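(* There exists a constant $\kappa_0$ with $1 > \kappa_0 > \frac12$ such that $$\#\{z\in\mathbb{C} : |z| = 1 \text{ and } f_p(z) = 0\} \sim \kappa_0\, p$$ as $p\to\infty$ through primes.
   Context: For an odd prime $p$, $\left(\frac{\cdot}{p}\right)$ denotes the Legendre symbol (with $\left(\frac{a}{p}\right)=0$ when $p\mid a$), and the Fekete polynomial is $f_p(t) := \sum_{a=0}^{p-1} \left(\frac{a}{p}\right) t^a$. *)

theory Defs
  imports
    Complex_Main
    "HOL-Library.Landau_Symbols"
    "HOL-Computational_Algebra.Polynomial"
    "HOL-Number_Theory.Number_Theory"
begin

definition fekete_poly :: "nat \<Rightarrow> complex poly" where
  "fekete_poly p = (\<Sum>a<p. Polynomial.monom (of_int (Legendre (int a) (int p))) a)"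

definition primes_at_top :: "nat filter" where
  "primes_at_top = inf at_top (principal {p. prime p})"

end

theory Submission
  imports Defs
begin

text \<open>
  Write \<open>\<chi>\<close> for the Legendre symbol modulo \<open>p\<close>. The \<open>p\<close>-th roots of unity cut the unit circle into \<open>p\<close> arcs.
  Expanding the relation \<open>f\<^sub>p(\<zeta>\<^sup>k) = \<chi>(k) f\<^sub>p(\<zeta>)\<close> into geometric series shows (\<open>fekete_on_arc\<close>) that the
  zeros on the arc from \<open>m/p\<close> to \<open>(m+1)/p\<close> are the zeros \<open>0 < x < 1\<close> of the real function
  \<open>G(x) = \<Sum>\<^sub>j \<chi>(m+j) cot(\<pi>(x-j)/p)\<close>, with \<open>j\<close> running over a complete system of residues.

  The poles at \<open>x = 0\<close> and \<open>x = 1\<close> govern this function. If \<open>\<chi>(m) = \<chi>(m+1)\<close> then \<open>G\<close> is strictly monotone with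
  opposite signs at the two ends, so there is exactly one zero; this happens for half of all \<open>m\<close> and
  accounts for the \<open>1/2\<close> in the density. If \<open>\<chi>(m) = -\<chi>(m+1)\<close> then, after multiplication by the sign \<open>\<chi>(m)\<close>,
  \<open>G\<close> is strictly convex and tends to \<open>+\<infinity>\<close> at both ends, so there are two zeros or none according to
  the sign of the minimum, apart from the borderline case of a double zero.

  After scaling, \<open>G\<close> is close to \<open>\<Sum> \<chi>(m+j)/(x-j)\<close> over \<open>\<bar>j\<bar> \<le> J\<close>: the remaining terms vary little with \<open>x\<close>, and their
  value at \<open>x = 0\<close> is small for most \<open>m\<close> by a second moment computation (\<open>far_sum_second_moment\<close>).
  So only the pattern of the signs \<open>\<chi>(m+j)\<close>, \<open>\<bar>j\<bar> \<le> J\<close>, matters, and every pattern occurs with the same asymptotic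
  frequency (\<open>pattern_density\<close>). This independence reduces to \<open>\<Sum>\<^sub>x \<chi>((x+s\<^sub>1)\<cdots>(x+s\<^sub>k)) = o(p)\<close> for fixed distinct
  \<open>s\<^sub>i\<close>. The bound comes from Stepanov's method (\<open>stepanov_bound\<close>), with an auxiliary polynomial
  whose order of vanishing stays fixed while \<open>p\<close> grows. It is carried out with integer polynomials modulo
  \<open>p\<close>, so that one type of polynomials serves all primes.

  It remains to treat random signs \<open>\<epsilon>\<^sub>j\<close>. The approximation could only go wrong when the minimum of the convex function is close
  to \<open>0\<close>, and this is rare: among the patterns that differ only at the positions \<open>j = 4, 16, 64, \<dots>\<close> at most
  one is affected, since the sizes of these terms separate the minima (\<open>card_near_tangent_le\<close>). Hence
  the proportion of zeros is within \<open>5/2\<^sup>r\<close> of a number depending on \<open>J\<close> alone, for \<open>J\<close> large in terms of \<open>r\<close> and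
  then \<open>p\<close> large; therefore it converges. The limit exceeds \<open>1/2\<close>
  because a negative minimum has positive probability: signs forced on a bounded block make the value at the midpoint negative,
  and a global sign change of the other terms shows that these do no harm half of the time
  (\<open>card_crossing_ge\<close>). It is less than \<open>1\<close> because the poles contribute at least \<open>4\<close>, so a negative minimum needs the other
  terms to be large, and Chebyshev's inequality bounds the probability of that (\<open>card_crossing_le\<close>).
\<close>

section \<open>Zeros of integer polynomials modulo a prime\<close>

text \<open>Divisibility in the polynomial ring over the field with \<open>p\<close> elements, expressed by integer
  polynomials. A type for that field would depend on \<open>p\<close>, while statements about all large primes
  need a type that does not.\<close>

definition mdvd :: "int \<Rightarrow> int poly \<Rightarrow> int poly \<Rightarrow> bool" where
  "mdvd p u q \<longleftrightarrow> (\<exists>h k. q = u * h + [:p:] * k)"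

text \<open>Synthetic division: the remainder is the value at \<open>b\<close>, which is absorbed by \<open>p\<close>. The degree of the
  quotient is recorded because a descent below terminates through it.\<close>

lemma linear_factor_mod:
  fixes q :: "int poly"
  assumes "p dvd poly q b"
  obtains h k where "q = [:-b, 1:] * h + [:p:] * k" "degree h = degree q - 1"
    "degree q = 0 \<Longrightarrow> h = 0"
proof -
  from assms obtain c where c: "poly q b = p * c" by (elim dvdE)
  have "q = [:-b, 1:] * synthetic_div q b + [:p:] * [:c:]"
    using synthetic_div_correct'[of b q] c by (simp add: mult.commute)
  then show ?thesis
    using that degree_synthetic_div[of q b] synthetic_div_eq_0_iff[of q b] by metis
qed

lemma monic_not_dvd_mod:
  fixes u :: "int poly"
  assumes "prime p" "lead_coeff u = 1"
  shows "\<not> [:p:] dvd u"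
  using assms by (metis const_poly_dvd_iff not_prime_unit)

lemma prime_elem_pconst: "prime (p::int) \<Longrightarrow> prime_elem [:p:]"
  by (rule lift_prime_elem_poly, rule prime_imp_prime_elem)

lemma prime_dvd_mult_mod:
  fixes u v :: "int poly"
  assumes "prime p" "[:p:] dvd u * v" "\<not> [:p:] dvd u"
  shows "[:p:] dvd v"
  using assms prime_elem_pconst prime_elem_dvd_multD by blast

text \<open>Comparing the two representations of \<open>q\<close> gives \<open>(x-b)\<^sup>l (u h - (x-b) h') \<in> (p)\<close>. The monic factor cancels because
  \<open>p\<close> stays prime in the polynomial ring, and evaluation at \<open>b\<close> then shows that \<open>h\<close> vanishes at \<open>b\<close>
  modulo \<open>p\<close>, which is one more factor \<open>x-b\<close>.\<close>

lemma mdvd_linear_step: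
  fixes q u :: "int poly"
  assumes p: "prime p" and ub: "\<not> p dvd poly u b"
    and 1: "mdvd p (u * [:-b, 1:] ^ l) q" and 2: "mdvd p ([:-b, 1:] ^ Suc l) q"
  shows "mdvd p (u * [:-b, 1:] ^ Suc l) q"
proof -
  let ?X = "[:-b, 1:] :: int poly"
  obtain h k where hk: "q = u * ?X ^ l * h + [:p:] * k"
    using 1 unfolding mdvd_def by blast
  obtain h' k' where hk': "q = ?X ^ Suc l * h' + [:p:] * k'"
    using 2 unfolding mdvd_def by blast
  have "?X ^ l * (u * h - ?X * h') = [:p:] * (k' - k)"
  proof -
    have "u * X ^ l * h + P * k = X ^ Suc l * h' + P * k' \<Longrightarrow>
        X ^ l * (u * h - X * h') = P * (k' - k)" for X P :: "int poly"
      by (simp add: algebra_simps)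
    thus ?thesis using hk hk' by metis
  qed
  hence "[:p:] dvd ?X ^ l * (u * h - ?X * h')" by (simp only: dvd_triv_left)
  moreover have "\<not> [:p:] dvd ?X ^ l"
    by (rule monic_not_dvd_mod[OF p]) (simp add: degree_linear_power coeff_linear_power)
  ultimately have "[:p:] dvd u * h - ?X * h'"
    using prime_dvd_mult_mod[OF p] by blast
  then obtain g where "u * h - ?X * h' = [:p:] * g" by (elim dvdE)
  hence "poly (u * h - ?X * h') b = poly ([:p:] * g) b" by simp
  hence "p dvd poly u b * poly h b" by simp
  hence "p dvd poly h b" using p ub prime_dvd_mult_iff by blast
  then obtain h2 k2 where h2: "h = ?X * h2 + [:p:] * k2"
    using linear_factor_mod by blast
  have "q = u * ?X ^ Suc l * h2 + [:p:] * (u * ?X ^ l * k2 + k)"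
    by (simp only: hk h2 power_Suc ring_distribs mult_ac add_ac)
  thus ?thesis unfolding mdvd_def by blast
qed

lemma mdvd_power_le:
  assumes "mdvd p (u ^ m) q" "l \<le> m"
  shows "mdvd p (u ^ l) q"
proof -
  obtain h k where "q = u ^ m * h + [:p:] * k" using assms unfolding mdvd_def by blast
  moreover have "u ^ m = u ^ l * u ^ (m - l)" using assms(2) by (simp flip: power_add)
  ultimately have "q = u ^ l * (u ^ (m - l) * h) + [:p:] * k" by (simp add: mult_ac)
  thus ?thesis unfolding mdvd_def by blast
qed

lemma mdvd_mult_linear_power:
  assumes p: "prime p" and ub: "\<not> p dvd poly u b" and 1: "mdvd p u q"
  shows "mdvd p ([:-b, 1:] ^ l) q \<Longrightarrow> mdvd p (u * [:-b, 1:] ^ l) q"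
proof (induction l)
  case 0 thus ?case using 1 by simp
next
  case (Suc l)
  thus ?case using mdvd_linear_step[OF p ub] mdvd_power_le[OF Suc.prems, of l] by simp
qed

lemma mdvd_prod_linear_power:
  assumes p: "prime p" and "finite X"
    and "\<And>a b. a \<in> X \<Longrightarrow> b \<in> X \<Longrightarrow> a \<noteq> b \<Longrightarrow> \<not> p dvd b - a"
    and "\<And>b. b \<in> X \<Longrightarrow> mdvd p ([:-b, 1:] ^ l) q"
  shows "mdvd p (\<Prod>b\<in>X. [:-b, 1:] ^ l) q"
  using assms(2-)
proof (induction X rule: finite_induct)
  case empty
  have "q = 1 * q + [:p:] * 0" by simp
  thus ?case unfolding mdvd_def prod.empty by blast
next
  case (insert x X)
  have "poly (\<Prod>b\<in>X. [:-b, 1:] ^ l) x = (\<Prod>b\<in>X. (x - b) ^ l)"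
    by (simp add: poly_prod poly_power)
  moreover have "\<not> p dvd (\<Prod>b\<in>X. (x - b) ^ l)"
  proof
    assume "p dvd (\<Prod>b\<in>X. (x - b) ^ l)"
    then obtain b where b: "b \<in> X" "p dvd (x - b) ^ l"
      using prime_dvd_prod_iff[OF insert.hyps(1) p, of "\<lambda>b. (x - b) ^ l"] by auto
    hence "p dvd x - b" using prime_dvd_power[OF p] by metis
    thus False using insert.prems(1)[of b x] insert.hyps b by auto
  qed
  ultimately have "mdvd p ((\<Prod>b\<in>X. [:-b, 1:] ^ l) * [:-x, 1:] ^ l) q"
    using insert by (intro mdvd_mult_linear_power[OF p]) auto
  thus ?case using insert.hyps by (simp add: mult.commute)
qed

text \<open>If \<open>u\<close> had larger degree than \<open>q\<close>, the leading coefficient of the quotient would be divisible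
  by \<open>p\<close> and could be dropped; repeating this leaves no quotient at all.\<close>

lemma mdvd_degree_le:
  fixes u q :: "int poly"
  assumes monic: "lead_coeff u = 1" and d: "mdvd p u q" and n: "\<not> [:p:] dvd q"
  shows "degree u \<le> degree q"
proof (rule ccontr)
  assume less: "\<not> degree u \<le> degree q"
  have u0: "u \<noteq> 0" using monic by auto
  have "q = u * h + [:p:] * k \<Longrightarrow> False" for h k
  proof (induction "degree h" arbitrary: h k rule: less_induct)
    case less
    show False
    proof (cases "h = 0")
      case True
      hence "q = [:p:] * k" using less.prems by simp
      thus False using n dvd_triv_left by metis
    next
      case False
      have "Polynomial.coeff q (degree u + degree h) = 0"
        using \<open>\<not> degree u \<le> degree q\<close> by (intro coeff_eq_0) simp
      hence "lead_coeff h = p * (- Polynomial.coeff k (degree u + degree h))"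
        using less.prems monic coeff_mult_degree_sum[of u h] by simp
      then obtain c where c: "lead_coeff h = p * c" by blast
      define h' where "h' = h - Polynomial.monom (lead_coeff h) (degree h)"
      have q': "q = u * h' + [:p:] * (k + u * Polynomial.monom c (degree h))"
      proof -
        have "Polynomial.monom (lead_coeff h) (degree h) = [:p:] * Polynomial.monom c (degree h)"
          by (simp add: c smult_monom)
        thus ?thesis using less.prems unfolding h'_def by (simp add: algebra_simps)
      qed
      show False
      proof (cases "degree h = 0")
        case True
        hence "h' = 0" unfolding h'_def
          by (metis cancel_comm_monoid_add_class.diff_cancel degree_0_id monom_0)
        hence "q = [:p:] * (k + u * Polynomial.monom c (degree h))"
          using q' by (simp only: mult_zero_right add_0)
        thus False using n dvd_triv_left by metis
      next
        case False
        have "Polynomial.coeff h' (degree h) = 0" by (simp add: h'_def)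
        moreover have "degree h' \<le> degree h" unfolding h'_def
          by (intro degree_diff_le degree_monom_le) simp
        ultimately have "degree h' < degree h" using False
          by (metis coeff_0 degree_0 degree_diff_less h'_def leading_coeff_0_iff le_neq_implies_less gr0I)
        thus False using less.hyps q' by blast
      qed
    qed
  qed
  thus False using d unfolding mdvd_def by blast
qed

lemma pderiv_funpow_add: "(pderiv ^^ n) (a + b) = (pderiv ^^ n) a + (pderiv ^^ n) (b :: 'a::idom poly)"
  by (induction n) (simp_all add: pderiv_add)

lemma pderiv_funpow_sum: "(pderiv ^^ n) (\<Sum>i\<in>I. a i) = (\<Sum>i\<in>I. (pderiv ^^ n) (a i :: 'a::idom poly))"
proof -
  have "(pderiv ^^ n) (0 :: 'a poly) = 0" by (induction n) simp_all
  thus ?thesis by (induction I rule: infinite_finite_induct) (simp_all add: pderiv_funpow_add)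
qed

lemma pderiv_funpow_const_mult: "(pderiv ^^ n) ([:p:] * a) = [:p:] * (pderiv ^^ n) (a :: 'a::idom poly)"
  by (induction n) (simp_all add: pderiv_smult)

lemma poly_pderiv_funpow_linear_power:
  fixes h :: "int poly"
  shows "poly ((pderiv ^^ n) ([:-a, 1:] ^ n * h)) a = fact n * poly h a"
proof (induction n arbitrary: h)
  case (Suc n)
  have "pderiv ([:-a, 1:] ^ Suc n * h)
        = [:-a, 1:] ^ n * (Polynomial.smult (of_nat (Suc n)) h + [:-a, 1:] * pderiv h)"
    by (simp only: pderiv_mult pderiv_power_Suc) (simp add: pderiv_pCons algebra_simps)
  hence "poly ((pderiv ^^ Suc n) ([:-a, 1:] ^ Suc n * h)) a
         = fact n * poly (Polynomial.smult (of_nat (Suc n)) h + [:-a, 1:] * pderiv h) a"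
    by (simp only: funpow_Suc_right o_apply Suc.IH)
  thus ?case by (simp add: algebra_simps)
qed simp

text \<open>The \<open>n\<close>-th derivative of \<open>(x-a)\<^sup>n h\<close> takes the value \<open>n! h(a)\<close> at \<open>a\<close>. Derivatives therefore detect the multiplicity
  of a zero as long as these factorials are units, which is why \<open>l\<close> may not exceed \<open>p\<close>.\<close>

lemma mdvd_linear_power_of_pderiv:
  fixes q :: "int poly"
  assumes p: "prime p"
  shows "int l \<le> p \<Longrightarrow> (\<And>n. n < l \<Longrightarrow> p dvd poly ((pderiv ^^ n) q) a) \<Longrightarrow> mdvd p ([:-a, 1:] ^ l) q"
proof (induction l)
  case 0
  have "q = 1 * q + [:p:] * 0" by simp
  thus ?case unfolding mdvd_def power_0 by blast
next
  case (Suc l)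
  obtain h k where hk: "q = [:-a, 1:] ^ l * h + [:p:] * k"
    using Suc unfolding mdvd_def by auto
  have "poly ((pderiv ^^ l) q) a = fact l * poly h a + p * poly ((pderiv ^^ l) k) a"
    unfolding hk pderiv_funpow_add pderiv_funpow_const_mult poly_add poly_pderiv_funpow_linear_power
    by simp
  hence "p dvd fact l * poly h a" using Suc.prems(2)[of l] by (simp add: dvd_add_left_iff)
  moreover have "\<not> p dvd fact l"
  proof -
    have "prime (nat p)" using p by simp
    hence "\<not> nat p dvd fact l" using Suc.prems(1) p by (simp add: prime_dvd_fact_iff nat_le_iff)
    hence "\<not> int (nat p) dvd int (fact l)" by (simp only: int_dvd_int_iff) simp
    thus ?thesis using p prime_gt_0_int[OF p] by simp
  qed
  ultimately have "p dvd poly h a" using p prime_dvd_mult_iff by blast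
  then obtain h2 k2 where h2: "h = [:-a, 1:] * h2 + [:p:] * k2"
    using linear_factor_mod by blast
  have "q = [:-a, 1:] ^ Suc l * h2 + [:p:] * ([:-a, 1:] ^ l * k2 + k)"
    by (simp only: hk h2 power_Suc ring_distribs mult_ac add_ac)
  thus ?case unfolding mdvd_def by blast
qed

text \<open>The counting principle of Stepanov's method: a polynomial of small degree with zeros of high order
  has few of them.\<close>

lemma card_high_order_zeros_le:
  fixes q :: "int poly"
  assumes p: "prime p" and fin: "finite X" and l: "int l \<le> p"
    and inc: "\<And>a b. a \<in> X \<Longrightarrow> b \<in> X \<Longrightarrow> a \<noteq> b \<Longrightarrow> \<not> p dvd b - a"
    and van: "\<And>a n. a \<in> X \<Longrightarrow> n < l \<Longrightarrow> p dvd poly ((pderiv ^^ n) q) a"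
    and nz: "\<not> [:p:] dvd q"
  shows "l * card X \<le> degree q"
proof -
  let ?u = "\<Prod>b\<in>X. [:-b, 1:] ^ l :: int poly"
  have "mdvd p ?u q"
    using mdvd_prod_linear_power[OF p fin inc] mdvd_linear_power_of_pderiv[OF p l van] by blast
  moreover have "lead_coeff ?u = 1"
    by (simp add: lead_coeff_prod degree_linear_power coeff_linear_power)
  moreover have "degree ?u = (\<Sum>b\<in>X. degree ([:-b, 1:] ^ l :: int poly))"
    by (rule degree_prod_eq_sum_degree) simp
  ultimately show ?thesis
    using mdvd_degree_le[OF _ _ nz, of ?u] by (simp add: degree_linear_power mult.commute)
qed

section \<open>Stepanov's auxiliary polynomial\<close>

text \<open>The polynomial that remains when the power \<open>f\<^sup>e\<^sup>-\<^sup>n\<close> is split off the \<open>n\<close>-th derivative of \<open>f\<^sup>e r\<close>. Its degree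
  grows by at most \<open>deg f\<close> per derivative, however large \<open>e\<close> is.\<close>

fun deriv_cofactor :: "int poly \<Rightarrow> nat \<Rightarrow> nat \<Rightarrow> int poly \<Rightarrow> int poly" where
  "deriv_cofactor f e 0 r = r"
| "deriv_cofactor f e (Suc n) r =
     Polynomial.smult (of_nat (e - n)) (pderiv f * deriv_cofactor f e n r) + f * pderiv (deriv_cofactor f e n r)"

lemma pderiv_funpow_power_mult:
  "n \<le> e \<Longrightarrow> (pderiv ^^ n) (f ^ e * r) = f ^ (e - n) * deriv_cofactor f e n r"
proof (induction n)
  case (Suc n)
  have e: "e - n = Suc (e - Suc n)" using Suc.prems by simp
  have "(pderiv ^^ Suc n) (f ^ e * r) = pderiv (f ^ (e - n) * deriv_cofactor f e n r)"
    using Suc by simp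
  also have "\<dots> = f ^ (e - Suc n) * deriv_cofactor f e (Suc n) r"
    unfolding deriv_cofactor.simps e pderiv_mult pderiv_power_Suc
    by (simp add: algebra_simps)
  finally show ?case .
qed simp

lemma deriv_cofactor_diff:
  "deriv_cofactor f e n (r - r') = deriv_cofactor f e n r - deriv_cofactor f e n r'"
proof (induction n)
  case (Suc n)
  show ?case unfolding deriv_cofactor.simps Suc.IH
    by (simp add: pderiv_diff smult_diff_right algebra_simps)
qed simp

lemma degree_deriv_cofactor_le: "degree (deriv_cofactor f e n r) \<le> degree r + n * degree f"
proof (induction n)
  case (Suc n)
  let ?T = "deriv_cofactor f e n r"
  have "degree (pderiv f * ?T) \<le> degree (pderiv f) + degree ?T" by (rule degree_mult_le)
  also have "\<dots> \<le> degree f + (degree r + n * degree f)"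
    using Suc by (intro add_mono) (simp_all add: degree_pderiv)
  finally have 1: "degree (Polynomial.smult (of_nat (e - n)) (pderiv f * ?T)) \<le> degree r + Suc n * degree f"
    by (intro order.trans[OF degree_smult_le]) simp
  have "degree (f * pderiv ?T) \<le> degree f + degree (pderiv ?T)" by (rule degree_mult_le)
  also have "\<dots> \<le> degree f + (degree r + n * degree f)"
    using Suc by (intro add_mono) (simp_all add: degree_pderiv)
  finally have 2: "degree (f * pderiv ?T) \<le> degree r + Suc n * degree f" by simp
  show ?case unfolding deriv_cofactor.simps using 1 2 by (rule degree_add_le)
qed simp

text \<open>In characteristic \<open>p\<close>, powers of \<open>x\<^sup>p\<close> behave like constants under differentiation.\<close>

lemma pderiv_funpow_mult_monom_mod:
  fixes g :: "int poly"
  assumes "p dvd int m"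
  shows "[:p:] dvd (pderiv ^^ n) (g * Polynomial.monom 1 m) - (pderiv ^^ n) g * Polynomial.monom 1 m"
proof (induction n)
  case (Suc n)
  then obtain k where "(pderiv ^^ n) (g * Polynomial.monom 1 m) - (pderiv ^^ n) g * Polynomial.monom 1 m = [:p:] * k"
    by (elim dvdE)
  hence k: "(pderiv ^^ n) (g * Polynomial.monom 1 m) = (pderiv ^^ n) g * Polynomial.monom 1 m + [:p:] * k"
    by (simp add: algebra_simps)
  obtain c where c: "int m = p * c" using assms by (elim dvdE)
  have m: "Polynomial.monom (c * p) (m - 1) = [:p:] * Polynomial.monom c (m - 1)"
    by (simp add: smult_monom mult.commute)
  have "(pderiv ^^ Suc n) (g * Polynomial.monom 1 m) - (pderiv ^^ Suc n) g * Polynomial.monom 1 m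
      = [:p:] * ((pderiv ^^ n) g * Polynomial.monom c (m - 1) + pderiv k)"
    unfolding funpow.simps o_apply k pderiv_add pderiv_mult pderiv_monom mult_1_right of_nat_id
    by (simp add: algebra_simps pderiv_smult c m pderiv_monom del: One_nat_def)
  thus ?case by (metis dvd_triv_left)
qed simp

text \<open>A homogeneous linear system modulo \<open>p\<close> with more unknowns than equations has a nontrivial
  solution. There are more vectors of residues than values, so two of them collide, and their
  difference is a solution.\<close>

lemma siegel_mod:
  fixes L :: "('u \<Rightarrow> int) \<Rightarrow> 'w \<Rightarrow> int" and p :: int
  assumes fin: "finite U" "finite W" and card: "card W < card U" and p: "p > 1"
    and lin: "\<And>v v' y. y \<in> W \<Longrightarrow> L (\<lambda>u. v u - v' u) y = L v y - L v' y"
  obtains w where "\<exists>u\<in>U. \<not> p dvd w u" "\<forall>y\<in>W. p dvd L w y"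
proof -
  define V where "V = PiE U (\<lambda>_. {0..<p})"
  define Z where "Z = PiE W (\<lambda>_. {0..<p})"
  define F where "F = (\<lambda>v. restrict (\<lambda>y. L v y mod p) W)"
  have sub: "F ` V \<subseteq> Z" using p unfolding F_def Z_def by auto
  have "card (F ` V) \<le> card Z"
    by (rule card_mono[OF _ sub]) (simp add: Z_def fin finite_PiE)
  also have "\<dots> = nat p ^ card W" using p unfolding Z_def by (simp add: card_PiE fin)
  also have "\<dots> < nat p ^ card U" using p card by (intro power_strict_increasing) auto
  also have "\<dots> = card V" using p unfolding V_def by (simp add: card_PiE fin)
  finally have "\<not> inj_on F V" by (rule pigeonhole)
  then obtain v v' where v: "v \<in> V" "v' \<in> V" "v \<noteq> v'" "F v = F v'" unfolding inj_on_def by blast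
  have "\<exists>u\<in>U. v u \<noteq> v' u" using v(1-3) unfolding V_def by (meson PiE_ext)
  then obtain u where u: "u \<in> U" "v u \<noteq> v' u" by blast
  have "v u \<in> {0..<p}" "v' u \<in> {0..<p}" using v u unfolding V_def by auto
  hence "\<not> p dvd v u - v' u" using u(2) dvd_imp_le_int[of "v u - v' u" p] by auto
  moreover have "p dvd L (\<lambda>u. v u - v' u) y" if "y \<in> W" for y
  proof -
    have "L v y mod p = L v' y mod p" using fun_cong[OF v(4), of y] that unfolding F_def by simp
    thus ?thesis using lin[OF that] by (simp add: mod_eq_dvd_iff)
  qed
  ultimately show ?thesis using that[of "\<lambda>u. v u - v' u"] u(1) by blast
qed

text \<open>Modulo \<open>p\<close> the equation \<open>f r\<^sup>2 = b s\<^sup>2\<close> with a simple zero \<open>c\<close> of \<open>f\<close> would give \<open>c\<close> odd order on one side and even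
  order on the other. The proof removes a factor \<open>x-c\<close> from both \<open>s\<close> and \<open>r\<close> and descends.\<close>

lemma square_form_descent:
  fixes r s f1 :: "int poly" and b c p :: int
  assumes p: "prime p" and b: "\<not> p dvd b" and f1: "\<not> p dvd poly f1 c"
  shows "[:p:] dvd [:-c, 1:] * f1 * r ^ 2 - [:b:] * s ^ 2 \<Longrightarrow> [:p:] dvd r \<and> [:p:] dvd s"
proof (induction "degree r + degree s" arbitrary: r s rule: less_induct)
  case less
  define X where "X = [:-c, 1:]"
  define P where "P = [:p:]"
  define B where "B = [:b:]"
  have nX: "\<not> P dvd X" unfolding P_def X_def by (rule monic_not_dvd_mod[OF p]) simp
  have ev: "p dvd poly u c" if "P dvd u" for u
  proof -
    obtain k where "u = P * k" using \<open>P dvd u\<close> by (elim dvdE)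
    thus ?thesis by (simp add: P_def)
  qed
  have d: "P dvd X * f1 * r ^ 2 - B * s ^ 2" using less.prems by (simp only: X_def P_def B_def)
  have "p dvd b * poly s c ^ 2" using ev[OF d] by (simp add: X_def B_def)
  hence "p dvd poly s c" using p b prime_dvd_mult_iff prime_dvd_power by blast
  then obtain s' ks where s': "s = X * s' + P * ks" "degree s' = degree s - 1" "degree s = 0 \<Longrightarrow> s' = 0"
    using linear_factor_mod unfolding X_def P_def by metis
  have "X * (f1 * r ^ 2 - B * X * s' ^ 2) =
      (X * f1 * r ^ 2 - B * s ^ 2) + P * (B * ks * (2 * X * s' + P * ks))"
    unfolding s'(1) by (simp add: algebra_simps power2_eq_square)
  hence "P dvd X * (f1 * r ^ 2 - B * X * s' ^ 2)" using d dvd_add[OF d dvd_triv_left] by metis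
  hence d2: "P dvd f1 * r ^ 2 - B * X * s' ^ 2"
    using prime_dvd_mult_mod[OF p, of X] nX unfolding P_def by blast
  have "p dvd poly f1 c * poly r c ^ 2" using ev[OF d2] by (simp add: X_def B_def)
  hence "p dvd poly r c" using p f1 prime_dvd_mult_iff prime_dvd_power by blast
  then obtain r' kr where r': "r = X * r' + P * kr" "degree r' = degree r - 1" "degree r = 0 \<Longrightarrow> r' = 0"
    using linear_factor_mod unfolding X_def P_def by metis
  have "X * (X * f1 * r' ^ 2 - B * s' ^ 2) =
      (f1 * r ^ 2 - B * X * s' ^ 2) - P * (f1 * kr * (2 * X * r' + P * kr))"
    unfolding r'(1) by (simp add: algebra_simps power2_eq_square)
  hence "P dvd X * (X * f1 * r' ^ 2 - B * s' ^ 2)" using dvd_diff[OF d2 dvd_triv_left] by metis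
  hence d3: "P dvd X * f1 * r' ^ 2 - B * s' ^ 2"
    using prime_dvd_mult_mod[OF p, of X] nX unfolding P_def by blast
  have "P dvd r' \<and> P dvd s'"
  proof (cases "degree r + degree s = 0")
    case True thus ?thesis using r'(3) s'(3) by simp
  next
    case False
    hence "degree r' + degree s' < degree r + degree s" using r'(2) s'(2) by linarith
    thus ?thesis using less.hyps[of r' s'] d3 by (simp only: X_def P_def B_def)
  qed
  thus ?case unfolding r'(1) s'(1) P_def[symmetric] by (simp add: dvd_add)
qed

lemma fermat_little_int:
  fixes p :: nat
  assumes p: "prime p"
  shows "[s ^ p = s] (mod int p)"
proof -
  define t where "t = nat (s mod int p)"
  have t: "int t = s mod int p" using prime_gt_0_nat[OF p] unfolding t_def by simp
  have "[t ^ p = t] (mod p)"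
  proof (cases "p dvd t")
    case True
    hence "p dvd t ^ p" using dvd_trans[OF True dvd_power] prime_gt_0_nat[OF p] by blast
    thus ?thesis using True by (simp add: cong_def mod_eq_0_iff_dvd)
  next
    case False
    have "[t ^ (p - 1) * t = 1 * t] (mod p)"
      using fermat_theorem[OF p False] by (rule cong_scalar_right)
    thus ?thesis using prime_gt_0_nat[OF p] by (simp flip: power_Suc2)
  qed
  hence "[int t ^ p = int t] (mod int p)" by (metis cong_int_iff of_nat_power)
  moreover have "s ^ p mod int p = int t ^ p mod int p" unfolding t by (simp add: power_mod)
  ultimately show ?thesis unfolding cong_def t by simp
qed

text \<open>The Frobenius map on a linear polynomial: the inner binomial coefficients are divisible by \<open>p\<close>.\<close>

lemma linear_power_prime_mod:
  fixes p :: nat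
  assumes p: "prime p"
  shows "[:int p:] dvd [:s, 1:] ^ p - ([:s:] + Polynomial.monom 1 p)"
proof -
  have "int p dvd Polynomial.coeff ([:s, 1:] ^ p - ([:s:] + Polynomial.monom 1 p)) k" for k
  proof -
    consider "k = 0" | "0 < k" "k < p" | "k = p" | "k > p" by linarith
    thus ?thesis
    proof cases
      case 1
      have "[s ^ p = s] (mod int p)" by (rule fermat_little_int[OF p])
      thus ?thesis using 1 prime_gt_0_nat[OF p]
        by (simp add: coeff_linear_poly_power cong_iff_dvd_diff)
    next
      case 2
      have "p dvd (p choose k)" using p 2 by (intro dvd_choose_prime) auto
      hence "int p dvd int (p choose k)" by simp
      moreover have "Polynomial.coeff ([:s, 1:] ^ p - ([:s:] + Polynomial.monom 1 p)) k = int (p choose k) * s ^ (p - k)"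
        using 2 by (simp add: coeff_linear_poly_power coeff_pCons split: nat.splits)
      ultimately show ?thesis by simp
    next
      case 3
      thus ?thesis using prime_gt_0_nat[OF p]
        by (simp add: coeff_linear_poly_power coeff_pCons split: nat.splits)
    next
      case 4
      hence "Polynomial.coeff ([:s, 1:] ^ p) k = 0" by (intro coeff_eq_0) (simp add: degree_linear_power)
      thus ?thesis using 4 by (simp add: coeff_pCons split: nat.splits)
    qed
  qed
  thus ?thesis by (simp add: const_poly_dvd_iff)
qed

text \<open>Consequently \<open>f\<^sup>p\<close> is congruent to the constant \<open>f(0)\<close> modulo \<open>x\<^sup>p\<close> and \<open>p\<close>.\<close>

lemma prod_linear_power_prime_mod:
  fixes p :: nat and S :: "int set"
  assumes p: "prime p" and "finite S"
  shows "\<exists>A k. (\<Prod>s\<in>S. [:s, 1:]) ^ p = [:\<Prod>S:] + Polynomial.monom 1 p * A + [:int p:] * k"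
  using assms(2)
proof (induction S rule: finite_induct)
  case empty
  have "(\<Prod>s\<in>{}. [:s, 1:]) ^ p = [:\<Prod>{}::int:] + Polynomial.monom 1 p * 0 + [:int p:] * 0"
    by (simp flip: one_pCons)
  thus ?case by blast
next
  case (insert x S)
  define M where "M = (Polynomial.monom 1 p :: int poly)"
  define P where "P = [:int p:]"
  obtain A k where A: "(\<Prod>s\<in>S. [:s, 1:]) ^ p = [:\<Prod>S:] + M * A + P * k"
    using insert.IH unfolding M_def P_def by blast
  obtain k' where "[:x, 1:] ^ p - ([:x:] + M) = P * k'"
    using linear_power_prime_mod[OF p, of x] unfolding M_def P_def by (elim dvdE)
  hence k': "[:x, 1:] ^ p = [:x:] + M + P * k'" by (simp add: algebra_simps)
  have "(\<Prod>s\<in>insert x S. [:s, 1:]) ^ p = [:x, 1:] ^ p * (\<Prod>s\<in>S. [:s, 1:]) ^ p"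
    by (simp only: prod.insert[OF insert.hyps] power_mult_distrib)
  also have "\<dots> = ([:x:] + M + P * k') * ([:\<Prod>S:] + M * A + P * k)"
    by (simp only: A k')
  also have "\<dots> = [:x:] * [:\<Prod>S:] + M * ([:x:] * A + [:\<Prod>S:] + M * A + P * k)
       + P * (k' * ([:\<Prod>S:] + M * A + P * k) + [:x:] * k)"
    by (simp only: ring_distribs mult_ac add_ac)
  also have "[:x:] * [:\<Prod>S:] = [:\<Prod>(insert x S):]"
    using insert.hyps by simp
  finally show ?case unfolding M_def P_def by blast
qed

text \<open>The functions \<open>1\<close> and \<open>f\<^sup>c\<close>, \<open>c = (p-1)/2\<close>, are linearly independent over polynomials of small degree,
  even modulo \<open>x\<^sup>p\<close>. Since \<open>f\<^sup>2\<^sup>c\<^sup>+\<^sup>1 = f\<^sup>p\<close> is constant there, a dependence would give \<open>f r\<^sup>2 = f(0) s\<^sup>2\<close> modulo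
  \<open>x\<^sup>p\<close>, hence identically for degree reasons, which the descent excludes. The zeros of \<open>f\<close> avoid \<open>0\<close>
  modulo \<open>p\<close> in order that \<open>f(0)\<close> be a unit.\<close>

lemma power_basis_independent_mod:
  fixes p :: nat and S :: "int set" and r s A :: "int poly"
  assumes p: "prime p" and pc: "p = 2 * c + 1" and S: "finite S" "S \<noteq> {}" "S \<subseteq> {0<..<int p}"
    and deg: "2 * degree r + card S < p" "2 * degree s < p"
    and f: "f = (\<Prod>s\<in>S. [:s, 1:])"
    and dv: "[:int p:] dvd r + f ^ c * s + Polynomial.monom 1 p * A"
  shows "[:int p:] dvd r \<and> [:int p:] dvd s"
proof -
  define M where "M = (Polynomial.monom 1 p :: int poly)"
  define P where "P = [:int p:]"
  define b where "b = \<Prod>S"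
  have pi: "prime (int p)" using p by simp
  obtain A' k where A': "f ^ p = [:b:] + M * A' + P * k"
    using prod_linear_power_prime_mod[OF p S(1)] unfolding f M_def P_def b_def by blast
  have fp: "f ^ c * f ^ c * f = f ^ p" unfolding pc by (simp add: power_add mult_2)
  \<comment> \<open>Multiplying by \<open>f (r - f\<^sup>c s)\<close> leaves only the power \<open>f\<^sup>2\<^sup>c\<^sup>+\<^sup>1 = f\<^sup>p\<close> of \<open>f\<close>.\<close>
  have "(r + f ^ c * s + M * A) * (f * (r - f ^ c * s))
      = f * r ^ 2 - (f ^ c * f ^ c * f) * s ^ 2 + M * (A * f * (r - f ^ c * s))"
    by (simp add: algebra_simps power2_eq_square)
  also have "\<dots> = (f * r ^ 2 - [:b:] * s ^ 2 + M * (A * f * (r - f ^ c * s) - A' * s ^ 2)) - P * (k * s ^ 2)"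
    unfolding fp A' by (simp add: algebra_simps)
  finally have eq: "f * r ^ 2 - [:b:] * s ^ 2 + M * (A * f * (r - f ^ c * s) - A' * s ^ 2)
    = (r + f ^ c * s + M * A) * (f * (r - f ^ c * s)) + P * (k * s ^ 2)" by (simp only: diff_add_cancel)
  have "P dvd f * r ^ 2 - [:b:] * s ^ 2 + M * (A * f * (r - f ^ c * s) - A' * s ^ 2)"
    unfolding eq by (intro dvd_add dvd_mult2[OF dv[folded M_def P_def]] dvd_triv_left)
  then have dA: "P dvd f * r ^ 2 - [:b:] * s ^ 2 + M * (A * f * (r - f ^ c * s) - A' * s ^ 2)" .
  have degf: "degree f = card S" unfolding f by (subst degree_prod_eq_sum_degree) auto
  have "int p dvd Polynomial.coeff (f * r ^ 2 - [:b:] * s ^ 2) n" for n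
  proof (cases "n < p")
    case True
    have "int p dvd Polynomial.coeff (f * r ^ 2 - [:b:] * s ^ 2 + M * (A * f * (r - f ^ c * s) - A' * s ^ 2)) n"
      using dA unfolding P_def const_poly_dvd_iff by blast
    moreover have "Polynomial.coeff (M * (A * f * (r - f ^ c * s) - A' * s ^ 2)) n = 0"
      using True unfolding M_def by (simp add: coeff_monom_mult)
    ultimately show ?thesis by (simp only: coeff_add add_0_right)
  next
    case False
    have "degree (f * r ^ 2) < p"
    proof -
      have "degree (f * r ^ 2) \<le> degree f + degree (r ^ 2)" by (rule degree_mult_le)
      also have "degree (r ^ 2) \<le> degree r * 2" by (rule degree_power_le)
      finally show ?thesis using deg(1) degf by linarith
    qed
    moreover have "degree ([:b:] * s ^ 2) < p"
    proof -
      have "degree ([:b:] * s ^ 2) \<le> degree [:b:] + degree (s ^ 2)" by (rule degree_mult_le)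
      also have "degree (s ^ 2) \<le> degree s * 2" by (rule degree_power_le)
      finally show ?thesis using deg(2) by simp
    qed
    ultimately have "degree (f * r ^ 2 - [:b:] * s ^ 2) < p" by (rule degree_diff_less)
    hence "Polynomial.coeff (f * r ^ 2 - [:b:] * s ^ 2) n = 0" using False by (intro coeff_eq_0) simp
    thus ?thesis by simp
  qed
  hence d: "[:int p:] dvd f * r ^ 2 - [:b:] * s ^ 2" by (simp only: const_poly_dvd_iff) blast
  obtain s0 where s0: "s0 \<in> S" using S(2) by blast
  define f1 where "f1 = (\<Prod>s\<in>S-{s0}. [:s, 1:])"
  have ff1: "f = [:-(-s0), 1:] * f1" unfolding f f1_def minus_minus using S(1) s0 by (rule prod.remove)
  have small: "\<not> int p dvd x" if "\<bar>x\<bar> < int p" "x \<noteq> 0" for x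
    using that dvd_imp_le_int[of x "int p"] by auto
  have nb: "\<not> int p dvd b"
  proof
    assume "int p dvd b"
    then obtain x where "x \<in> S" "int p dvd x"
      using prime_dvd_prod_iff[OF S(1) pi, of "\<lambda>x. x"] unfolding b_def by auto
    thus False using small[of x] S(3) by auto
  qed
  have "poly f1 (-s0) = (\<Prod>s\<in>S-{s0}. s - s0)" by (simp add: f1_def poly_prod)
  moreover have "\<not> int p dvd (\<Prod>s\<in>S-{s0}. s - s0)"
  proof
    assume "int p dvd (\<Prod>s\<in>S-{s0}. s - s0)"
    then obtain x where "x \<in> S" "x \<noteq> s0" "int p dvd x - s0"
      using prime_dvd_prod_iff[of "S-{s0}" "int p" "\<lambda>x. x - s0"] pi S(1) by auto
    moreover have "x \<in> {0<..<int p}" "s0 \<in> {0<..<int p}" using S(3) s0 \<open>x \<in> S\<close> by blast+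
    hence "\<bar>x - s0\<bar> < int p" by auto
    ultimately show False using small[of "x - s0"] by auto
  qed
  ultimately have "\<not> int p dvd poly f1 (-s0)" by simp
  from square_form_descent[OF pi nb this] d show ?thesis unfolding ff1 by blast
qed

text \<open>The lowest term that is nonzero modulo \<open>p\<close> decides: after division by its power of \<open>x\<^sup>p\<close>, the higher terms
  vanish modulo \<open>x\<^sup>p\<close>.\<close>

lemma stepanov_sum_independent_mod:
  fixes p :: nat and S :: "int set" and r s :: "nat \<Rightarrow> int poly"
  assumes p: "prime p" and pc: "p = 2 * c + 1" and S: "finite S" "S \<noteq> {}" "S \<subseteq> {0<..<int p}"
    and deg: "\<And>j. 2 * degree (r j) + card S < p" "\<And>j. 2 * degree (s j) < p"
    and f: "f = (\<Prod>s\<in>S. [:s, 1:])"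
    and dv: "[:int p:] dvd (\<Sum>j<K. (r j + f ^ c * s j) * Polynomial.monom 1 (j * p))"
  shows "j < K \<Longrightarrow> [:int p:] dvd r j \<and> [:int p:] dvd s j"
proof (induction j rule: less_induct)
  case (less j)
  define g where "g i = r i + f ^ c * s i" for i
  define M where "M i = (Polynomial.monom 1 i :: int poly)" for i
  have M: "M (a + b) = M a * M b" for a b by (simp add: M_def mult_monom)
  have small: "[:int p:] dvd (\<Sum>i<j. g i * M (i * p))"
    using less unfolding g_def by (intro dvd_sum dvd_mult2 dvd_add dvd_mult) auto
  define h where "h i = g i * M (i * p)" for i
  have "{..<K} = {..<j} \<union> ({j} \<union> {j<..<K})" using less.prems by auto
  hence "sum h {..<K} = sum h ({..<j} \<union> ({j} \<union> {j<..<K}))" by (rule arg_cong)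
  also have "\<dots> = sum h {..<j} + sum h ({j} \<union> {j<..<K})" by (rule sum.union_disjoint) auto
  also have "sum h ({j} \<union> {j<..<K}) = h j + sum h {j<..<K}" by (subst sum.union_disjoint) auto
  finally have "(\<Sum>i<K. g i * M (i * p)) =
      (\<Sum>i<j. g i * M (i * p)) + (g j * M (j * p) + (\<Sum>i\<in>{j<..<K}. g i * M (i * p)))"
    unfolding h_def .
  also have "(\<Sum>i\<in>{j<..<K}. g i * M (i * p)) = M (j * p) * (M p * (\<Sum>i\<in>{j<..<K}. g i * M ((i - j - 1) * p)))"
  proof -
    have "g i * M (i * p) = M (j * p) * (M p * (g i * M ((i - j - 1) * p)))" if "i \<in> {j<..<K}" for i
    proof -
      obtain l where "i = Suc (j + l)" using \<open>i \<in> {j<..<K}\<close> less_imp_Suc_add by auto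
      hence "i * p = j * p + (p + (i - j - 1) * p)" by (simp add: algebra_simps)
      thus ?thesis by (simp add: M mult_ac)
    qed
    thus ?thesis unfolding sum_distrib_left by (intro sum.cong refl)
  qed
  finally have "(\<Sum>i<K. g i * M (i * p)) = (\<Sum>i<j. g i * M (i * p)) + (g j * M (j * p)
      + M (j * p) * (M p * (\<Sum>i\<in>{j<..<K}. g i * M ((i - j - 1) * p))))" .
  hence "[:int p:] dvd (\<Sum>i<j. g i * M (i * p)) + (g j * M (j * p)
      + M (j * p) * (M p * (\<Sum>i\<in>{j<..<K}. g i * M ((i - j - 1) * p))))"
    using dv unfolding g_def M_def by metis
  hence "[:int p:] dvd g j * M (j * p) + M (j * p) * (M p * (\<Sum>i\<in>{j<..<K}. g i * M ((i - j - 1) * p)))"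
    using small dvd_add_right_iff by blast
  hence "[:int p:] dvd M (j * p) * (g j + M p * (\<Sum>i\<in>{j<..<K}. g i * M ((i - j - 1) * p)))"
    by (simp only: distrib_left mult.commute)
  note dM = this
  have pi: "prime (int p)" using p by simp
  have nM: "\<not> [:int p:] dvd M (j * p)"
    by (rule monic_not_dvd_mod[OF pi]) (simp add: M_def degree_monom_eq)
  note prime_dvd_mult_mod[OF pi dM nM]
  thus ?case unfolding g_def M_def
    using power_basis_independent_mod[OF p pc S deg(1)[of j] deg(2)[of j] f] by blast
qed

lemma Legendre_cong_power:
  assumes "prime p" "p = 2 * c + 1"
  shows "[x ^ c = Legendre x (int p)] (mod int p)"
proof -
  have "p > 2" using prime_ge_2_nat[OF assms(1)] assms(2) by presburger
  thus ?thesis using euler_criterion[OF assms(1), of x] assms(2) by (simp add: cong_sym)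
qed

text \<open>Put \<open>l = 2t\<close> and \<open>d = deg f\<close>. The auxiliary polynomial is
  \<open>R = \<Sum> (f\<^sup>l r\<^sub>j + f\<^sup>l\<^sup>+\<^sup>c s\<^sub>j) x\<^sup>j\<^sup>p\<close>, summed over \<open>0 \<le> j \<le> t\<close>, with unknown \<open>r\<^sub>j, s\<^sub>j\<close> of degree less than \<open>B = c - d\<close>.
  At a point \<open>x\<close> with \<open>f(x)\<^sup>c = a\<close> one has \<open>x\<^sup>p = x\<close>, so the \<open>n\<close>-th derivative of \<open>R\<close> takes the value
  \<open>f(x)\<^sup>l\<^sup>-\<^sup>n \<sigma>\<^sub>n(x)\<close> with a polynomial \<open>\<sigma>\<^sub>n\<close> that no longer contains any power of \<open>x\<^sup>p\<close>, and hence has degree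
  below \<open>E = B + ld + t + 1\<close> only. Requiring \<open>\<sigma>\<^sub>n = 0\<close> for all \<open>n < l\<close> is a system of \<open>lE\<close> equations in
  \<open>2(t+1)B\<close> unknowns, and the surplus of \<open>2B\<close> unknowns gained from the term \<open>j = t\<close> pays for the lower
  order part of \<open>lE\<close>. Then \<open>R\<close> vanishes to order \<open>l\<close> at every such \<open>x\<close>, while its degree exceeds \<open>tp\<close> by little more
  than \<open>(d+1)p/2\<close>; dividing by \<open>l = 2t\<close> gives a count close to \<open>p/2\<close> when \<open>t\<close> is large.\<close>

lemma stepanov_bound:
  fixes p :: nat and S :: "int set" and a :: int
  assumes p: "prime p" and pc: "p = 2 * c + 1" and S: "finite S" "S \<noteq> {}" "S \<subseteq> {0<..<int p}"
    and t: "t > 0" and c: "card S + t * (2 * t * card S + t + 1) < c"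
  shows "2 * t * card {x\<in>{0..<int p}. Legendre (\<Prod>s\<in>S. x + s) (int p) = a}
      \<le> (2 * t + c) * card S + c + t * p"
proof -
  define d where "d = card S"
  define l where "l = 2 * t"
  define K where "K = t + 1"
  define B where "B = c - d"
  define E where "E = B + l * d + K"
  define f where "f = (\<Prod>s\<in>S. [:s, 1:] :: int poly)"
  define P where "P = int p"
  have pi: "prime P" using p unfolding P_def by simp
  have dc: "d < c" using c unfolding d_def by simp
  have Bpos: "B > 0" using dc unfolding B_def by simp
  have degf: "degree f = d" unfolding f_def d_def by (subst degree_prod_eq_sum_degree) auto
  define q where "q v j b = (\<Sum>i<B. Polynomial.monom (v (j, b, i)) i)"
    for v :: "nat \<times> bool \<times> nat \<Rightarrow> int" and j b
  define sg where "sg v n = (\<Sum>j<K. (deriv_cofactor f l n (q v j True)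
      + Polynomial.smult a (deriv_cofactor f (l + c) n (q v j False))) * Polynomial.monom 1 j)"
    for v n
  define L where "L = (\<lambda>v (n, m). Polynomial.coeff (sg v n) m)"
  have q_diff: "q (\<lambda>u. v u - v' u) j b = q v j b - q v' j b" for v v' j b
    unfolding q_def by (simp add: sum_subtractf flip: diff_monom)
  have deg_q: "degree (q v j b) < B" for v j b
  proof -
    have "degree (q v j b) \<le> B - 1" unfolding q_def
      by (intro degree_sum_le) (auto intro!: order.trans[OF degree_monom_le])
    thus ?thesis using Bpos by simp
  qed
  have coeff_q: "Polynomial.coeff (q v j b) i = v (j, b, i)" if "i < B" for v j b i
    using that unfolding q_def by (simp add: coeff_sum)
  obtain w where w: "\<exists>u\<in>{..<K} \<times> UNIV \<times> {..<B}. \<not> P dvd w u"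
    "\<forall>y\<in>{..<l} \<times> {..<E}. P dvd L w y"
  proof (rule siegel_mod[of "{..<K} \<times> UNIV \<times> {..<B}" "{..<l} \<times> {..<E}" P L])
    show "finite ({..<K} \<times> (UNIV::bool set) \<times> {..<B})" "finite ({..<l} \<times> {..<E})" by auto
    show "P > 1" using pi prime_gt_1_int by blast
    have "t * (2 * t * d + t + 1) < B" using c dc unfolding B_def d_def by linarith
    hence "2 * t * E < 2 * K * B" unfolding E_def K_def l_def by (simp add: algebra_simps)
    thus "card ({..<l} \<times> {..<E}) < card ({..<K} \<times> (UNIV::bool set) \<times> {..<B})"
      by (simp add: card_cartesian_product l_def mult_ac)
    show "L (\<lambda>u. v u - v' u) y = L v y - L v' y" for v v' y
    proof -
      have "sg (\<lambda>u. v u - v' u) n = sg v n - sg v' n" for n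
        unfolding sg_def q_diff deriv_cofactor_diff sum_subtractf[symmetric]
        by (intro sum.cong refl) (simp add: smult_diff_right algebra_simps)
      thus ?thesis unfolding L_def by (cases y) simp
    qed
  qed blast
  have deg_sg: "degree (sg w n) < E" if "n < l" for n
  proof -
    have "degree ((deriv_cofactor f l n (q w j True)
      + Polynomial.smult a (deriv_cofactor f (l + c) n (q w j False))) * Polynomial.monom 1 j) \<le> E - 1"
      if "j < K" for j
    proof -
      have "degree (deriv_cofactor f e n (q w j b)) \<le> (B - 1) + l * d" for e b
      proof -
        have "n * d \<le> l * d" using \<open>n < l\<close> by simp
        thus ?thesis using degree_deriv_cofactor_le[of f e n "q w j b"] deg_q[of w j b]
          unfolding degf by linarith
      qed
      hence "degree (deriv_cofactor f l n (q w j True)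
          + Polynomial.smult a (deriv_cofactor f (l + c) n (q w j False))) \<le> (B - 1) + l * d"
        by (intro degree_add_le order.trans[OF degree_smult_le]) auto
      moreover have "degree (Polynomial.monom (1::int) j) \<le> j" by (rule degree_monom_le)
      ultimately show ?thesis using \<open>j < K\<close> Bpos unfolding E_def
        by (intro order.trans[OF degree_mult_le]) linarith
    qed
    hence "degree (sg w n) \<le> E - 1" unfolding sg_def by (intro degree_sum_le) auto
    thus ?thesis using Bpos unfolding E_def by linarith
  qed
  have sg0: "P dvd poly (sg w n) x" if "n < l" for n x
  proof -
    have "P dvd Polynomial.coeff (sg w n) m" for m
    proof (cases "m < E")
      case True
      thus ?thesis using w(2) that unfolding L_def by auto
    next
      case False
      thus ?thesis using deg_sg[OF that] by (simp add: coeff_eq_0)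
    qed
    hence "[:P:] dvd sg w n" by (simp only: const_poly_dvd_iff) blast
    then obtain k where "sg w n = [:P:] * k" by (elim dvdE)
    thus ?thesis by simp
  qed
  define H where "H j = f ^ l * q w j True + f ^ (l + c) * q w j False" for j
  define R where "R = (\<Sum>j<K. H j * Polynomial.monom 1 (j * p))"
  define X where "X = {x\<in>{0..<int p}. Legendre (\<Prod>s\<in>S. x + s) (int p) = a}"
  have van: "P dvd poly ((pderiv ^^ n) R) x" if x: "x \<in> X" and n: "n < l" for x n
  proof -
    define y where "y = poly f x"
    have y: "y = (\<Prod>s\<in>S. x + s)" unfolding y_def f_def by (simp add: poly_prod add.commute)
    have yc: "[y ^ c = a] (mod P)"
      using Legendre_cong_power[OF p pc, of y] x unfolding X_def y P_def by simp
    have term_cong: "[poly ((pderiv ^^ n) (H j * Polynomial.monom 1 (j * p))) x =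
        y ^ (l - n) * poly ((deriv_cofactor f l n (q w j True)
          + Polynomial.smult a (deriv_cofactor f (l + c) n (q w j False))) * Polynomial.monom 1 j) x] (mod P)"
      for j
    proof -
      define r s where "r = poly (deriv_cofactor f l n (q w j True)) x"
        and "s = poly (deriv_cofactor f (l + c) n (q w j False)) x"
      have "[:P:] dvd (pderiv ^^ n) (H j * Polynomial.monom 1 (j * p)) - (pderiv ^^ n) (H j) * Polynomial.monom 1 (j * p)"
        by (rule pderiv_funpow_mult_monom_mod) (simp add: P_def)
      then obtain k where "(pderiv ^^ n) (H j * Polynomial.monom 1 (j * p)) - (pderiv ^^ n) (H j) * Polynomial.monom 1 (j * p) = [:P:] * k"
        by (elim dvdE)
      hence "poly ((pderiv ^^ n) (H j * Polynomial.monom 1 (j * p)) - (pderiv ^^ n) (H j) * Polynomial.monom 1 (j * p)) x = P * poly k x"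
        by simp
      hence "[poly ((pderiv ^^ n) (H j * Polynomial.monom 1 (j * p))) x
          = poly ((pderiv ^^ n) (H j) * Polynomial.monom 1 (j * p)) x] (mod P)"
        by (simp add: cong_iff_dvd_diff)
      also have "(pderiv ^^ n) (H j) = f ^ (l - n) * deriv_cofactor f l n (q w j True)
          + f ^ (l + c - n) * deriv_cofactor f (l + c) n (q w j False)"
        unfolding H_def pderiv_funpow_add using n by (simp add: pderiv_funpow_power_mult)
      also have "poly ((f ^ (l - n) * deriv_cofactor f l n (q w j True)
          + f ^ (l + c - n) * deriv_cofactor f (l + c) n (q w j False)) * Polynomial.monom 1 (j * p)) x
          = y ^ (l - n) * (r + y ^ c * s) * (x ^ p) ^ j"
      proof -
        have "l + c - n = (l - n) + c" using n by simp
        thus ?thesis by (simp add: poly_monom r_def s_def power_add y_def power_mult[symmetric] mult.commute[of p j] algebra_simps)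
      qed
      also have "[y ^ (l - n) * (r + y ^ c * s) * (x ^ p) ^ j = y ^ (l - n) * (r + a * s) * x ^ j] (mod P)"
        using yc fermat_little_int[OF p, of x, folded P_def]
        by (intro cong_mult cong_add cong_pow cong_refl)
      also have "y ^ (l - n) * (r + a * s) * x ^ j = y ^ (l - n) * poly ((deriv_cofactor f l n (q w j True)
          + Polynomial.smult a (deriv_cofactor f (l + c) n (q w j False))) * Polynomial.monom 1 j) x"
        by (simp add: poly_monom r_def s_def)
      finally show ?thesis .
    qed
    have "poly ((pderiv ^^ n) R) x = (\<Sum>j<K. poly ((pderiv ^^ n) (H j * Polynomial.monom 1 (j * p))) x)"
      unfolding R_def pderiv_funpow_sum by (simp add: poly_sum)
    also have "[\<dots> = (\<Sum>j<K. y ^ (l - n) * poly ((deriv_cofactor f l n (q w j True)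
          + Polynomial.smult a (deriv_cofactor f (l + c) n (q w j False))) * Polynomial.monom 1 j) x)] (mod P)"
      by (intro cong_sum term_cong)
    also have "(\<Sum>j<K. y ^ (l - n) * poly ((deriv_cofactor f l n (q w j True)
          + Polynomial.smult a (deriv_cofactor f (l + c) n (q w j False))) * Polynomial.monom 1 j) x)
        = y ^ (l - n) * poly (sg w n) x"
      unfolding sg_def poly_sum by (simp only: sum_distrib_left)
    finally show ?thesis using sg0[OF n] by (metis cong_dvd_iff dvd_mult)
  qed
  have nz: "\<not> [:P:] dvd R"
  proof
    assume "[:P:] dvd R"
    moreover have "R = f ^ l * (\<Sum>j<K. (q w j True + f ^ c * q w j False) * Polynomial.monom 1 (j * p))"
      unfolding R_def H_def sum_distrib_left by (simp add: power_add algebra_simps)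
    moreover have "\<not> [:P:] dvd f ^ l"
      by (rule monic_not_dvd_mod[OF pi]) (simp add: f_def lead_coeff_power lead_coeff_prod)
    ultimately have d: "[:P:] dvd (\<Sum>j<K. (q w j True + f ^ c * q w j False) * Polynomial.monom 1 (j * p))"
      using prime_dvd_mult_mod[OF pi] by metis
    obtain j b i where u: "j < K" "i < B" "\<not> P dvd w (j, b, i)" using w(1) by auto
    have "[:int p:] dvd q w j True \<and> [:int p:] dvd q w j False"
    proof (rule stepanov_sum_independent_mod[OF p pc S _ _ f_def _ u(1)])
      show "2 * degree (q w j True) + card S < p" for j
        using deg_q[of w j True] dc pc unfolding B_def d_def by linarith
      show "2 * degree (q w j False) < p" for j
        using deg_q[of w j False] dc pc unfolding B_def d_def by linarith
      show "[:int p:] dvd (\<Sum>j<K. (q w j True + f ^ c * q w j False) * Polynomial.monom 1 (j * p))"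
        using d unfolding P_def .
    qed
    hence "[:P:] dvd q w j b" by (cases b) (auto simp: P_def)
    hence "P dvd w (j, b, i)" unfolding const_poly_dvd_iff using coeff_q[OF u(2), of w j b] by metis
    thus False using u(3) by simp
  qed
  have "int l \<le> P"
  proof -
    have "t * 2 \<le> t * (2 * t * card S + t + 1)" using t by (intro mult_left_mono) auto
    hence "l < c" using c unfolding l_def by linarith
    thus ?thesis unfolding P_def pc by simp
  qed
  hence "l * card X \<le> degree R"
  proof (rule card_high_order_zeros_le[OF pi, rotated])
    show "finite X" unfolding X_def by (rule finite_subset[of _ "{0..<int p}"]) auto
    show "\<not> P dvd b - a" if "a \<in> X" "b \<in> X" "a \<noteq> b" for a b
      using that dvd_imp_le_int[of "b - a" P] unfolding X_def P_def by auto
  qed (use van nz in auto)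
  also have "degree R \<le> (l + c) * d + c + t * p"
  proof -
    have "degree (H j * Polynomial.monom 1 (j * p)) \<le> (l + c) * d + c + t * p" if "j < K" for j
    proof -
      have fe: "degree (f ^ e * q w j b) \<le> (l + c) * d + c" if "e \<le> l + c" for e b
      proof -
        have "degree (f ^ e) \<le> d * e" using degree_power_le[of f e] degf by simp
        also have "\<dots> \<le> (l + c) * d" using that by (simp add: mult.commute)
        finally show ?thesis using deg_q[of w j b] degree_mult_le[of "f ^ e" "q w j b"]
          unfolding B_def by linarith
      qed
      have "degree (H j) \<le> (l + c) * d + c" unfolding H_def by (intro degree_add_le fe) auto
      moreover have "degree (Polynomial.monom (1::int) (j * p)) \<le> j * p" by (rule degree_monom_le)
      moreover have "j * p \<le> t * p" using that unfolding K_def by simp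
      ultimately show ?thesis by (intro order.trans[OF degree_mult_le]) linarith
    qed
    thus ?thesis unfolding R_def by (intro degree_sum_le) auto
  qed
  finally show ?thesis unfolding X_def l_def d_def .
qed

section \<open>Equidistribution of patterns of Legendre symbols\<close>

lemma eventually_primes_at_top:
  "eventually P primes_at_top \<longleftrightarrow> (\<exists>N. \<forall>p\<ge>N. prime p \<longrightarrow> P p)"
  unfolding primes_at_top_def by (simp add: eventually_inf_principal eventually_at_top_linorder)

lemma tendsto_primes_at_top: "(f \<longlongrightarrow> L) at_top \<Longrightarrow> (f \<longlongrightarrow> L) primes_at_top"
  unfolding primes_at_top_def by (erule tendsto_mono[rotated]) simp

lemma Legendre_range: "Legendre x m \<in> {-1, 0, 1}"
  by (simp add: Legendre_def)

lemma Legendre_eq_0_iff: "Legendre x m = 0 \<longleftrightarrow> m dvd x"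
  by (simp add: Legendre_def cong_0_iff)

lemma Legendre_cong: "[x = y] (mod m) \<Longrightarrow> Legendre x m = Legendre y m"
  by (simp add: Legendre_def QuadRes_def cong_def)

lemma Legendre_eq_if_cong:
  assumes "p > 2" "[u = v] (mod int p)" "u \<in> {-1, 0, 1}" "v \<in> {-1, 0, 1 :: int}"
  shows "u = v"
proof (rule ccontr)
  assume "u \<noteq> v"
  moreover have "int p dvd u - v" using assms(2) by (simp add: cong_iff_dvd_diff)
  ultimately have "int p \<le> \<bar>u - v\<bar>" using dvd_imp_le_int[of "u - v" "int p"] by simp
  thus False using assms by auto
qed

lemma odd_prime_form:
  fixes p :: nat
  assumes "prime p" "p > 2"
  obtains c where "p = 2 * c + 1" "c > 0"
proof -
  have "odd p" using assms prime_odd_nat by blast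
  then obtain c where "p = 2 * c + 1" by (elim oddE)
  thus ?thesis using that assms(2) by simp
qed

lemma Legendre_mult:
  assumes "prime p" "p > 2"
  shows "Legendre (x * y) (int p) = Legendre x (int p) * Legendre y (int p)"
proof -
  obtain c where c: "p = 2 * c + 1" using odd_prime_form[OF assms] by blast
  note P = Legendre_cong_power[OF assms(1) c]
  have "[x ^ c * y ^ c = Legendre x (int p) * Legendre y (int p)] (mod int p)"
    by (intro cong_mult P)
  moreover have "[x ^ c * y ^ c = Legendre (x * y) (int p)] (mod int p)"
    using P[of "x * y"] by (simp add: power_mult_distrib)
  ultimately have "[Legendre (x * y) (int p) = Legendre x (int p) * Legendre y (int p)] (mod int p)"
    using cong_sym cong_trans by metis
  thus ?thesis
    using Legendre_range[of x "int p"] Legendre_range[of y "int p"] Legendre_range[of "x * y" "int p"]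
    by (intro Legendre_eq_if_cong[OF assms(2)]) auto
qed

lemma Legendre_1: "p > 1 \<Longrightarrow> Legendre 1 (int p) = 1"
  unfolding Legendre_def QuadRes_def by (auto simp: cong_0_iff intro!: exI[of _ 1])

lemma Legendre_prod:
  assumes "prime p" "p > 2"
  shows "Legendre (\<Prod>i\<in>A. g i) (int p) = (\<Prod>i\<in>A. Legendre (g i) (int p))"
  using Legendre_1[of p] assms(2)
  by (induction A rule: infinite_finite_induct) (simp_all add: Legendre_mult[OF assms])

lemma sum_residues_shift:
  fixes g :: "int \<Rightarrow> 'a::comm_monoid_add"
  assumes p: "p > 0" and per: "\<And>x y. [x = y] (mod p) \<Longrightarrow> g x = g y"
  shows "(\<Sum>x\<in>{0..<p}. g (x + k)) = (\<Sum>x\<in>{0..<p}. g x)"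
proof (rule sum.reindex_bij_witness[of _ "\<lambda>x. (x - k) mod p" "\<lambda>x. (x + k) mod p"])
  show "g ((x + k) mod p) = g (x + k)" for x by (rule per) (simp add: cong_def)
qed (use p in \<open>auto simp: mod_simps\<close>)

lemma card_residues_dvd_le_1:
  assumes "p > 0"
  shows "card {x\<in>{0..<p}. p dvd x + (s::int)} \<le> 1"
proof (rule card_le_Suc0_iff_eq[THEN iffD2, unfolded One_nat_def[symmetric]])
  show "\<forall>a\<in>{x\<in>{0..<p}. p dvd x + s}. \<forall>b\<in>{x\<in>{0..<p}. p dvd x + s}. a = b"
  proof (intro ballI)
    fix a b assume "a \<in> {x\<in>{0..<p}. p dvd x + s}" "b \<in> {x\<in>{0..<p}. p dvd x + s}"
    hence ab: "p dvd a + s" "p dvd b + s" "0 \<le> a" "a < p" "0 \<le> b" "b < p" by auto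
    have "p dvd a - b" using dvd_diff[OF ab(1,2)] by simp
    moreover have "\<bar>a - b\<bar> < p" using ab by linarith
    ultimately show "a = b" using dvd_imp_le_int[of "a - b" p] by auto
  qed
qed (rule finite_subset[of _ "{0..<p}"], auto)

lemma card_residues_Ex_dvd_le:
  assumes "p > 0" "finite S"
  shows "card {x\<in>{0..<p}. \<exists>s\<in>S. p dvd x + (s::int)} \<le> card S"
proof -
  have "{x\<in>{0..<p}. \<exists>s\<in>S. p dvd x + s} = (\<Union>s\<in>S. {x\<in>{0..<p}. p dvd x + s})" by auto
  hence "card {x\<in>{0..<p}. \<exists>s\<in>S. p dvd x + s} \<le> (\<Sum>s\<in>S. card {x\<in>{0..<p}. p dvd x + s})"
    using card_UN_le[OF assms(2)] by metis
  also have "\<dots> \<le> (\<Sum>s\<in>S. 1)" by (intro sum_mono card_residues_dvd_le_1 assms)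
  finally show ?thesis by simp
qed

lemma sum_of_values:
  fixes g :: "'a \<Rightarrow> int"
  assumes "finite A" "\<And>x. x \<in> A \<Longrightarrow> g x \<in> {-1, 0, 1}"
  shows "(\<Sum>x\<in>A. g x) = int (card {x\<in>A. g x = 1}) - int (card {x\<in>A. g x = -1})"
    and "card A = card {x\<in>A. g x = 1} + card {x\<in>A. g x = -1} + card {x\<in>A. g x = 0}"
proof -
  have "(\<Sum>x\<in>A. g x) = (\<Sum>x\<in>A. (if g x = 1 then 1 else 0) - (if g x = -1 then 1 else 0))"
    using assms(2) by (intro sum.cong) fastforce+
  thus "(\<Sum>x\<in>A. g x) = int (card {x\<in>A. g x = 1}) - int (card {x\<in>A. g x = -1})"
    using assms(1) by (simp add: sum_subtractf sum.If_cases Int_def)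
  have "A = ({x\<in>A. g x = 1} \<union> {x\<in>A. g x = -1}) \<union> {x\<in>A. g x = 0}" using assms(2) by auto
  hence "card A = card (({x\<in>A. g x = 1} \<union> {x\<in>A. g x = -1}) \<union> {x\<in>A. g x = 0})" by metis
  also have "\<dots> = card ({x\<in>A. g x = 1} \<union> {x\<in>A. g x = -1}) + card {x\<in>A. g x = 0}"
    using assms(1) by (intro card_Un_disjoint) auto
  also have "card ({x\<in>A. g x = 1} \<union> {x\<in>A. g x = -1}) = card {x\<in>A. g x = 1} + card {x\<in>A. g x = -1}"
    using assms(1) by (intro card_Un_disjoint) auto
  finally show "card A = card {x\<in>A. g x = 1} + card {x\<in>A. g x = -1} + card {x\<in>A. g x = 0}" .
qed

text \<open>Neither of the values \<open>1\<close> and \<open>-1\<close> is taken much more often than \<open>p/2\<close> times, and \<open>0\<close> is taken a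
  bounded number of times; so both are taken close to \<open>p/2\<close> times and cancel.\<close>

lemma character_sum_small_pos:
  assumes S: "finite S" "S \<noteq> {}" "S \<subseteq> {0<..<D}" and e: "e > (0::real)"
  shows "\<forall>\<^sub>F p in primes_at_top.
    \<bar>real_of_int (\<Sum>x\<in>{0..<int p}. \<Prod>s\<in>S. Legendre (x + s) (int p))\<bar> \<le> e * real p"
proof -
  define d where "d = card S"
  \<comment> \<open>The error term \<open>p (d+1)/(4t)\<close> of the bound has to be at most \<open>e p/4\<close>.\<close>
  obtain t :: nat where t: "real (d + 1) / e < real t" using reals_Archimedean2 by blast
  have t0: "t > 0" using t e by (intro gr0I) (simp add: field_simps)
  define m where "m = d + t * (2 * t * d + t + 1)"
  define N where "N = nat D + 2 * m + nat \<lceil>6 * real d / e\<rceil> + 4"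
  have "\<bar>real_of_int (\<Sum>x\<in>{0..<int p}. \<Prod>s\<in>S. Legendre (x + s) (int p))\<bar> \<le> e * real p"
    if p: "prime p" "p \<ge> N" for p
  proof -
    have p2: "p > 2" using p unfolding N_def by linarith
    obtain c where c: "p = 2 * c + 1" using odd_prime_form[OF p(1) p2] by blast
    have "m < c" using p c unfolding N_def by linarith
    hence cc: "d + t * (2 * t * d + t + 1) < c" unfolding m_def .
    have sub: "S \<subseteq> {0<..<int p}" using S(3) p unfolding N_def by (auto dest!: subsetD)
    define g where "g x = Legendre (\<Prod>s\<in>S. x + s) (int p)" for x
    have "2 * real t * real (card {x\<in>{0..<int p}. g x = a}) \<le> (2 * real t + c) * d + c + real t * p" for a
    proof -
      have "2 * t * card {x\<in>{0..<int p}. g x = a} \<le> (2 * t + c) * d + c + t * p"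
        unfolding g_def d_def
        using stepanov_bound[OF p(1) c S(1,2) sub t0 cc[unfolded d_def]] by blast
      hence "real (2 * t * card {x\<in>{0..<int p}. g x = a}) \<le> real ((2 * t + c) * d + c + t * p)"
        by (simp only: of_nat_le_iff)
      thus ?thesis by simp
    qed
    moreover have "(2 * real t + c) * d + c + real t * p \<le> 2 * real t * (p / 2 + d + e * p / 4)"
    proof -
      have "real c * (d + 1) \<le> (p / 2) * (d + 1)" using c by (intro mult_right_mono) auto
      also have "\<dots> \<le> (p / 2) * (e * t)"
        using t e by (intro mult_left_mono) (auto simp: field_simps)
      finally show ?thesis by (simp add: algebra_simps)
    qed
    ultimately have "2 * real t * real (card {x\<in>{0..<int p}. g x = a}) \<le> 2 * real t * (p / 2 + d + e * p / 4)" for a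
      using order.trans by blast
    hence bound: "real (card {x\<in>{0..<int p}. g x = a}) \<le> p / 2 + d + e * p / 4" for a
      using t0 by (simp add: mult_le_cancel_left)
    have zero: "card {x\<in>{0..<int p}. g x = 0} \<le> d"
    proof -
      have "{x\<in>{0..<int p}. g x = 0} = {x\<in>{0..<int p}. \<exists>s\<in>S. int p dvd x + s}"
        using prime_dvd_prod_iff[OF S(1), of "int p"] p(1) by (auto simp: g_def Legendre_eq_0_iff)
      thus ?thesis using card_residues_Ex_dvd_le[of "int p" S] S(1) p2 unfolding d_def by simp
    qed
    have "(\<Sum>x\<in>{0..<int p}. \<Prod>s\<in>S. Legendre (x + s) (int p)) = (\<Sum>x\<in>{0..<int p}. g x)"
      unfolding g_def by (simp add: Legendre_prod[OF p(1) p2])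
    moreover have "(\<Sum>x\<in>{0..<int p}. g x) = int (card {x\<in>{0..<int p}. g x = 1}) - int (card {x\<in>{0..<int p}. g x = -1})"
      by (intro sum_of_values) (auto simp: g_def Legendre_range[simplified])
    moreover have "card {0..<int p} = card {x\<in>{0..<int p}. g x = 1} + card {x\<in>{0..<int p}. g x = -1} + card {x\<in>{0..<int p}. g x = 0}"
      by (intro sum_of_values) (auto simp: g_def Legendre_range[simplified])
    moreover have "3 * d \<le> e * p / 2"
    proof -
      have "6 * real d / e \<le> p" using p(2) unfolding N_def by linarith
      thus ?thesis using e by (simp add: field_simps)
    qed
    ultimately show ?thesis using bound[of 1] bound[of "-1"] zero by (simp add: abs_le_iff)
  qed
  thus ?thesis unfolding eventually_primes_at_top by blast
qed

lemma character_sum_small: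
  assumes S: "finite S" "S \<noteq> {}"
  shows "((\<lambda>p. real_of_int (\<Sum>x\<in>{0..<int p}. \<Prod>s\<in>S. Legendre (x + s) (int p)) / real p) \<longlongrightarrow> 0) primes_at_top"
proof (rule tendstoI)
  fix e :: real assume e: "e > 0"
  define k where "k = 1 - Min S"
  define S' where "S' = (\<lambda>s. s + k) ` S"
  have S': "finite S'" "S' \<noteq> {}" "S' \<subseteq> {0<..<Max S + k + 1}"
  proof -
    have "s + k \<in> {0<..<Max S + k + 1}" if "s \<in> S" for s
      using Min_le[OF S(1) that] Max_ge[OF S(1) that] unfolding k_def
      by (simp only: greaterThanLessThan_iff) linarith
    thus "S' \<subseteq> {0<..<Max S + k + 1}" unfolding S'_def by blast
  qed (use S in \<open>auto simp: S'_def\<close>)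
  have "\<forall>\<^sub>F p in primes_at_top. p > 0 \<and>
     \<bar>real_of_int (\<Sum>x\<in>{0..<int p}. \<Prod>s\<in>S'. Legendre (x + s) (int p))\<bar> \<le> (e / 2) * real p"
    using character_sum_small_pos[OF S', of "e / 2"] e
    by (intro eventually_conj) (auto simp: eventually_primes_at_top intro: exI[of _ 1])
  thus "\<forall>\<^sub>F p in primes_at_top. dist (real_of_int (\<Sum>x\<in>{0..<int p}. \<Prod>s\<in>S. Legendre (x + s) (int p)) / real p) 0 < e"
  proof eventually_elim
    case (elim p)
    have "(\<Sum>x\<in>{0..<int p}. \<Prod>s\<in>S'. Legendre (x + s) (int p))
        = (\<Sum>x\<in>{0..<int p}. \<Prod>s\<in>S. Legendre ((x + k) + s) (int p))"
      unfolding S'_def by (subst prod.reindex) (auto simp: inj_on_def add_ac)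
    also have "\<dots> = (\<Sum>x\<in>{0..<int p}. \<Prod>s\<in>S. Legendre (x + s) (int p))"
      using elim by (intro sum_residues_shift[of "int p" "\<lambda>x. \<Prod>s\<in>S. Legendre (x + s) (int p)"] prod.cong refl Legendre_cong)
        (auto intro: cong_add)
    finally have "\<bar>real_of_int (\<Sum>x\<in>{0..<int p}. \<Prod>s\<in>S. Legendre (x + s) (int p))\<bar> \<le> (e / 2) * real p"
      using elim by simp
    hence "\<bar>real_of_int (\<Sum>x\<in>{0..<int p}. \<Prod>s\<in>S. Legendre (x + s) (int p))\<bar> / real p \<le> e / 2"
      using elim by (simp add: divide_le_eq)
    hence "\<bar>real_of_int (\<Sum>x\<in>{0..<int p}. \<Prod>s\<in>S. Legendre (x + s) (int p))\<bar> / real p < e"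
      using e by linarith
    thus ?case by (simp add: dist_real_def)
  qed
qed

definition sign_patterns :: "int set \<Rightarrow> (int \<Rightarrow> int) set" where
  "sign_patterns I = PiE I (\<lambda>_. {-1, 1})"

text \<open>Restricting the function makes patterns on a finite set of positions elements of a finite product set.\<close>

definition legendre_pattern :: "int set \<Rightarrow> nat \<Rightarrow> int \<Rightarrow> int \<Rightarrow> int" where
  "legendre_pattern I p x = restrict (\<lambda>j. Legendre (x + j) (int p)) I"

lemma finite_sign_patterns: "finite I \<Longrightarrow> finite (sign_patterns I)"
  unfolding sign_patterns_def by (intro finite_PiE) auto

lemma card_sign_patterns: "finite I \<Longrightarrow> card (sign_patterns I) = 2 ^ card I"
  unfolding sign_patterns_def by (simp add: card_PiE numeral_2_eq_2)

text \<open>For all but boundedly many \<open>x\<close>, the product of the factors \<open>1 + q\<^sub>j \<chi>(x+j)\<close> equals \<open>2\<^sup>\<bar>\<^sup>I\<^sup>\<bar>\<close> if \<open>x\<close> has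
  the pattern \<open>q\<close> and \<open>0\<close> otherwise. In the expansion over subsets of \<open>I\<close> only the empty subset
  contributes to the main term; the others are character sums.\<close>

lemma single_pattern_density:
  assumes I: "finite I" and q: "q \<in> sign_patterns I"
  shows "((\<lambda>p. real (card {x\<in>{0..<int p}. legendre_pattern I p x = q}) / real p)
    \<longlongrightarrow> 1 / 2 ^ card I) primes_at_top"
proof -
  define C where "C p = {x\<in>{0..<int p}. legendre_pattern I p x = q}" for p
  define W where "W p x = (\<Prod>j\<in>I. q j * Legendre (x + j) (int p) + 1)" for p x
  define T where "T X p = (\<Sum>x\<in>{0..<int p}. \<Prod>s\<in>X. Legendre (x + s) (int p))" for X p
  have q1: "q j = 1 \<or> q j = -1" if "j \<in> I" for j using q that unfolding sign_patterns_def by blast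
  have expand: "(\<Sum>x\<in>{0..<int p}. W p x) = (\<Sum>X\<in>Pow I. (\<Prod>j\<in>X. q j) * T X p)" for p
  proof -
    have "W p x = (\<Sum>X\<in>Pow I. (\<Prod>j\<in>X. q j) * (\<Prod>j\<in>X. Legendre (x + j) (int p)))" for x
      unfolding W_def by (subst prod_add[OF I]) (simp add: prod.distrib)
    thus ?thesis unfolding T_def by (simp add: sum_distrib_left sum.swap[of _ "Pow I"])
  qed
  have "((\<lambda>p. \<Sum>X\<in>Pow I. real_of_int (\<Prod>j\<in>X. q j) * (real_of_int (T X p) / real p)) \<longlongrightarrow>
      (\<Sum>X\<in>Pow I. real_of_int (\<Prod>j\<in>X. q j) * (if X = {} then 1 else 0))) primes_at_top"
  proof (intro tendsto_sum tendsto_mult tendsto_const)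
    fix X assume X: "X \<in> Pow I"
    show "((\<lambda>p. real_of_int (T X p) / real p) \<longlongrightarrow> (if X = {} then 1 else 0)) primes_at_top"
    proof (cases "X = {}")
      case True
      have "\<forall>\<^sub>F p in primes_at_top. real_of_int (T X p) / real p = 1"
        unfolding eventually_primes_at_top T_def True by (intro exI[of _ 1]) auto
      thus ?thesis unfolding if_P[OF True] by (rule tendsto_eventually)
    next
      case False
      thus ?thesis using X I character_sum_small[of X] finite_subset unfolding T_def by auto
    qed
  qed
  moreover have "(\<Sum>X\<in>Pow I. real_of_int (\<Prod>j\<in>X. q j) * (if X = {} then 1 else 0)) = 1"
    using I by (subst sum.mono_neutral_right[of "Pow I" "{{}}"]) auto
  moreover have "(\<Sum>X\<in>Pow I. real_of_int (\<Prod>j\<in>X. q j) * (real_of_int (T X p) / real p))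
      = real_of_int (\<Sum>x\<in>{0..<int p}. W p x) / real p" for p
    unfolding expand by (simp add: sum_divide_distrib)
  ultimately have lim1: "((\<lambda>p. real_of_int (\<Sum>x\<in>{0..<int p}. W p x) / real p) \<longlongrightarrow> 1) primes_at_top"
    by simp
  have err: "\<bar>real_of_int (\<Sum>x\<in>{0..<int p}. W p x) - 2 ^ card I * real (card (C p))\<bar> \<le> 2 ^ card I * card I"
    if "p > 0" for p
  proof -
    define Z where "Z = {x\<in>{0..<int p}. \<exists>s\<in>I. int p dvd x + s}"
    have Zf: "finite Z" unfolding Z_def by (rule finite_subset[of _ "{0..<int p}"]) auto
    have W_val: "W p x = (if x \<in> C p then 2 ^ card I else 0)" if x: "x \<in> {0..<int p}" "x \<notin> Z" for x
    proof -
      have nz: "Legendre (x + j) (int p) = 1 \<or> Legendre (x + j) (int p) = -1" if "j \<in> I" for j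
        using Legendre_range[of "x + j" "int p"] Legendre_eq_0_iff[of "x + j" "int p"] x that
        unfolding Z_def by auto
      show ?thesis
      proof (cases "x \<in> C p")
        case True
        hence "Legendre (x + j) (int p) = q j" if "j \<in> I" for j
          using that unfolding C_def legendre_pattern_def by (auto simp: fun_eq_iff restrict_def split: if_splits)
        hence "W p x = (\<Prod>j\<in>I. 2)" unfolding W_def using q1 by (intro prod.cong) fastforce+
        thus ?thesis using True by simp
      next
        case False
        have "\<exists>j\<in>I. Legendre (x + j) (int p) \<noteq> q j"
        proof (rule ccontr)
          assume "\<not> ?thesis"
          hence "legendre_pattern I p x j = q j" for j
            using PiE_arb[OF q[unfolded sign_patterns_def], of j]
            by (cases "j \<in> I") (auto simp: legendre_pattern_def)
          hence "legendre_pattern I p x = q" by blast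
          thus False using False x unfolding C_def by simp
        qed
        then obtain j where "j \<in> I" "Legendre (x + j) (int p) \<noteq> q j" by blast
        hence "\<exists>j\<in>I. q j * Legendre (x + j) (int p) + 1 = 0" using nz[of j] q1[of j] by (intro bexI[of _ j]) auto
        thus ?thesis unfolding W_def using I False by (simp add: prod_zero_iff)
      qed
    qed
    have W_range: "0 \<le> W p x \<and> W p x \<le> 2 ^ card I" for x
    proof -
      have "0 \<le> q j * Legendre (x + j) (int p) + 1 \<and> q j * Legendre (x + j) (int p) + 1 \<le> 2" if "j \<in> I" for j
        using q1[OF that] Legendre_range[of "x + j" "int p"] by auto
      thus ?thesis unfolding W_def using prod_mono[of I "\<lambda>j. q j * Legendre (x + j) (int p) + 1" "\<lambda>_. 2"]
        by (auto intro: prod_nonneg)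
    qed
    have Csub: "C p \<subseteq> {0..<int p}" unfolding C_def by auto
    have "2 ^ card I * int (card (C p)) = (\<Sum>x\<in>{0..<int p}. if x \<in> C p then 2 ^ card I else 0)"
      using Csub by (simp add: sum.If_cases Int_absorb1)
    hence "(\<Sum>x\<in>{0..<int p}. W p x) - 2 ^ card I * int (card (C p))
       = (\<Sum>x\<in>{0..<int p}. W p x - (if x \<in> C p then 2 ^ card I else 0))"
      by (simp only: sum_subtractf)
    also have "\<dots> = (\<Sum>x\<in>Z. W p x - (if x \<in> C p then 2 ^ card I else 0))"
      by (rule sum.mono_neutral_right) (auto simp: Z_def W_val[unfolded Z_def])
    finally have "\<bar>(\<Sum>x\<in>{0..<int p}. W p x) - 2 ^ card I * int (card (C p))\<bar>
        \<le> (\<Sum>x\<in>Z. \<bar>W p x - (if x \<in> C p then 2 ^ card I else 0)\<bar>)" by simp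
    also have "\<dots> \<le> (\<Sum>x\<in>Z. 2 ^ card I)" using W_range by (intro sum_mono) auto
    also have "\<dots> = 2 ^ card I * int (card Z)" by simp
    also have "\<dots> \<le> 2 ^ card I * int (card I)"
      using card_residues_Ex_dvd_le[of "int p" I] I that unfolding Z_def by simp
    finally have "real_of_int \<bar>(\<Sum>x\<in>{0..<int p}. W p x) - 2 ^ card I * int (card (C p))\<bar>
      \<le> real_of_int (2 ^ card I * int (card I))" by (simp only: of_int_le_iff)
    thus ?thesis by simp
  qed
  have "((\<lambda>p. real_of_int (\<Sum>x\<in>{0..<int p}. W p x) / real p - 2 ^ card I * (real (card (C p)) / real p)) \<longlongrightarrow> 0) primes_at_top"
  proof (rule tendsto_0_le[where K = 1])
    show "((\<lambda>p. (2 ^ card I * card I) / real p) \<longlongrightarrow> 0) primes_at_top"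
      by (rule tendsto_primes_at_top[OF real_tendsto_divide_at_top[OF tendsto_const filterlim_real_sequentially]])
    have bnd: "norm (real_of_int (\<Sum>x\<in>{0..<int p}. W p x) / real p - 2 ^ card I * (real (card (C p)) / real p))
        \<le> (2 ^ card I * card I) / real p" if "p \<ge> 1" for p
    proof -
      have "real_of_int (\<Sum>x\<in>{0..<int p}. W p x) / real p - 2 ^ card I * (real (card (C p)) / real p)
        = (real_of_int (\<Sum>x\<in>{0..<int p}. W p x) - 2 ^ card I * real (card (C p))) / real p"
        by (simp add: diff_divide_distrib)
      thus ?thesis using err[of p] that by (simp only: real_norm_def abs_divide) (simp add: divide_right_mono)
    qed
    hence "norm (real_of_int (\<Sum>x\<in>{0..<int p}. W p x) / real p - 2 ^ card I * (real (card (C p)) / real p))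
        \<le> norm ((2 ^ card I * card I) / real p) * 1" if "p \<ge> 1" for p
      using order.trans[OF bnd[OF that] abs_ge_self] by (simp only: mult_1_right real_norm_def)
    thus "\<forall>\<^sub>F p in primes_at_top. norm (real_of_int (\<Sum>x\<in>{0..<int p}. W p x) / real p - 2 ^ card I * (real (card (C p)) / real p))
        \<le> norm ((2 ^ card I * card I) / real p) * 1" unfolding eventually_primes_at_top by blast
  qed
  from tendsto_mult[OF tendsto_diff[OF lim1 this] tendsto_const[of "1 / 2 ^ card I"]]
  show ?thesis unfolding C_def by simp
qed

lemma pattern_density:
  assumes I: "finite I" and Q: "Q \<subseteq> sign_patterns I"
  shows "((\<lambda>p. real (card {x\<in>{0..<int p}. legendre_pattern I p x \<in> Q}) / real p)
    \<longlongrightarrow> real (card Q) / 2 ^ card I) primes_at_top"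
proof -
  have Qf: "finite Q" using Q finite_sign_patterns[OF I] finite_subset by blast
  have "((\<lambda>p. \<Sum>q\<in>Q. real (card {x\<in>{0..<int p}. legendre_pattern I p x = q}) / real p)
    \<longlongrightarrow> (\<Sum>q\<in>Q. 1 / 2 ^ card I)) primes_at_top"
    using Q by (intro tendsto_sum single_pattern_density I) auto
  moreover have "card {x\<in>{0..<int p}. legendre_pattern I p x \<in> Q}
      = (\<Sum>q\<in>Q. card {x\<in>{0..<int p}. legendre_pattern I p x = q})" for p
  proof -
    have "{x\<in>{0..<int p}. legendre_pattern I p x \<in> Q} = (\<Union>q\<in>Q. {x\<in>{0..<int p}. legendre_pattern I p x = q})"
      by auto
    also have "card \<dots> = (\<Sum>q\<in>Q. card {x\<in>{0..<int p}. legendre_pattern I p x = q})"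
    proof (rule card_UN_disjoint[OF Qf])
      have "finite {x\<in>{0..<int p}. legendre_pattern I p x = q}" for q
        by (rule finite_subset[of _ "{0..<int p}"]) auto
      thus "\<forall>q\<in>Q. finite {x\<in>{0..<int p}. legendre_pattern I p x = q}" by blast
    qed auto
    finally show ?thesis .
  qed
  ultimately show ?thesis by (simp add: sum_divide_distrib)
qed

section \<open>Correlations of Legendre symbols\<close>

text \<open>Squaring is not injective on the nonzero residues, hence not surjective either.\<close>

lemma ex_quadratic_nonresidue:
  fixes p :: nat
  assumes "prime p" "p > 2"
  shows "\<exists>n. Legendre n (int p) = -1"
proof -
  define A where "A = {1..<int p}"
  define sq where "sq x = x ^ 2 mod int p" for x
  have nd: "\<not> int p dvd x" if "x \<in> A" for x using that zdvd_not_zless unfolding A_def by auto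
  have sub: "sq ` A \<subseteq> A"
  proof
    fix y assume "y \<in> sq ` A"
    then obtain x where x: "x \<in> A" "y = sq x" by blast
    have "\<not> int p dvd x ^ 2" using nd[OF x(1)] prime_dvd_power[of "int p" x 2] assms(1) by auto
    hence "sq x \<noteq> 0" unfolding sq_def by (simp add: mod_eq_0_iff_dvd)
    moreover have "0 \<le> sq x" "sq x < int p" unfolding sq_def using assms(2) by auto
    ultimately show "y \<in> A" unfolding x(2) A_def by simp
  qed
  have "sq 1 = sq (int p - 1)"
  proof -
    have "(int p - 1) ^ 2 = 1 + int p * (int p - 2)" by (simp add: power2_eq_square algebra_simps)
    thus ?thesis unfolding sq_def by simp
  qed
  moreover have "1 \<in> A" "int p - 1 \<in> A" "1 \<noteq> int p - 1" using assms(2) unfolding A_def by auto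
  ultimately have "\<not> inj_on sq A" unfolding inj_on_def by blast
  hence "sq ` A \<noteq> A" using finite_surj_inj[of A sq] unfolding A_def by blast
  then obtain n where n: "n \<in> A" "n \<notin> sq ` A" using sub by blast
  have "\<not> QuadRes (int p) n"
  proof
    assume "QuadRes (int p) n"
    then obtain y where y: "[y ^ 2 = n] (mod int p)" unfolding QuadRes_def by blast
    have n2: "n mod int p = n" using n(1) unfolding A_def by simp
    hence *: "sq (y mod int p) = n" using y unfolding sq_def cong_def by (simp add: power_mod)
    have "y mod int p \<noteq> 0"
    proof
      assume "y mod int p = 0"
      hence "n = 0" using * unfolding sq_def by simp
      thus False using n(1) unfolding A_def by simp
    qed
    moreover have "0 \<le> y mod int p" "y mod int p < int p" using assms(2) by auto
    ultimately have "y mod int p \<in> A" unfolding A_def by simp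
    thus False using * n(2) by blast
  qed
  hence "Legendre n (int p) = -1" using nd[OF n(1)] by (simp add: Legendre_def cong_0_iff)
  thus ?thesis by blast
qed

lemma sum_residues_scale:
  fixes g :: "int \<Rightarrow> 'a::comm_monoid_add"
  assumes p: "prime p" and a: "\<not> p dvd a" and per: "\<And>x y. [x = y] (mod p) \<Longrightarrow> g x = g y"
  shows "(\<Sum>x\<in>{0..<p}. g (a * x)) = (\<Sum>x\<in>{0..<p}. g x)"
proof -
  define f where "f x = (a * x) mod p" for x
  have p0: "p > 0" using p prime_gt_0_int by blast
  have inj: "inj_on f {0..<p}"
  proof (rule inj_onI)
    fix x y assume xy: "x \<in> {0..<p}" "y \<in> {0..<p}" "f x = f y"
    hence "p dvd a * x - a * y" unfolding f_def by (simp add: mod_eq_dvd_iff)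
    hence "p dvd a * (x - y)" by (simp add: right_diff_distrib)
    hence "p dvd x - y" using a p prime_dvd_mult_iff by blast
    moreover have "\<bar>x - y\<bar> < p" using xy by auto
    ultimately show "x = y" using dvd_imp_le_int[of "x - y" p] by auto
  qed
  have "f ` {0..<p} \<subseteq> {0..<p}" unfolding f_def using p0 by auto
  hence img: "f ` {0..<p} = {0..<p}" using endo_inj_surj[OF _ _ inj] by simp
  have "(\<Sum>x\<in>{0..<p}. g x) = (\<Sum>x\<in>{0..<p}. g (f x))"
    using sum.reindex[OF inj, of g] img by simp
  also have "\<dots> = (\<Sum>x\<in>{0..<p}. g (a * x))" unfolding f_def
    by (intro sum.cong refl per) (simp add: cong_def)
  finally show ?thesis by simp
qed

lemma sum_Legendre_eq_0:
  assumes p: "prime p" "p > 2"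
  shows "(\<Sum>x\<in>{0..<int p}. Legendre x (int p)) = 0"
proof -
  obtain n where n: "Legendre n (int p) = -1" using ex_quadratic_nonresidue[OF p] by blast
  hence nd: "\<not> int p dvd n" using Legendre_eq_0_iff[of n "int p"] by auto
  have "(\<Sum>x\<in>{0..<int p}. Legendre x (int p)) = (\<Sum>x\<in>{0..<int p}. Legendre (n * x) (int p))"
    using sum_residues_scale[of "int p" n "\<lambda>x. Legendre x (int p)"] p(1) nd Legendre_cong by fastforce
  also have "\<dots> = - (\<Sum>x\<in>{0..<int p}. Legendre x (int p))"
    by (simp add: Legendre_mult[OF p] n sum_negf)
  finally show ?thesis by simp
qed

lemma sum_Legendre_shift_eq_0:
  assumes p: "prime p" "p > 2"
  shows "(\<Sum>x\<in>{0..<int p}. Legendre (x + k) (int p)) = 0"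
  using sum_residues_shift[of "int p" "\<lambda>x. Legendre x (int p)" k] sum_Legendre_eq_0[OF p] p(2)
  by (simp add: Legendre_cong)

lemma sum_Legendre_squares:
  assumes p: "prime p" "p > 2"
  shows "(\<Sum>x\<in>{0..<int p}. Legendre x (int p) * Legendre x (int p)) = int p - 1"
proof -
  have "Legendre x (int p) * Legendre x (int p) = (if x = 0 then 0 else 1)" if "x \<in> {0..<int p}" for x
    using that Legendre_range[of x "int p"] Legendre_eq_0_iff[of x "int p"] zdvd_not_zless[of x "int p"] by auto
  hence "(\<Sum>x\<in>{0..<int p}. Legendre x (int p) * Legendre x (int p)) = (\<Sum>x\<in>{0..<int p}. if x = 0 then 0 else 1)"
    by (intro sum.cong) auto
  also have "\<dots> = (\<Sum>x\<in>{1..<int p}. 1)"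
    by (rule sum.mono_neutral_cong_right) auto
  finally show ?thesis using p by simp
qed

text \<open>Scaling the variable shows that the correlation is the same for all nonzero shifts. Summed over all
  shifts it vanishes, and the shift \<open>0\<close> contributes \<open>p - 1\<close>.\<close>

lemma sum_Legendre_correlation:
  assumes p: "prime p" "p > 2" and a: "\<not> int p dvd a"
  shows "(\<Sum>x\<in>{0..<int p}. Legendre x (int p) * Legendre (x + a) (int p)) = -1"
proof -
  define A where "A a = (\<Sum>x\<in>{0..<int p}. Legendre x (int p) * Legendre (x + a) (int p))" for a
  have pi: "prime (int p)" using p by simp
  have scale: "A b = A 1" if b: "\<not> int p dvd b" for b
  proof -
    have "A b = (\<Sum>x\<in>{0..<int p}. Legendre (b * x) (int p) * Legendre (b * x + b) (int p))"
      unfolding A_def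
      by (rule sum_residues_scale[OF pi b, symmetric]) (metis Legendre_cong cong_add_rcancel)
    also have "\<dots> = (\<Sum>x\<in>{0..<int p}. (Legendre b (int p) * Legendre b (int p)) * (Legendre x (int p) * Legendre (x + 1) (int p)))"
    proof (intro sum.cong refl)
      fix x
      have "b * x + b = b * (x + 1)" by (simp add: algebra_simps)
      thus "Legendre (b * x) (int p) * Legendre (b * x + b) (int p)
        = (Legendre b (int p) * Legendre b (int p)) * (Legendre x (int p) * Legendre (x + 1) (int p))"
        by (simp only: Legendre_mult[OF p] mult_ac)
    qed
    also have "Legendre b (int p) * Legendre b (int p) = 1"
      using Legendre_range[of b "int p"] Legendre_eq_0_iff[of b "int p"] b by auto
    finally show ?thesis unfolding A_def by simp
  qed
  have "(\<Sum>b\<in>{0..<int p}. A b) = (\<Sum>x\<in>{0..<int p}. Legendre x (int p) * (\<Sum>b\<in>{0..<int p}. Legendre (b + x) (int p)))"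
    unfolding A_def by (subst sum.swap) (simp add: sum_distrib_left add.commute)
  hence "(\<Sum>b\<in>{0..<int p}. A b) = 0" by (simp add: sum_Legendre_shift_eq_0[OF p])
  moreover have "{0..<int p} = insert 0 {1..<int p}" using p by auto
  ultimately have "A 0 + (\<Sum>b\<in>{1..<int p}. A b) = 0" by simp
  moreover have "(\<Sum>b\<in>{1..<int p}. A b) = (\<Sum>b\<in>{1..<int p}. A 1)"
    using zdvd_not_zless by (intro sum.cong refl scale) auto
  moreover have "A 0 = int p - 1" unfolding A_def using sum_Legendre_squares[OF p] by simp
  ultimately have "(int p - 1) * (1 + A 1) = 0" using p by (simp add: algebra_simps)
  hence "A 1 = -1" using p by simp
  thus ?thesis using scale[OF a] unfolding A_def by simp
qed

text \<open>The Gram matrix is \<open>(K+e) I\<close> minus \<open>e\<close> times the all-ones matrix, and the latter is positive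
  semidefinite. Used with \<open>e = 1\<close> for shifted Legendre symbols and with \<open>e = 0\<close> for random signs.\<close>

lemma sum_squares_equicorrelated:
  fixes X :: "'i \<Rightarrow> 'w \<Rightarrow> real"
  assumes T: "finite T" and e: "e \<ge> 0"
    and diag: "\<And>i. i \<in> T \<Longrightarrow> (\<Sum>w\<in>\<Omega>. X i w * X i w) = K"
    and off: "\<And>i j. i \<in> T \<Longrightarrow> j \<in> T \<Longrightarrow> i \<noteq> j \<Longrightarrow> (\<Sum>w\<in>\<Omega>. X i w * X j w) = - e"
  shows "(\<Sum>w\<in>\<Omega>. (\<Sum>i\<in>T. c i * X i w) ^ 2) \<le> (K + e) * (\<Sum>i\<in>T. c i ^ 2)"
proof -
  have "(\<Sum>w\<in>\<Omega>. (\<Sum>i\<in>T. c i * X i w) ^ 2)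
      = (\<Sum>w\<in>\<Omega>. \<Sum>i\<in>T. \<Sum>j\<in>T. c i * c j * (X i w * X j w))"
    by (simp add: power2_eq_square sum_product mult_ac)
  also have "\<dots> = (\<Sum>i\<in>T. \<Sum>w\<in>\<Omega>. \<Sum>j\<in>T. c i * c j * (X i w * X j w))" by (rule sum.swap)
  also have "\<dots> = (\<Sum>i\<in>T. \<Sum>j\<in>T. \<Sum>w\<in>\<Omega>. c i * c j * (X i w * X j w))" by (intro sum.cong refl sum.swap)
  also have "\<dots> = (\<Sum>i\<in>T. \<Sum>j\<in>T. c i * c j * (\<Sum>w\<in>\<Omega>. X i w * X j w))"
    by (simp add: sum_distrib_left)
  also have "\<dots> = (\<Sum>i\<in>T. \<Sum>j\<in>T. (if i = j then (K + e) * c i ^ 2 else 0) - e * (c i * c j))"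
    by (intro sum.cong refl) (auto simp: diag off algebra_simps power2_eq_square)
  also have "\<dots> = (K + e) * (\<Sum>i\<in>T. c i ^ 2) - e * (\<Sum>i\<in>T. c i) ^ 2"
  proof -
    have "e * (\<Sum>i\<in>T. c i) ^ 2 = (\<Sum>i\<in>T. \<Sum>j\<in>T. e * (c i * c j))"
      by (simp only: power2_eq_square sum_product) (simp only: sum_distrib_left)
    thus ?thesis using T by (simp add: sum_subtractf sum_distrib_left)
  qed
  also have "\<dots> \<le> (K + e) * (\<Sum>i\<in>T. c i ^ 2)" using e by simp
  finally show ?thesis .
qed

lemma Legendre_second_moment:
  fixes c :: "int \<Rightarrow> real"
  assumes p: "prime p" "p > 2" and T: "finite T"
    and inc: "\<And>i j. i \<in> T \<Longrightarrow> j \<in> T \<Longrightarrow> i \<noteq> j \<Longrightarrow> \<not> int p dvd j - i"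
  shows "(\<Sum>x\<in>{0..<int p}. (\<Sum>j\<in>T. c j * real_of_int (Legendre (x + j) (int p))) ^ 2) \<le> real p * (\<Sum>j\<in>T. c j ^ 2)"
proof -
  have corr: "(\<Sum>x\<in>{0..<int p}. Legendre (x + i) (int p) * Legendre (x + j) (int p))
      = (\<Sum>x\<in>{0..<int p}. Legendre x (int p) * Legendre (x + (j - i)) (int p))" for i j
  proof -
    define g where "g x = Legendre x (int p) * Legendre (x + (j - i)) (int p)" for x
    have "(\<Sum>x\<in>{0..<int p}. g (x + i)) = (\<Sum>x\<in>{0..<int p}. g x)"
      using p(2) unfolding g_def by (intro sum_residues_shift) (auto, metis Legendre_cong cong_add_rcancel)
    thus ?thesis unfolding g_def by (simp add: algebra_simps)
  qed
  have "(\<Sum>x\<in>{0..<int p}. (\<Sum>j\<in>T. c j * real_of_int (Legendre (x + j) (int p))) ^ 2)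
     \<le> ((real p - 1) + 1) * (\<Sum>j\<in>T. c j ^ 2)"
  proof (rule sum_squares_equicorrelated[OF T])
    fix i assume "i \<in> T"
    show "(\<Sum>x\<in>{0..<int p}. real_of_int (Legendre (x + i) (int p)) * real_of_int (Legendre (x + i) (int p))) = real p - 1"
      using arg_cong[OF corr[of i i], of real_of_int] sum_Legendre_squares[OF p] by simp
  next
    fix i j assume "i \<in> T" "j \<in> T" "i \<noteq> j"
    thus "(\<Sum>x\<in>{0..<int p}. real_of_int (Legendre (x + i) (int p)) * real_of_int (Legendre (x + j) (int p))) = - 1"
      using arg_cong[OF corr[of i j], of real_of_int] sum_Legendre_correlation[OF p inc[of i j]] by simp
  qed simp
  thus ?thesis by simp
qed

section \<open>Random sign patterns: how often the minimum is close to zero\<close>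

definition window :: "nat \<Rightarrow> int set" where
  "window J = {- int J..int J}"

lemma finite_window [simp]: "finite (window J)" by (simp add: window_def)

lemma card_window: "card (window J) = 2 * J + 1" by (simp add: window_def)

lemma sum_window_outer:
  fixes g :: "int \<Rightarrow> 'a::comm_monoid_add"
  shows "(\<Sum>j\<in>{-int N..-1} \<union> {2..int N + 1}. g j) = (\<Sum>n\<in>{1..N}. g (int n + 1) + g (- int n))"
proof -
  have "(\<Sum>j\<in>{-int N..-1} \<union> {2..int N + 1}. g j) = (\<Sum>j\<in>{-int N..-1}. g j) + (\<Sum>j\<in>{2..int N + 1}. g j)"
    by (rule sum.union_disjoint) auto
  also have "(\<Sum>j\<in>{-int N..-1}. g j) = (\<Sum>n\<in>{1..N}. g (- int n))"
    by (rule sum.reindex_bij_witness[of _ "\<lambda>n. - int n" "\<lambda>j. nat (- j)"]) auto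
  also have "(\<Sum>j\<in>{2..int N + 1}. g j) = (\<Sum>n\<in>{1..N}. g (int n + 1))"
    by (rule sum.reindex_bij_witness[of _ "\<lambda>n. int n + 1" "\<lambda>j. nat (j - 1)"]) auto
  finally show ?thesis by (simp add: sum.distrib add.commute)
qed

text \<open>The numbers \<open>n + 1\<close> and \<open>-n\<close> lie symmetrically about \<open>1/2\<close>, the centre of the interval on which the
  sums over a window are studied.\<close>

lemma sum_window_outer_le:
  fixes g :: "int \<Rightarrow> real"
  assumes "\<And>j. g j \<ge> 0"
  shows "(\<Sum>j\<in>window J - {0, 1}. g j) \<le> (\<Sum>n\<in>{1..J}. g (int n + 1) + g (- int n))"
  unfolding sum_window_outer[symmetric] using assms
  by (intro sum_mono2) (auto simp: window_def)

lemma sum_inverse_square_le: "(\<Sum>n\<in>{1..N}. 1 / real n ^ 2) \<le> 2"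
proof -
  have "(\<Sum>n\<in>{1..N}. 1 / real n ^ 2) \<le> 2 - 1 / real N"
  proof (induction N)
    case (Suc N)
    show ?case
    proof (cases "N = 0")
      case False
      have "1 / real (Suc N) ^ 2 \<le> 1 / (real N * real (Suc N))"
        using False by (intro divide_left_mono) (auto simp: power2_eq_square)
      also have "\<dots> = 1 / real N - 1 / real (Suc N)" using False by (simp add: field_simps)
      finally show ?thesis using Suc by simp
    qed simp
  qed simp
  thus ?thesis by (rule order.trans) simp
qed

text \<open>The model for the Fekete polynomial on an arc: the partial fraction with poles at the integers to which the
  cotangent sum degenerates when \<open>p\<close> is large.\<close>

definition local_sum :: "nat \<Rightarrow> (int \<Rightarrow> int) \<Rightarrow> real \<Rightarrow> real" where
  "local_sum J q x = (\<Sum>j\<in>window J. real_of_int (q j) / (x - real_of_int j))"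

definition sign_changes :: "nat \<Rightarrow> (int \<Rightarrow> int) set" where
  "sign_changes J = {q \<in> sign_patterns (window J). q 0 \<noteq> q 1}"

text \<open>The factor \<open>q 0\<close> makes the function tend to \<open>+\<infinity>\<close> at both ends of the interval, so that a negative
  value forces two zeros.\<close>

definition crossing :: "nat \<Rightarrow> (int \<Rightarrow> int) set" where
  "crossing J = {q \<in> sign_changes J. \<exists>x\<in>{0<..<1}. real_of_int (q 0) * local_sum J q x < 0}"

text \<open>The patterns whose minimum lies between \<open>-\<delta>\<close> and \<open>\<delta>\<close>. For all others an error of size \<open>\<delta>\<close> cannot
  change the number of zeros.\<close>

definition near_tangent :: "nat \<Rightarrow> real \<Rightarrow> (int \<Rightarrow> int) set" where
  "near_tangent J \<delta> = {q \<in> sign_changes J.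
     (\<exists>x\<in>{0<..<1}. real_of_int (q 0) * local_sum J q x \<le> \<delta>) \<and>
     (\<forall>x\<in>{0<..<1}. - \<delta> \<le> real_of_int (q 0) * local_sum J q x)}"

lemma power_4_in_window:
  assumes "4 ^ r \<le> J" "k \<le> r"
  shows "4 ^ k \<in> window J"
proof -
  have "(4::nat) ^ k \<le> 4 ^ r" using assms(2) by (intro power_increasing) auto
  hence "(4::nat) ^ k \<le> J" using assms(1) by linarith
  hence "int (4 ^ k) \<le> int J" by (simp only: of_nat_le_iff)
  moreover have "- int J \<le> 4 ^ k" by (rule order.trans[of _ 0]) auto
  ultimately show ?thesis unfolding window_def by simp
qed

lemma sign_patternsD: "q \<in> sign_patterns I \<Longrightarrow> j \<in> I \<Longrightarrow> q j = 1 \<or> q j = -1"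
  unfolding sign_patterns_def by blast

lemma sum_inverse_powers_4: "i \<le> r \<Longrightarrow> (\<Sum>k\<in>{i<..r}. 1 / 4 ^ k) = (1 / 4 ^ i - 1 / (4::real) ^ r) / 3"
proof (induction r rule: dec_induct)
  case (step r)
  have "{i<..Suc r} = insert (Suc r) {i<..r}" using step by auto
  hence "(\<Sum>k\<in>{i<..Suc r}. 1 / 4 ^ k) = 1 / 4 ^ Suc r + (\<Sum>k\<in>{i<..r}. 1 / (4::real) ^ k)" by simp
  also have "\<dots> = 1 / 4 ^ Suc r + (1 / 4 ^ i - 1 / 4 ^ r) / 3" by (simp only: step.IH)
  also have "\<dots> = (1 / 4 ^ i - 1 / 4 ^ Suc r) / 3" by (simp add: field_simps)
  finally show ?case .
qed simp

text \<open>For \<open>0 < x < 1\<close> the terms at the positions \<open>4\<^sup>k\<close> are negative multiples of the signs and decrease so fast that the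
  first position of difference outweighs all later ones together. The two functions then differ by
  at least \<open>4\<^sup>-\<^sup>r\<close> throughout, so their minima cannot both be within \<open>\<delta>\<close> of \<open>0\<close>.\<close>

lemma near_tangent_separated:
  assumes q: "q \<in> near_tangent J \<delta>" "q' \<in> near_tangent J \<delta>"
    and \<delta>: "2 * \<delta> < 1 / 4 ^ r" and J: "4 ^ r \<le> J"
    and agree: "\<And>j. j \<in> window J \<Longrightarrow> j \<notin> (\<lambda>k. 4 ^ k) ` {i..r} \<Longrightarrow> q j = q' j"
    and i: "1 \<le> i" "i \<le> r" and differ: "q 0 * q (4 ^ i) = 1" "q 0 * q' (4 ^ i) = -1"
  shows False
proof -
  define w where "w j = real_of_int (q 0 * (q' j - q j))" for j
  note inw = power_4_in_window[OF J]
  have val: "q j = 1 \<or> q j = -1" "q' j = 1 \<or> q' j = -1" if "j \<in> window J" for j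
    using sign_patternsD[OF _ that] q unfolding near_tangent_def sign_changes_def by blast+
  have w0: "0 \<in> window J" by (simp add: window_def)
  have "q 0 = q' 0" using w0 by (rule agree) auto
  obtain x where x: "x \<in> {0<..<1}" "real_of_int (q' 0) * local_sum J q' x \<le> \<delta>"
    using q(2) unfolding near_tangent_def by blast
  have "- \<delta> \<le> real_of_int (q 0) * local_sum J q x" using q(1) x(1) unfolding near_tangent_def by blast
  hence "real_of_int (q 0) * local_sum J q' x - real_of_int (q 0) * local_sum J q x \<le> 2 * \<delta>"
    using x(2) \<open>q 0 = q' 0\<close> by simp
  moreover have "real_of_int (q 0) * local_sum J q' x - real_of_int (q 0) * local_sum J q x
      = (\<Sum>j\<in>window J. w j / (x - real_of_int j))"
    unfolding local_sum_def sum_distrib_left sum_subtractf[symmetric] w_def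
    by (intro sum.cong refl) (simp add: algebra_simps diff_divide_distrib)
  moreover have "(\<Sum>j\<in>window J. w j / (x - real_of_int j)) = (\<Sum>j\<in>(\<lambda>k. 4 ^ k) ` {i..r}. w j / (x - real_of_int j))"
    using inw agree by (intro sum.mono_neutral_right) (auto simp: w_def)
  moreover have "\<dots> = (\<Sum>k\<in>{i..r}. w (4 ^ k) / (x - 4 ^ k))"
    by (subst sum.reindex) (auto simp: inj_on_def)
  moreover have "{i..r} = insert i {i<..r}" using i by auto
  ultimately have le: "w (4 ^ i) / (x - 4 ^ i) + (\<Sum>k\<in>{i<..r}. w (4 ^ k) / (x - 4 ^ k)) \<le> 2 * \<delta>" by simp
  have "w (4 ^ i) = -2" using differ unfolding w_def by (simp add: right_diff_distrib)
  moreover have "(4::real) ^ i \<ge> 4" using power_increasing[of 1 i "4::real"] i by simp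
  ultimately have "w (4 ^ i) / (x - 4 ^ i) \<ge> 2 / 4 ^ i" using x(1) by (simp add: field_simps)
  moreover have "w (4 ^ k) / (x - 4 ^ k) \<ge> - (32 / 15) * (1 / 4 ^ k)" if k: "k \<in> {i<..r}" for k
  proof -
    have "\<bar>w (4 ^ k)\<bar> \<le> 2" unfolding w_def using val[OF inw[of k]] val[OF w0] k by auto
    moreover have "(4::real) ^ k \<ge> 16" using power_increasing[of 2 k "4::real"] i k by simp
    \<comment> \<open>The later positions satisfy \<open>k \<ge> 2\<close>, so the distance to \<open>x\<close> is at least \<open>15/16\<close> of \<open>4\<^sup>k\<close>.\<close>
    hence "4 ^ k - x \<ge> (15 / 16) * 4 ^ k" using x(1) by simp
    ultimately have "\<bar>w (4 ^ k)\<bar> / (4 ^ k - x) \<le> 2 / ((15 / 16) * 4 ^ k)"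
      by (intro frac_le) auto
    moreover have "\<bar>x - 4 ^ k\<bar> = 4 ^ k - x"
      using \<open>4 ^ k - x \<ge> (15 / 16) * 4 ^ k\<close> zero_less_power[of "4::real" k] by linarith
    ultimately have "\<bar>w (4 ^ k) / (x - 4 ^ k)\<bar> \<le> (32 / 15) * (1 / 4 ^ k)" unfolding abs_divide by simp
    thus ?thesis by linarith
  qed
  hence "(\<Sum>k\<in>{i<..r}. w (4 ^ k) / (x - 4 ^ k)) \<ge> (\<Sum>k\<in>{i<..r}. - (32 / 15) * (1 / 4 ^ k))"
    by (intro sum_mono)
  moreover have "(\<Sum>k\<in>{i<..r}. - (32 / 15) * (1 / 4 ^ k)) = - (32 / 15) * ((1 / 4 ^ i - 1 / 4 ^ r) / (3::real))"
    using sum_inverse_powers_4[OF i(2)] by (simp only: sum_distrib_left[symmetric])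
  moreover have "1 / 4 ^ r \<le> 1 / (4::real) ^ i" using i by (simp add: frac_le power_increasing)
  moreover have "(0::real) < 1 / 4 ^ r" by simp
  ultimately show False using le \<delta> by argo
qed

text \<open>The signs outside the positions \<open>4, 4\<^sup>2, \<dots>, 4\<^sup>r\<close> determine a near-tangent pattern.\<close>

lemma card_near_tangent_le:
  assumes \<delta>: "2 * \<delta> < 1 / 4 ^ r" and J: "4 ^ r \<le> J"
  shows "card (near_tangent J \<delta>) * 2 ^ r \<le> 2 ^ (2 * J + 1)"
proof -
  define T where "T = (\<lambda>k. 4 ^ k :: int) ` {1..r}"
  have T: "T \<subseteq> window J"
  proof
    fix j assume "j \<in> T"
    then obtain k where k: "j = 4 ^ k" "k \<le> r" unfolding T_def by auto
    show "j \<in> window J" unfolding k(1) using power_4_in_window[OF J k(2)] .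
  qed
  have "card T = r" unfolding T_def by (subst card_image) (auto simp: inj_on_def)
  define R where "R q = restrict q (window J - T)" for q :: "int \<Rightarrow> int"
  have "inj_on R (near_tangent J \<delta>)"
  proof (rule inj_onI, rule ccontr)
    fix q q' assume q: "q \<in> near_tangent J \<delta>" "q' \<in> near_tangent J \<delta>" "R q = R q'" "q \<noteq> q'"
    have pat: "q \<in> sign_patterns (window J)" "q' \<in> sign_patterns (window J)"
      using q unfolding near_tangent_def sign_changes_def by auto
    have off: "q j = q' j" if "j \<in> window J" "j \<notin> T" for j
      using fun_cong[OF q(3), of j] that unfolding R_def by simp
    have "\<exists>j\<in>window J. q j \<noteq> q' j" using q(4) pat unfolding sign_patterns_def by (meson PiE_ext)
    then obtain j where j: "j \<in> window J" "q j \<noteq> q' j" by blast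
    hence "j \<in> T" using off by blast
    then obtain k where "k \<in> {1..r} \<and> q (4 ^ k) \<noteq> q' (4 ^ k)" using j(2) unfolding T_def by blast
    define i where "i = (LEAST k. k \<in> {1..r} \<and> q (4 ^ k) \<noteq> q' (4 ^ k))"
    have i: "i \<in> {1..r} \<and> q (4 ^ i) \<noteq> q' (4 ^ i)" unfolding i_def by (rule LeastI) fact
    have first: "q (4 ^ k) = q' (4 ^ k)" if "k \<in> {1..r}" "k < i" for k
      using not_less_Least[of k "\<lambda>k. k \<in> {1..r} \<and> q (4 ^ k) \<noteq> q' (4 ^ k)"] that unfolding i_def by blast
    have agree: "q j = q' j" if "j \<in> window J" "j \<notin> (\<lambda>k. 4 ^ k) ` {i..r}" for j
    proof (cases "j \<in> T")
      case True
      then obtain k where k: "j = 4 ^ k" "k \<in> {1..r}" unfolding T_def by blast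
      hence "k < i" using that(2) by (cases "k < i") auto
      thus ?thesis using first k by blast
    qed (use off that in blast)
    have w: "0 \<in> window J" "4 ^ i \<in> window J" using power_4_in_window[OF J, of i] i by (auto simp: window_def)
    have q0: "q 0 = q' 0" using w(1) by (rule agree) auto
    have v: "q 0 = 1 \<or> q 0 = -1" "q (4 ^ i) = 1 \<or> q (4 ^ i) = -1" "q' (4 ^ i) = 1 \<or> q' (4 ^ i) = -1"
      using sign_patternsD[OF pat(1) w(1)] sign_patternsD[OF pat(1) w(2)] sign_patternsD[OF pat(2) w(2)] by auto
    have "q 0 * q (4 ^ i) = 1 \<and> q 0 * q' (4 ^ i) = -1 \<or> q' 0 * q' (4 ^ i) = 1 \<and> q' 0 * q (4 ^ i) = -1"
      using v i q0 by auto
    thus False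
      using near_tangent_separated[OF q(1,2) \<delta> J agree] near_tangent_separated[OF q(2,1) \<delta> J agree[symmetric]] i
      by auto
  qed
  hence "card (near_tangent J \<delta>) = card (R ` near_tangent J \<delta>)" by (simp add: card_image)
  also have "\<dots> \<le> card (sign_patterns (window J - T))"
  proof (rule card_mono[OF finite_sign_patterns])
    show "R ` near_tangent J \<delta> \<subseteq> sign_patterns (window J - T)"
    proof
      fix q' assume "q' \<in> R ` near_tangent J \<delta>"
      then obtain q where "q \<in> sign_patterns (window J)" "q' = R q"
        unfolding near_tangent_def sign_changes_def by blast
      thus "q' \<in> sign_patterns (window J - T)"
        unfolding sign_patterns_def R_def by (simp add: restrict_PiE_iff PiE_iff)
    qed
  qed simp
  also have "\<dots> = 2 ^ (2 * J + 1 - r)"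
    using T \<open>card T = r\<close> by (simp add: card_sign_patterns card_Diff_subset finite_subset card_window)
  finally have "card (near_tangent J \<delta>) * 2 ^ r \<le> 2 ^ (2 * J + 1 - r) * 2 ^ r" by simp
  also have "\<dots> = 2 ^ (2 * J + 1)"
  proof -
    have "r \<le> 2 * J + 1" using card_mono[OF _ T] \<open>card T = r\<close> card_window by simp
    thus ?thesis by (simp flip: power_add)
  qed
  finally show ?thesis .
qed

section \<open>Random sign patterns: bounds for the probability of a crossing\<close>

definition flip :: "int set \<Rightarrow> (int \<Rightarrow> int) \<Rightarrow> int \<Rightarrow> int" where
  "flip A q j = (if j \<in> A then - q j else q j)"

lemma flip_flip [simp]: "flip A (flip A q) = q" by (auto simp: flip_def fun_eq_iff)

lemma inj_on_flip: "inj_on (flip A) S" by (rule inj_on_inverseI[of _ "flip A"]) simp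

lemma flip_sign_patterns: "A \<subseteq> I \<Longrightarrow> q \<in> sign_patterns I \<Longrightarrow> flip A q \<in> sign_patterns I"
  unfolding sign_patterns_def by (auto simp: flip_def PiE_iff extensional_def)

lemma finite_sign_changes: "finite (sign_changes J)"
  unfolding sign_changes_def using finite_sign_patterns[of "window J"] by simp

lemma card_sign_changes:
  assumes "J \<ge> 1"
  shows "2 * card (sign_changes J) = 2 ^ (2 * J + 1)"
proof -
  let ?P = "sign_patterns (window J)"
  have in01: "0 \<in> window J" "1 \<in> window J" using assms by (auto simp: window_def)
  have "bij_betw (flip {0}) (sign_changes J) (?P - sign_changes J)"
  proof (rule bij_betwI[where g = "flip {0}"])
    show "flip {0} \<in> sign_changes J \<rightarrow> ?P - sign_changes J"
      using sign_patternsD[OF _ in01(1)] sign_patternsD[OF _ in01(2)] in01 flip_sign_patterns[of "{0}" "window J"]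
      unfolding sign_changes_def by (fastforce simp: flip_def)
    show "flip {0} \<in> (?P - sign_changes J) \<rightarrow> sign_changes J"
      using sign_patternsD[OF _ in01(1)] sign_patternsD[OF _ in01(2)] in01 flip_sign_patterns[of "{0}" "window J"]
      unfolding sign_changes_def by (fastforce simp: flip_def)
  qed auto
  hence "card (sign_changes J) = card (?P - sign_changes J)" by (rule bij_betw_same_card)
  also have "\<dots> = card ?P - card (sign_changes J)"
    by (rule card_Diff_subset[OF finite_sign_changes]) (auto simp: sign_changes_def)
  moreover have "card (sign_changes J) \<le> card ?P"
    by (rule card_mono) (auto simp: sign_changes_def finite_sign_patterns)
  ultimately show ?thesis by (simp add: card_sign_patterns card_window)
qed

text \<open>Reversing the sign at \<open>i\<close> is an involution of the patterns with a sign change between \<open>0\<close> and \<open>1\<close>.\<close>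

lemma sum_sign_changes_orthogonal:
  assumes "i \<in> window J - {0, 1}" "j \<noteq> i"
  shows "(\<Sum>q\<in>sign_changes J. real_of_int (q i) * real_of_int (q j)) = 0"
proof -
  let ?s = "\<Sum>q\<in>sign_changes J. real_of_int (q i) * real_of_int (q j)"
  have "flip {i} ` sign_changes J \<subseteq> sign_changes J"
    using assms flip_sign_patterns[of "{i}" "window J"] unfolding sign_changes_def
    by (auto simp: flip_def)
  hence "flip {i} ` sign_changes J = sign_changes J"
    using endo_inj_surj[OF finite_sign_changes] inj_on_flip by blast
  hence "?s = (\<Sum>q\<in>flip {i} ` sign_changes J. real_of_int (q i) * real_of_int (q j))" by simp
  also have "\<dots> = (\<Sum>q\<in>sign_changes J. real_of_int (flip {i} q i) * real_of_int (flip {i} q j))"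
    by (subst sum.reindex) (simp_all add: inj_on_flip)
  also have "\<dots> = - ?s" using assms(2) by (simp add: flip_def sum_negf)
  finally show ?thesis by simp
qed

lemma local_sum_split:
  assumes "q \<in> sign_changes J" "J \<ge> 1"
  shows "real_of_int (q 0) * local_sum J q x = 1 / x + 1 / (1 - x) +
     real_of_int (q 0) * (\<Sum>j\<in>window J - {0, 1}. real_of_int (q j) / (x - real_of_int j))"
proof -
  have in01: "0 \<in> window J" "1 \<in> window J" using assms by (auto simp: window_def)
  have q: "q 0 = 1 \<and> q 1 = -1 \<or> q 0 = -1 \<and> q 1 = 1"
    using sign_patternsD[OF _ in01(1)] sign_patternsD[OF _ in01(2)] assms(1) unfolding sign_changes_def by force
  define h where "h j = real_of_int (q j) / (x - real_of_int j)" for j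
  have "window J = insert 0 (insert 1 (window J - {0, 1}))" using in01 by blast
  hence "local_sum J q x = sum h (insert 0 (insert 1 (window J - {0, 1})))"
    unfolding local_sum_def h_def by metis
  hence "local_sum J q x = h 0 + (h 1 + sum h (window J - {0, 1}))" by simp
  moreover have "real_of_int (q 0) * h 0 = 1 / x" using q unfolding h_def by auto
  moreover have "real_of_int (q 0) * h 1 = 1 / (1 - x)"
    using q minus_divide_right[of 1 "x - 1"] unfolding h_def by auto
  ultimately show ?thesis unfolding h_def[symmetric] by (simp add: algebra_simps)
qed

lemma inverse_sum_ge_4:
  fixes x :: real
  assumes "0 < x" "x < 1"
  shows "1 / x + 1 / (1 - x) \<ge> 4"
proof -
  have "0 \<le> (2 * x - 1) ^ 2" by simp
  hence "4 * (x * (1 - x)) \<le> 1" by (simp add: power2_eq_square algebra_simps)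
  hence "4 \<le> 1 / (x * (1 - x))" using assms by (simp add: field_simps)
  also have "\<dots> = 1 / x + 1 / (1 - x)" using assms by (simp add: field_simps)
  finally show ?thesis .
qed

lemma outer_distance:
  fixes x :: real
  assumes "0 \<le> x" "x \<le> 1" "n \<ge> (1::nat)"
  shows "\<bar>x - real_of_int (int n + 1)\<bar> \<ge> real n" "\<bar>x - real_of_int (- int n)\<bar> \<ge> real n"
  using assms by auto

text \<open>Moving from \<open>x\<close> to the midpoint changes the terms at \<open>n+1\<close> and \<open>-n\<close> by at most
  \<open>1/(2n(n + 1/2))\<close> each, and \<open>\<Sum> 1/(n(n + 1/2)) \<le> 2/3 + \<Sum> 1/(n(n-1)) \<le> 5/3\<close>, the last sum being over \<open>n \<ge> 2\<close>.\<close>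

lemma outer_variation:
  fixes x :: real
  assumes x: "0 < x" "x < 1" and q: "q \<in> sign_patterns (window J)"
  shows "\<bar>(\<Sum>j\<in>window J - {0, 1}. real_of_int (q j) / (x - real_of_int j))
      - (\<Sum>j\<in>window J - {0, 1}. real_of_int (q j) / (1 / 2 - real_of_int j))\<bar> \<le> 5 / 3"
proof -
  define g where "g j = 1 / (2 * (\<bar>x - real_of_int j\<bar> * \<bar>1 / 2 - real_of_int j\<bar>))" for j :: int
  have "\<bar>(\<Sum>j\<in>window J - {0, 1}. real_of_int (q j) / (x - real_of_int j))
      - (\<Sum>j\<in>window J - {0, 1}. real_of_int (q j) / (1 / 2 - real_of_int j))\<bar>
      \<le> (\<Sum>j\<in>window J - {0, 1}. \<bar>real_of_int (q j) / (x - real_of_int j) - real_of_int (q j) / (1 / 2 - real_of_int j)\<bar>)"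
    unfolding sum_subtractf[symmetric] by (rule sum_abs)
  also have "\<dots> \<le> (\<Sum>j\<in>window J - {0, 1}. g j)"
  proof (rule sum_mono)
    fix j assume j: "j \<in> window J - {0, 1}"
    have nz: "x - real_of_int j \<noteq> 0" "1 / 2 - real_of_int j \<noteq> 0"
    proof -
      have "j \<le> -1 \<or> j \<ge> 2" using j by auto
      hence "real_of_int j \<le> -1 \<or> real_of_int j \<ge> 2" by linarith
      thus "x - real_of_int j \<noteq> 0" "1 / 2 - real_of_int j \<noteq> 0" using x by linarith+
    qed
    have "\<bar>real_of_int (q j)\<bar> = 1" using sign_patternsD[OF q, of j] j by auto
    moreover have "real_of_int (q j) / (x - real_of_int j) - real_of_int (q j) / (1 / 2 - real_of_int j)
        = real_of_int (q j) * (1 / 2 - x) / ((x - real_of_int j) * (1 / 2 - real_of_int j))"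
    proof -
      have "a / u - a / v = a * (v - u) / (u * v)" if "u \<noteq> 0" "v \<noteq> 0" for a u v :: real
        using that by (simp add: field_simps)
      from this[OF nz, of "real_of_int (q j)"] show ?thesis by simp
    qed
    ultimately have "\<bar>real_of_int (q j) / (x - real_of_int j) - real_of_int (q j) / (1 / 2 - real_of_int j)\<bar>
        = \<bar>1 / 2 - x\<bar> / (\<bar>x - real_of_int j\<bar> * \<bar>1 / 2 - real_of_int j\<bar>)"
      by (simp add: abs_mult)
    also have "\<dots> \<le> (1 / 2) / (\<bar>x - real_of_int j\<bar> * \<bar>1 / 2 - real_of_int j\<bar>)"
    proof (rule divide_right_mono)
      show "\<bar>1 / 2 - x\<bar> \<le> 1 / 2" using x by linarith
    qed simp
    finally show "\<bar>real_of_int (q j) / (x - real_of_int j) - real_of_int (q j) / (1 / 2 - real_of_int j)\<bar> \<le> g j"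
      unfolding g_def by simp
  qed
  also have "\<dots> \<le> (\<Sum>n\<in>{1..J}. g (int n + 1) + g (- int n))"
    by (rule sum_window_outer_le) (simp add: g_def)
  also have "\<dots> \<le> (\<Sum>n\<in>{1..J}. 1 / (real n * (real n + 1 / 2)))"
  proof (rule sum_mono)
    fix n assume n: "n \<in> {1..J}"
    have half: "g j \<le> 1 / (2 * (real n * (real n + 1 / 2)))" if "j = int n + 1 \<or> j = - int n" for j
    proof -
      have "\<bar>x - real_of_int j\<bar> \<ge> real n" "\<bar>1 / 2 - real_of_int j\<bar> = real n + 1 / 2"
        using outer_distance[of x n] that x n by auto
      thus ?thesis unfolding g_def using n by (intro divide_left_mono mult_left_mono mult_mono mult_pos_pos) auto
    qed
    have "1 / (2 * X) + 1 / (2 * X) = 1 / X" for X :: real by simp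
    thus "g (int n + 1) + g (- int n) \<le> 1 / (real n * (real n + 1 / 2))"
      using add_mono[OF half[OF disjI1[OF refl]] half[OF disjI2[OF refl]]] by metis
  qed
  also have "\<dots> \<le> 5 / 3"
  proof -
    have "(\<Sum>n\<in>{1..J}. 1 / (real n * (real n + 1 / 2))) \<le> 5 / 3 - 1 / real J" if "J \<ge> 1" for J
      using that
    proof (induction J rule: dec_induct)
      case (step N)
      have "1 / (real (Suc N) * (real (Suc N) + 1 / 2)) \<le> 1 / (real N * real (Suc N))"
        using step by (intro divide_left_mono) (auto intro!: mult_mono)
      also have "\<dots> = 1 / real N - 1 / real (Suc N)" using step by (simp add: field_simps)
      finally show ?case using step by simp
    qed simp
    hence *: "(\<Sum>n\<in>{1..J}. 1 / (real n * (real n + 1 / 2))) \<le> 5 / 3 - 1 / real J" if "J \<ge> 1" using that .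
    show ?thesis
    proof (cases "J \<ge> 1")
      case True
      have "5 / 3 - 1 / real J \<le> 5 / 3" by simp
      thus ?thesis using *[OF True] by linarith
    qed simp
  qed
  finally show ?thesis .
qed

text \<open>The poles at \<open>0\<close> and \<open>1\<close> contribute at least \<open>4\<close>, so on a crossing pattern the other terms have absolute value
  at least \<open>4 - 5/3 = 7/3\<close> at the midpoint. Their second moment there is at most \<open>2\<close>, and Chebyshev's inequality
  gives the proportion \<open>2 (3/7)\<^sup>2 = 18/49\<close>.\<close>

lemma card_crossing_le:
  assumes J: "J \<ge> 1"
  shows "49 * card (crossing J) \<le> 18 * card (sign_changes J)"
proof -
  define c where "c j = 1 / (1 / 2 - real_of_int j)" for j :: int
  define B where "B q = (\<Sum>j\<in>window J - {0, 1}. c j * real_of_int (q j))" for q :: "int \<Rightarrow> int"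
  have "(\<Sum>q\<in>sign_changes J. B q ^ 2) \<le> (real (card (sign_changes J)) + 0) * (\<Sum>j\<in>window J - {0, 1}. c j ^ 2)"
    unfolding B_def
  proof (rule sum_squares_equicorrelated)
    fix i assume "i \<in> window J - {0, 1}"
    hence "real_of_int (q i) * real_of_int (q i) = 1" if "q \<in> sign_changes J" for q
      using sign_patternsD[of q "window J" i] that unfolding sign_changes_def by auto
    thus "(\<Sum>q\<in>sign_changes J. real_of_int (q i) * real_of_int (q i)) = real (card (sign_changes J))" by simp
  next
    fix i j assume "i \<in> window J - {0, 1}" "i \<noteq> j"
    thus "(\<Sum>q\<in>sign_changes J. real_of_int (q i) * real_of_int (q j)) = - 0"
      using sum_sign_changes_orthogonal[of i J j] by simp
  qed auto
  moreover have "(\<Sum>j\<in>window J - {0, 1}. c j ^ 2) \<le> 2"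
  proof -
  have "(\<Sum>j\<in>window J - {0, 1}. c j ^ 2) \<le> (\<Sum>n\<in>{1..J}. c (int n + 1) ^ 2 + c (- int n) ^ 2)"
    by (rule sum_window_outer_le) simp
  also have "\<dots> \<le> (\<Sum>n\<in>{1..J}. 2 * (1 / real n - 1 / (real n + 1)))"
  proof (rule sum_mono)
    fix n assume n: "n \<in> {1..J}"
    have c: "c (int n + 1) ^ 2 = 1 / (real n + 1 / 2) ^ 2" "c (- int n) ^ 2 = 1 / (real n + 1 / 2) ^ 2"
      unfolding c_def by (simp_all add: power2_eq_square field_simps)
    have "1 / (real n + 1 / 2) ^ 2 \<le> 1 / (real n * (real n + 1))"
      using n by (intro frac_le) (auto simp: power2_eq_square algebra_simps intro!: add_pos_pos)
    also have "\<dots> = 1 / real n - 1 / (real n + 1)" using n by (simp add: field_simps)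
    finally show "c (int n + 1) ^ 2 + c (- int n) ^ 2 \<le> 2 * (1 / real n - 1 / (real n + 1))" using c by simp
  qed
  also have "\<dots> = 2 * (1 - 1 / (real J + 1))"
  proof (induction J)
    case (Suc J)
    have "{1..Suc J} = insert (Suc J) {1..J}" by auto
    hence "(\<Sum>n\<in>{1..Suc J}. 2 * (1 / real n - 1 / (real n + 1))) =
        2 * (1 / real (Suc J) - 1 / (real (Suc J) + 1)) + (\<Sum>n\<in>{1..J}. 2 * (1 / real n - 1 / (real n + 1)))"
      by simp
    also have "\<dots> = 2 * (1 - 1 / (real (Suc J) + 1))" unfolding Suc.IH by (simp add: add.commute)
    finally show ?case .
  qed simp
  also have "\<dots> \<le> 2" by simp
  finally show ?thesis .
  qed
  hence "(real (card (sign_changes J)) + 0) * (\<Sum>j\<in>window J - {0, 1}. c j ^ 2) \<le> real (card (sign_changes J)) * 2"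
    by (intro mult_mono) (auto intro: sum_nonneg)
  ultimately have second: "(\<Sum>q\<in>sign_changes J. B q ^ 2) \<le> 2 * real (card (sign_changes J))" by linarith
  have big: "(7 / 3) ^ 2 \<le> B q ^ 2" if q: "q \<in> crossing J" for q
  proof -
    have qs: "q \<in> sign_changes J" "q \<in> sign_patterns (window J)"
      using q unfolding crossing_def sign_changes_def by auto
    obtain x where x: "0 < x" "x < 1" "real_of_int (q 0) * local_sum J q x < 0"
      using q unfolding crossing_def by auto
    have "0 \<in> window J" by (simp add: window_def)
    hence q0: "q 0 = 1 \<or> q 0 = -1" using sign_patternsD[OF qs(2)] by blast
    define S where "S = (\<Sum>j\<in>window J - {0, 1}. real_of_int (q j) / (x - real_of_int j))"
    have "real_of_int (q 0) * S < - 4"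
      unfolding S_def using x(3) inverse_sum_ge_4[OF x(1,2)] unfolding local_sum_split[OF qs(1) J] by linarith
    moreover have "B q = (\<Sum>j\<in>window J - {0, 1}. real_of_int (q j) / (1 / 2 - real_of_int j))"
      unfolding B_def c_def by simp
    hence "\<bar>S - B q\<bar> \<le> 5 / 3" using outer_variation[OF x(1,2) qs(2)] unfolding S_def by simp
    moreover have "S < -4 \<or> S > 4" using \<open>real_of_int (q 0) * S < - 4\<close> q0 by auto
    ultimately have "\<bar>B q\<bar> \<ge> 7 / 3" by linarith
    thus ?thesis by (metis abs_le_square_iff abs_of_nonneg zero_le_divide_iff zero_le_numeral)
  qed
  have "real (card (crossing J)) * (7 / 3) ^ 2 = (\<Sum>q\<in>crossing J. (7 / 3) ^ 2)" by simp
  also have "\<dots> \<le> (\<Sum>q\<in>crossing J. B q ^ 2)" by (intro sum_mono big)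
  also have "\<dots> \<le> (\<Sum>q\<in>sign_changes J. B q ^ 2)"
    by (intro sum_mono2 finite_sign_changes) (auto simp: crossing_def)
  finally have "real (49 * card (crossing J)) \<le> real (18 * card (sign_changes J))"
    using second by (simp add: power2_eq_square)
  thus ?thesis by (simp only: of_nat_le_iff)
qed

text \<open>Force the signs on \<open>{-7..8}\<close> so that every term except the poles at \<open>0\<close> and \<open>1\<close> is negative at the
  midpoint; the sum over this block is then negative. Reversing all signs outside the block changes the sign of the remaining
  contribution, so one of the two patterns is a crossing.\<close>

lemma card_crossing_ge:
  assumes J: "J \<ge> 8"
  shows "2 ^ (2 * J + 1) \<le> 2 ^ 17 * card (crossing J)"
proof -
  \<comment> \<open>The shortest such block: \<open>\<Sum> 1/(n + 1/2)\<close> over \<open>1 \<le> n \<le> N\<close> exceeds \<open>2\<close> first for \<open>N = 7\<close>.\<close>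
  define In where "In = {-7..8::int}"
  define w :: "int \<Rightarrow> int" where "w j = (if j = 0 \<or> j \<ge> 2 then 1 else -1)" for j
  define W where "W = {q \<in> sign_patterns (window J). \<forall>j\<in>In. q j = w j}"
  define fl where "fl = flip (window J - In)"
  have In: "In \<subseteq> window J" using J unfolding In_def window_def by auto
  have Wf: "finite W" unfolding W_def using finite_sign_patterns[of "window J"] by simp
  have flW: "fl q \<in> W" if "q \<in> W" for q
    using that flip_sign_patterns[of "window J - In" "window J" q] unfolding W_def fl_def by (auto simp: flip_def)
  have W_sc: "q \<in> sign_changes J" "q 0 = 1" if "q \<in> W" for q
    using that unfolding W_def sign_changes_def In_def w_def by auto
  define out where "out q = (\<Sum>j\<in>window J - In. real_of_int (q j) / (1 / 2 - real_of_int j))" for q :: "int \<Rightarrow> int"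
  have val: "local_sum J q (1 / 2) < out q" if q: "q \<in> W" for q
  proof -
    have "local_sum J q (1 / 2) = (\<Sum>j\<in>In. real_of_int (q j) / (1 / 2 - real_of_int j)) + out q"
      unfolding local_sum_def out_def using In by (simp add: sum.subset_diff add.commute)
    also have "(\<Sum>j\<in>In. real_of_int (q j) / (1 / 2 - real_of_int j)) = (\<Sum>j\<in>In. real_of_int (w j) / (1 / 2 - real_of_int j))"
      using q unfolding W_def by (intro sum.cong refl) auto
    also have "In = set [-7,-6,-5,-4,-3,-2,-1,0,1,2,3,4,5,6,7,8]" 
      unfolding In_def set_eq_iff by simp presburger
    also have "(\<Sum>j\<in>set [-7,-6,-5,-4,-3,-2,-1,0,1,2,3,4,5,6,7,8]. real_of_int (w j) / (1 / 2 - real_of_int j)) < 0"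
      unfolding w_def by simp
    finally show ?thesis by simp
  qed
  have neg: "q \<in> crossing J" if "q \<in> W" "out q \<le> 0" for q
  proof -
    have "real_of_int (q 0) * local_sum J q (1 / 2) < 0" using val[OF that(1)] that(2) W_sc(2)[OF that(1)] by simp
    thus ?thesis unfolding crossing_def using W_sc(1)[OF that(1)] by (auto intro!: bexI[of _ "1/2"])
  qed
  have out_fl: "out (fl q) = - out q" for q
    unfolding out_def fl_def flip_def by (simp add: sum_negf[symmetric])
  have "W \<subseteq> crossing J \<union> fl ` crossing J"
  proof
    fix q assume q: "q \<in> W"
    show "q \<in> crossing J \<union> fl ` crossing J"
    proof (cases "out q \<le> 0")
      case False
      hence "fl q \<in> crossing J" using neg[OF flW[OF q]] out_fl[of q] by simp
      hence "fl (fl q) \<in> fl ` crossing J" by blast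
      thus ?thesis unfolding fl_def by simp
    qed (use neg q in blast)
  qed
  moreover have cf: "finite (crossing J)"
    using finite_sign_changes[of J] unfolding crossing_def by simp
  ultimately have "card W \<le> card (crossing J \<union> fl ` crossing J)" by (intro card_mono) auto
  also have "\<dots> \<le> card (crossing J) + card (fl ` crossing J)" by (rule card_Un_le)
  also have "card (fl ` crossing J) \<le> card (crossing J)" by (rule card_image_le[OF cf])
  finally have W2: "card W \<le> 2 * card (crossing J)" by simp
  define ext where "ext q j = (if j \<in> In then w j else q j)" for q :: "int \<Rightarrow> int" and j
  have "inj_on ext (sign_patterns (window J - In))"
  proof (rule inj_onI)
    fix q q' assume q: "q \<in> sign_patterns (window J - In)" "q' \<in> sign_patterns (window J - In)" "ext q = ext q'"
    show "q = q'"
    proof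
      fix j
      show "q j = q' j"
        using fun_cong[OF q(3), of j] PiE_arb[OF q(1)[unfolded sign_patterns_def], of j]
          PiE_arb[OF q(2)[unfolded sign_patterns_def], of j]
        by (cases "j \<in> In") (auto simp: ext_def)
    qed
  qed
  moreover have "ext ` sign_patterns (window J - In) \<subseteq> W"
  proof clarify
    fix q assume q: "q \<in> sign_patterns (window J - In)"
    have "ext q \<in> sign_patterns (window J)" unfolding sign_patterns_def
    proof (rule PiE_I)
      fix j assume "j \<in> window J"
      thus "ext q j \<in> {-1, 1}" using sign_patternsD[OF q, of j]
        by (cases "j \<in> In") (auto simp: ext_def w_def)
    next
      fix j assume "j \<notin> window J"
      thus "ext q j = undefined" using PiE_arb[OF q[unfolded sign_patterns_def], of j] In
        by (auto simp: ext_def)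
    qed
    thus "ext q \<in> W" unfolding W_def by (simp add: ext_def)
  qed
  ultimately have "card (sign_patterns (window J - In)) \<le> card W"
    using card_inj_on_le[OF _ _ Wf] by blast
  moreover have "card (window J - In) = 2 * J + 1 - 16"
    using In by (simp add: card_Diff_subset In_def card_window)
  ultimately have "2 ^ (2 * J + 1 - 16) \<le> card W" by (simp add: card_sign_patterns)
  hence "2 ^ 16 * 2 ^ (2 * J + 1 - 16) \<le> 2 ^ 16 * (2 * card (crossing J))" using W2 by simp
  moreover have "(2::nat) ^ 16 * 2 ^ (2 * J + 1 - 16) = 2 ^ (2 * J + 1)"
  proof -
    have "16 + (2 * J + 1 - 16) = 2 * J + 1" using J by simp
    thus ?thesis by (metis power_add)
  qed
  ultimately show ?thesis by simp
qed

section \<open>Gauss sums and the cotangent representation\<close>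

definition circ :: "nat \<Rightarrow> real \<Rightarrow> complex" where
  "circ p y = cis (2 * pi * y / real p)"

lemma circ_add: "circ p (x + y) = circ p x * circ p y"
  unfolding circ_def by (simp add: cis_mult add_divide_distrib distrib_left)

lemma circ_int_periodic:
  assumes "p > 0"
  shows "circ p (y + real p * of_int n) = circ p y"
proof -
  have "circ p (real p * of_int n) = 1"
    using assms cis_multiple_2pi[of "of_int n"] unfolding circ_def by (simp add: mult.assoc)
  thus ?thesis by (simp add: circ_add)
qed

lemma circ_cong:
  assumes "p > 0" "[k = l] (mod int p)"
  shows "circ p (of_int k) = circ p (of_int l)"
proof -
  obtain n where "k = l + int p * n" using assms(2) by (metis cong_iff_lin cong_sym mult.commute)
  thus ?thesis using circ_int_periodic[OF assms(1), of "of_int l" n] by simp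
qed

lemma circ_power: "circ p y ^ n = circ p (real n * y)"
  unfolding circ_def by (simp add: DeMoivre mult_ac)

lemma circ_int_power_self: "p > 0 \<Longrightarrow> circ p (of_int k) ^ p = 1"
  using circ_int_periodic[of p 0 k] by (simp only: circ_power add_0_left) (simp add: circ_def)

lemma poly_fekete:
  "poly (fekete_poly p) z = (\<Sum>x\<in>{0..<int p}. of_int (Legendre x (int p)) * z ^ nat x)"
proof -
  have "poly (fekete_poly p) z = (\<Sum>a<p. of_int (Legendre (int a) (int p)) * z ^ a)"
    unfolding fekete_poly_def by (simp add: poly_sum poly_monom)
  also have "\<dots> = (\<Sum>x\<in>{0..<int p}. of_int (Legendre x (int p)) * z ^ nat x)"
    by (rule sum.reindex_bij_witness[of _ nat int]) auto
  finally show ?thesis .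
qed

lemma coeff_fekete: "a < p \<Longrightarrow> Polynomial.coeff (fekete_poly p) a = of_int (Legendre (int a) (int p))"
  unfolding fekete_poly_def by (simp add: coeff_sum)

lemma fekete_nonzero:
  assumes "p > 1"
  shows "fekete_poly p \<noteq> 0"
  using coeff_fekete[of 1 p] Legendre_1[OF assms] assms by auto

lemma degree_fekete: "p > 0 \<Longrightarrow> degree (fekete_poly p) < p"
  unfolding fekete_poly_def
  by (rule le_less_trans[of _ "p - 1"], rule degree_sum_le) (auto intro!: order.trans[OF degree_monom_le])

definition gauss_sum :: "nat \<Rightarrow> complex" where
  "gauss_sum p = poly (fekete_poly p) (circ p 1)"

lemma poly_fekete_circ_int:
  "poly (fekete_poly p) (circ p (of_int k)) = (\<Sum>x\<in>{0..<int p}. of_int (Legendre x (int p)) * circ p (of_int (k * x)))"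
  unfolding poly_fekete circ_power by (intro sum.cong refl) (simp add: mult.commute)

text \<open>Substitute \<open>a \<mapsto> k a\<close> in the sum for \<open>f\<^sub>p(\<zeta>)\<close> if \<open>p\<close> does not divide \<open>k\<close>.\<close>

lemma poly_fekete_root_of_unity:
  assumes p: "prime p" "p > 2"
  shows "poly (fekete_poly p) (circ p (of_int k)) = of_int (Legendre k (int p)) * gauss_sum p"
proof (cases "int p dvd k")
  case True
  have "circ p (of_int (k * x)) = 1" for x
    using circ_cong[of p "k * x" 0] p True by (simp add: cong_0_iff circ_def)
  hence "poly (fekete_poly p) (circ p (of_int k)) = of_int (\<Sum>x\<in>{0..<int p}. Legendre x (int p))"
    unfolding poly_fekete_circ_int by simp
  thus ?thesis using True Legendre_eq_0_iff[of k "int p"] sum_Legendre_eq_0[OF p] by simp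
next
  case False
  define g where "g y = of_int (Legendre y (int p)) * circ p (of_int y)" for y
  have "(\<Sum>x\<in>{0..<int p}. g (k * x)) = (\<Sum>x\<in>{0..<int p}. g x)"
  proof (rule sum_residues_scale)
    show "g x = g y" if "[x = y] (mod int p)" for x y
      unfolding g_def using Legendre_cong[OF that] circ_cong[OF _ that] p by simp
  qed (use p False in auto)
  also have "\<dots> = gauss_sum p"
    using poly_fekete_circ_int[of p 1] unfolding gauss_sum_def g_def by simp
  finally have "of_int (Legendre k (int p)) * poly (fekete_poly p) (circ p (of_int k)) = gauss_sum p"
    unfolding poly_fekete_circ_int g_def sum_distrib_left by (simp add: Legendre_mult[OF p] mult_ac)
  hence "of_int (Legendre k (int p)) * (of_int (Legendre k (int p)) * poly (fekete_poly p) (circ p (of_int k)))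
      = of_int (Legendre k (int p)) * gauss_sum p" by (rule arg_cong)
  moreover have "Legendre k (int p) = 1 \<or> Legendre k (int p) = -1"
    using Legendre_range[of k "int p"] Legendre_eq_0_iff[of k "int p"] False by auto
  hence "(of_int (Legendre k (int p)) :: complex) * of_int (Legendre k (int p)) = 1" by auto
  ultimately show ?thesis by (simp add: mult.assoc[symmetric])
qed

text \<open>Otherwise \<open>f\<^sub>p\<close>, of degree less than \<open>p\<close>, would vanish at all \<open>p\<close>-th roots of unity.\<close>

lemma gauss_sum_nonzero:
  assumes p: "prime p" "p > 2"
  shows "gauss_sum p \<noteq> 0"
proof
  assume 0: "gauss_sum p = 0"
  have "{z::complex. z ^ p = 1} \<subseteq> {z. poly (fekete_poly p) z = 0}"
  proof clarify
    fix z :: complex assume "z ^ p = 1"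
    moreover have "(\<lambda>k. cis (2 * pi * real k / real p)) ` {..<p} = {z. z ^ p = 1}"
      using p by (intro bij_betw_imp_surj_on bij_betw_roots_unity) simp
    ultimately have "z \<in> (\<lambda>k. cis (2 * pi * real k / real p)) ` {..<p}" by simp
    then obtain k where "k < p" "z = cis (2 * pi * real k / real p)" by blast
    hence "z = circ p (of_int (int k))" unfolding circ_def by simp
    thus "poly (fekete_poly p) z = 0" using poly_fekete_root_of_unity[OF p, of "int k"] 0 by simp
  qed
  hence "card {z::complex. z ^ p = 1} \<le> card {z. poly (fekete_poly p) z = 0}"
    using fekete_nonzero[of p] p by (intro card_mono poly_roots_finite) auto
  also have "\<dots> \<le> degree (fekete_poly p)"
    using fekete_nonzero[of p] p by (intro card_poly_roots_bound) auto
  also have "\<dots> < p" using p by (intro degree_fekete) auto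
  finally show False using card_roots_unity_eq[of p] p by simp
qed

lemma inverse_cis_minus_1:
  assumes "sin t \<noteq> 0"
  shows "1 / (cis (2 * t) - 1) = - (1 / 2) - \<i> / 2 * complex_of_real (cot t)"
proof -
  have *: "cos (t * 2) = 1 - 2 * (sin t * sin t)" "sin (t * 2) = 2 * sin t * cos t"
    using cos_double_sin[of t] sin_double[of t] by (simp_all add: mult.commute power2_eq_square)
  have "(sin t * sin t + cos t * cos t) * (sin t * 2) = sin t * 2"
    using sin_cos_squared_add[of t] by (simp add: power2_eq_square)
  hence k: "cos t * (cos t * (sin t * 2)) + sin t * (sin t * (sin t * 2)) = sin t * 2"
    by (simp only: distrib_right mult.assoc add.commute)
  from * have "(cis (2 * t) - 1) * (- (1 / 2) - \<i> / 2 * complex_of_real (cot t)) = 1"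
    using assms
    by (simp add: complex_eq_iff cot_def field_simps * del: sin_double cos_double)
      (simp add: k)
  thus ?thesis by (metis divide_eq_eq mult.commute mult_zero_left zero_neq_one)
qed

text \<open>For odd \<open>p\<close> the window of radius \<open>p div 2\<close> is a complete system of residues, chosen as close to the arc as possible.\<close>

definition cot_sum :: "nat \<Rightarrow> int \<Rightarrow> real \<Rightarrow> real" where
  "cot_sum p m x = (\<Sum>j\<in>window (p div 2). of_int (Legendre (m + j) (int p)) * cot (pi / real p * (x - of_int j)))"

lemma sum_residues_window:
  fixes g :: "int \<Rightarrow> 'a::comm_monoid_add"
  assumes p: "p = 2 * c + 1" and per: "\<And>x y. [x = y] (mod int p) \<Longrightarrow> g x = g y"
  shows "(\<Sum>j\<in>window c. g j) = (\<Sum>x\<in>{0..<int p}. g x)"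
proof -
  have "(\<Sum>j\<in>window c. g j) = (\<Sum>x\<in>{0..<int p}. g (x + - int c))"
    unfolding window_def p
    by (rule sum.reindex_bij_witness[of _ "\<lambda>x. x - int c" "\<lambda>j. j + int c"]) auto
  also have "\<dots> = (\<Sum>x\<in>{0..<int p}. g x)" using p per by (intro sum_residues_shift) auto
  finally show ?thesis .
qed

lemma sin_arc_nonzero:
  assumes "p > 0" "0 < x" "x < 1"
  shows "sin (pi / real p * (x - of_int j)) \<noteq> 0"
proof
  assume "sin (pi / real p * (x - of_int j)) = 0"
  then obtain i :: int where "pi / real p * (x - of_int j) = of_int i * pi" using sin_zero_iff_int2 by blast
  hence "pi * (x - of_int j) = pi * (of_int i * real p)" using assms(1) by (simp add: field_simps)
  hence "x - of_int j = of_int i * real p" by simp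
  hence "x = of_int (j + i * int p)" by simp
  hence "0 < j + i * int p" "j + i * int p < 1" using assms(2,3) by (simp_all only: of_int_0_less_iff of_int_less_1_iff)
  thus False by simp
qed

text \<open>Replacing \<open>\<chi>(a)\<close> times the Gauss sum by \<open>\<Sum>\<^sub>k \<chi>(k) \<zeta>\<^sup>a\<^sup>k\<close> in \<open>f\<^sub>p(z)\<close> and summing over \<open>a\<close> first yields
  \<open>(z\<^sup>p - 1) \<Sum>\<^sub>k \<chi>(k) / (\<zeta>\<^sup>k z - 1)\<close>. Here \<open>1/(e\<^sup>2\<^sup>i\<^sup>t - 1) = -1/2 - (i/2) cot t\<close>, and the constant disappears
  because the Legendre symbols sum to \<open>0\<close>.\<close>

lemma fekete_on_arc:
  assumes p: "prime p" "p > 2" and x: "0 < x" "x < 1"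
  shows "poly (fekete_poly p) (circ p (of_int m + x)) = 0 \<longleftrightarrow> cot_sum p m x = 0"
proof -
  define z where "z = circ p (of_int m + x)"
  define W where "W y = pi / real p * (x - of_int y)" for y :: int
  obtain c where c: "p = 2 * c + 1" using odd_prime_form[OF p] by blast
  have p0: "p > 0" using p by simp
  have ckz: "circ p (of_int k) * z = cis (2 * W (- m - k))" for k
  proof -
    have "circ p (of_int k) * z = circ p (of_int k + (of_int m + x))" by (simp only: z_def circ_add)
    also have "\<dots> = cis (2 * W (- m - k))"
      unfolding W_def circ_def by (rule arg_cong[of _ _ cis]) (simp add: algebra_simps add_divide_distrib)
    finally show ?thesis .
  qed
  have sW: "sin (W j) \<noteq> 0" for j unfolding W_def by (rule sin_arc_nonzero[OF p0 x])
  have ne: "cis (2 * W j) \<noteq> 1" for j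
  proof
    assume "cis (2 * W j) = 1"
    hence "cos (2 * W j) = 1" by (metis cis.sel(1) one_complex.sel(1))
    thus False using sW[of j] by (simp add: cos_double_sin)
  qed
  have zp: "z ^ p \<noteq> 1"
  proof -
    have "z ^ p = (circ p (of_int (-m)) * z) ^ p"
      using circ_power[of p "of_int (-m)" p] circ_int_periodic[OF p0, of 0 "-m"]
      by (simp add: power_mult_distrib circ_def)
    also have "\<dots> = cis (2 * (real p * W 0))" unfolding ckz by (simp add: DeMoivre algebra_simps)
    also have "real p * W 0 = pi * x" using p0 unfolding W_def by simp
    finally have zp: "z ^ p = cis (2 * (pi * x))" .
    have "sin (pi * x) > 0" using x by (intro sin_gt_zero) auto
    moreover have "cos (2 * (pi * x)) = 1" if "z ^ p = 1" using that zp by (metis cis.sel(1) one_complex.sel(1))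
    ultimately show ?thesis by (auto simp: cos_double_sin)
  qed
  have geo: "(\<Sum>x\<in>{0..<int p}. circ p (of_int (k * x)) * z ^ nat x) = (z ^ p - 1) * (1 / (circ p (of_int k) * z - 1))" for k
  proof -
    have "(\<Sum>x\<in>{0..<int p}. circ p (of_int (k * x)) * z ^ nat x) = (\<Sum>a<p. (circ p (of_int k) * z) ^ a)"
      by (rule sum.reindex_bij_witness[of _ int nat]) (auto simp: power_mult_distrib circ_power mult.commute)
    also have "\<dots> = ((circ p (of_int k) * z) ^ p - 1) / (circ p (of_int k) * z - 1)"
      using ne[of "-m-k"] ckz[of k] by (intro geometric_sum) simp
    also have "(circ p (of_int k) * z) ^ p = z ^ p"
      by (simp add: power_mult_distrib circ_int_power_self[OF p0])
    finally show ?thesis by simp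
  qed
  define g where "g k = of_int (Legendre k (int p)) * (1 / (circ p (of_int k) * z - 1))" for k
  have gper: "g k = g l" if "[k = l] (mod int p)" for k l
    unfolding g_def using Legendre_cong[OF that] circ_cong[OF p0 that] by simp
  have "gauss_sum p * poly (fekete_poly p) z
      = (\<Sum>x\<in>{0..<int p}. (\<Sum>k\<in>{0..<int p}. of_int (Legendre k (int p)) * circ p (of_int (x * k))) * z ^ nat x)"
    unfolding poly_fekete[of p z] sum_distrib_left poly_fekete_circ_int[symmetric] poly_fekete_root_of_unity[OF p]
    by (simp add: mult_ac)
  also have "\<dots> = (\<Sum>k\<in>{0..<int p}. of_int (Legendre k (int p)) * (\<Sum>x\<in>{0..<int p}. circ p (of_int (k * x)) * z ^ nat x))"
    unfolding sum_distrib_left sum_distrib_right by (subst sum.swap) (simp add: mult_ac)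
  also have "\<dots> = (z ^ p - 1) * (\<Sum>k\<in>{0..<int p}. g k)"
    unfolding geo g_def sum_distrib_left by (simp add: mult_ac)
  also have "(\<Sum>k\<in>{0..<int p}. g k) = (\<Sum>k\<in>{0..<int p}. g (k + - m))"
    by (rule sum_residues_shift[symmetric]) (use p0 gper in auto)
  also have "\<dots> = (\<Sum>j\<in>window c. g (j + - m))"
    by (rule sum_residues_window[OF c, symmetric]) (auto intro!: gper cong_diff)
  also have "\<dots> = (\<Sum>j\<in>window c. g (- m - j))"
    by (rule sum.reindex_bij_witness[of _ uminus uminus]) (auto simp: window_def)
  also have "\<dots> = (\<Sum>j\<in>window c. of_int (Legendre (-1) (int p) * Legendre (m + j) (int p)) * (- (1 / 2) - \<i> / 2 * complex_of_real (cot (W j))))"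
  proof (intro sum.cong refl)
    fix j
    have "- m - j = (-1) * (m + j)" by simp
    hence "Legendre (- m - j) (int p) = Legendre (-1) (int p) * Legendre (m + j) (int p)"
      by (simp only: Legendre_mult[OF p])
    thus "g (- m - j) = of_int (Legendre (-1) (int p) * Legendre (m + j) (int p)) * (- (1 / 2) - \<i> / 2 * complex_of_real (cot (W j)))"
      unfolding g_def ckz inverse_cis_minus_1[OF sW] by simp
  qed
  also have "\<dots> = of_int (Legendre (-1) (int p)) * (- (1 / 2) * of_int (\<Sum>j\<in>window c. Legendre (m + j) (int p))
        - \<i> / 2 * complex_of_real (\<Sum>j\<in>window c. of_int (Legendre (m + j) (int p)) * cot (W j)))"
    by (simp add: sum_distrib_left sum_subtractf algebra_simps)
  also have "(\<Sum>j\<in>window c. Legendre (m + j) (int p)) = (\<Sum>j\<in>{0..<int p}. Legendre (j + m) (int p))"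
    by (subst sum_residues_window[OF c]) (auto simp: add.commute intro!: Legendre_cong cong_add)
  also have "\<dots> = 0" by (rule sum_Legendre_shift_eq_0[OF p])
  also have "(\<Sum>j\<in>window c. of_int (Legendre (m + j) (int p)) * cot (W j)) = cot_sum p m x"
    using c unfolding cot_sum_def W_def by simp
  finally have key: "gauss_sum p * poly (fekete_poly p) z = (z ^ p - 1) *
      (of_int (Legendre (-1) (int p)) * (- (1 / 2) * of_int 0 - \<i> / 2 * complex_of_real (cot_sum p m x)))" .
  have "Legendre (-1) (int p) \<noteq> 0" using Legendre_eq_0_iff[of "-1" "int p"] p by auto
  thus ?thesis using key gauss_sum_nonzero[OF p] zp unfolding z_def[symmetric] by auto
qed

definition arc_zeros :: "nat \<Rightarrow> int \<Rightarrow> real set" where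
  "arc_zeros p m = {x\<in>{0<..<1}. cot_sum p m x = 0}"

lemma circ_inj:
  assumes "p > 0" "0 \<le> y" "y < real p" "0 \<le> y'" "y' < real p" "circ p y = circ p y'"
  shows "y = y'"
proof -
  have "circ p (y - y') * circ p y' = circ p y'" using assms(6) by (simp flip: circ_add)
  moreover have "circ p y' \<noteq> 0" unfolding circ_def by simp
  ultimately have "cis (2 * pi * (y - y') / real p) = 1" unfolding circ_def by simp
  hence "cos (2 * pi * (y - y') / real p) = 1" by (metis cis.sel(1) one_complex.sel(1))
  then obtain n :: int where "2 * pi * (y - y') / real p = of_int n * 2 * pi"
    using cos_one_2pi_int by blast
  hence "2 * pi * (y - y') = 2 * pi * (of_int n * real p)" using assms(1) by (simp add: field_simps)
  hence n: "y - y' = of_int n * real p" by simp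
  have "\<bar>y - y'\<bar> < real p" using assms by linarith
  hence "\<bar>real_of_int n\<bar> < 1" using assms(1) unfolding n by (simp add: abs_mult)
  hence "n = 0" by linarith
  thus ?thesis using n by simp
qed

lemma card_unit_circle_zeros:
  assumes p: "prime p" "p > 2"
  shows "card {z. cmod z = 1 \<and> poly (fekete_poly p) z = 0} = 1 + (\<Sum>m\<in>{0..<int p}. card (arc_zeros p m))"
    and "finite (arc_zeros p m)"
proof -
  define Z where "Z = {z. cmod z = 1 \<and> poly (fekete_poly p) z = 0}"
  have p0: "p > 0" using p by simp
  have Zf: "finite Z"
    by (rule finite_subset[of _ "{z. poly (fekete_poly p) z = 0}"])
       (use fekete_nonzero[of p] p in \<open>auto simp: Z_def intro: poly_roots_finite\<close>)
  have mem: "circ p (of_int m + x) \<in> Z" if "x \<in> arc_zeros p m" for m x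
    using that fekete_on_arc[OF p, of x m] unfolding Z_def arc_zeros_def circ_def by auto
  have inj: "inj_on (\<lambda>(m, x). circ p (of_int m + x)) (SIGMA m:{0..<int p}. arc_zeros p m)"
  proof (rule inj_onI, clarsimp)
    fix m x m' x'
    assume m: "0 \<le> m" "m < int p" "0 \<le> m'" "m' < int p" and x: "x \<in> arc_zeros p m" "x' \<in> arc_zeros p m'"
      and eq: "circ p (of_int m + x) = circ p (of_int m' + x')"
    have b: "0 < x" "x < 1" "0 < x'" "x' < 1" using x unfolding arc_zeros_def by auto
    have "real_of_int (m + 1) \<le> of_int (int p)" "real_of_int (m' + 1) \<le> of_int (int p)"
      using m by (simp_all only: of_int_le_iff)
    hence mp: "of_int m + x < real p" "of_int m' + x' < real p" using b by simp_all
    have "of_int m + x = of_int m' + x'"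
      by (rule circ_inj[OF p0 _ mp(1) _ mp(2) eq]) (use m b in simp_all)
    hence "\<bar>real_of_int (m - m')\<bar> < 1" using b by simp
    hence "m = m'" by linarith
    thus "m = m' \<and> x = x'" using \<open>of_int m + x = of_int m' + x'\<close> by simp
  qed
  have img: "Z = insert 1 ((\<lambda>(m, x). circ p (of_int m + x)) ` (SIGMA m:{0..<int p}. arc_zeros p m))"
  proof (intro equalityI subsetI)
    fix z assume z: "z \<in> Z"
    obtain t where t: "0 \<le> t" "t < 2 * pi" "z = cis t"
    proof -
      have "(Re z)\<^sup>2 + (Im z)\<^sup>2 = 1" using z unfolding Z_def by (simp add: cmod_power2[symmetric])
      then obtain t where "0 \<le> t" "t < 2 * pi" "Re z = cos t" "Im z = sin t" using sincos_total_2pi by metis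
      thus ?thesis using that by (simp add: complex_eq_iff)
    qed
    define y where "y = t * real p / (2 * pi)"
    have y: "0 \<le> y" "y < real p" "z = circ p y"
      using t p0 unfolding y_def circ_def by (simp_all add: field_simps)
    define m where "m = \<lfloor>y\<rfloor>"
    define x where "x = frac y"
    have mx: "y = of_int m + x" "0 \<le> x" "x < 1" 
      unfolding m_def x_def using frac_lt_1[of y] frac_ge_0[of y] by (simp_all add: frac_def)
    have m: "0 \<le> m" "m < int p" using y unfolding m_def by linarith+
    show "z \<in> insert 1 ((\<lambda>(m, x). circ p (of_int m + x)) ` (SIGMA m:{0..<int p}. arc_zeros p m))"
    proof (cases "x = 0")
      case True
      hence zm: "z = circ p (of_int m)" using y mx by simp
      hence "of_int (Legendre m (int p)) * gauss_sum p = 0"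
        using z poly_fekete_root_of_unity[OF p, of m] unfolding Z_def by simp
      hence "Legendre m (int p) = 0" using gauss_sum_nonzero[OF p] by simp
      hence "int p dvd m" using Legendre_eq_0_iff by blast
      hence "m = 0" using m dvd_imp_le_int[of m "int p"] by auto
      thus ?thesis using zm unfolding circ_def by simp
    next
      case False
      hence "x \<in> arc_zeros p m"
        using mx z y fekete_on_arc[OF p, of x m] unfolding arc_zeros_def Z_def by auto
      thus ?thesis using m y(3) mx(1) by (intro insertI2 image_eqI[of _ _ "(m, x)"]) auto
    qed
  next
    fix z assume "z \<in> insert 1 ((\<lambda>(m, x). circ p (of_int m + x)) ` (SIGMA m:{0..<int p}. arc_zeros p m))"
    moreover have "1 \<in> Z"
      using poly_fekete_root_of_unity[OF p, of 0] Legendre_eq_0_iff[of 0 "int p"] unfolding Z_def circ_def by simp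
    ultimately show "z \<in> Z" using mem by auto
  qed
  have fin: "finite (arc_zeros p m)" for m
  proof (rule finite_imageD)
    show "finite ((\<lambda>x. circ p (of_int m + x)) ` arc_zeros p m)"
      by (rule finite_subset[OF _ Zf]) (use mem in auto)
    show "inj_on (\<lambda>x. circ p (of_int m + x)) (arc_zeros p m)"
    proof (rule inj_onI)
      fix x y assume xy: "x \<in> arc_zeros p m" "y \<in> arc_zeros p m" "circ p (of_int m + x) = circ p (of_int m + y)"
      have "circ p (of_int m) \<noteq> 0" unfolding circ_def by simp
      hence "circ p x = circ p y" using xy(3) by (simp add: circ_add)
      thus "x = y" using xy(1,2) p by (intro circ_inj[OF p0]) (auto simp: arc_zeros_def)
    qed
  qed
  thus "finite (arc_zeros p m)" .
  have "1 \<notin> (\<lambda>(m, x). circ p (of_int m + x)) ` (SIGMA m:{0..<int p}. arc_zeros p m)"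
  proof
    assume "1 \<in> (\<lambda>(m, x). circ p (of_int m + x)) ` (SIGMA m:{0..<int p}. arc_zeros p m)"
    then obtain m x where m: "0 \<le> m" "m < int p" "x \<in> arc_zeros p m" "1 = circ p (of_int m + x)" by auto
    have x: "0 < x" "x < 1" using m unfolding arc_zeros_def by auto
    have "real_of_int (m + 1) \<le> of_int (int p)" using m by (simp only: of_int_le_iff)
    hence "of_int m + x < real p" using x by simp
    moreover have "circ p (of_int m + x) = circ p 0" using m(4) by (simp add: circ_def)
    ultimately have "of_int m + x = 0" using m x p0 by (intro circ_inj[OF p0]) auto
    thus False using m x by linarith
  qed
  hence "card Z = 1 + card ((\<lambda>(m, x). circ p (of_int m + x)) ` (SIGMA m:{0..<int p}. arc_zeros p m))"
    unfolding img using Zf img by (subst card_insert_disjoint) (auto dest: finite_subset)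
  also have "card ((\<lambda>(m, x). circ p (of_int m + x)) ` (SIGMA m:{0..<int p}. arc_zeros p m))
     = (\<Sum>m\<in>{0..<int p}. card (arc_zeros p m))"
    using card_image[OF inj] fin by simp
  finally show "card {z. cmod z = 1 \<and> poly (fekete_poly p) z = 0} = 1 + (\<Sum>m\<in>{0..<int p}. card (arc_zeros p m))"
    unfolding Z_def .
qed

section \<open>Sine, cotangent and zeros of convex functions\<close>

lemma cos_ge_quadratic: "u \<ge> 0 \<Longrightarrow> cos u \<ge> 1 - u ^ 2 / 2" for u :: real
proof -
  assume u: "u \<ge> 0"
  have "(\<lambda>x. cos x - 1 + x ^ 2 / 2) 0 \<le> (\<lambda>x. cos x - 1 + x ^ 2 / 2) u"
  proof (rule DERIV_nonneg_imp_nondecreasing[OF u])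
    fix x :: real assume "0 \<le> x"
    thus "\<exists>y. ((\<lambda>x. cos x - 1 + x ^ 2 / 2) has_real_derivative y) (at x) \<and> 0 \<le> y"
      by (intro exI[of _ "- sin x + x"] conjI) (auto intro!: derivative_eq_intros sin_x_le_x)
  qed
  thus ?thesis by simp
qed

lemma sin_ge_cubic: "u \<ge> 0 \<Longrightarrow> sin u \<ge> u - u ^ 3 / 6" for u :: real
proof -
  assume u: "u \<ge> 0"
  have "(\<lambda>x. sin x - x + x ^ 3 / 6) 0 \<le> (\<lambda>x. sin x - x + x ^ 3 / 6) u"
  proof (rule DERIV_nonneg_imp_nondecreasing[OF u])
    fix x :: real assume "0 \<le> x"
    thus "\<exists>y. ((\<lambda>x. sin x - x + x ^ 3 / 6) has_real_derivative y) (at x) \<and> 0 \<le> y"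
      using cos_ge_quadratic[of x]
      by (intro exI[of _ "cos x - 1 + x ^ 2 / 2"] conjI) (auto intro!: derivative_eq_intros)
  qed
  thus ?thesis by simp
qed

lemma cos_le_quartic: "u \<ge> 0 \<Longrightarrow> cos u \<le> 1 - u ^ 2 / 2 + u ^ 4 / 24" for u :: real
proof -
  assume u: "u \<ge> 0"
  have "(\<lambda>x. 1 - x ^ 2 / 2 + x ^ 4 / 24 - cos x) 0 \<le> (\<lambda>x. 1 - x ^ 2 / 2 + x ^ 4 / 24 - cos x) u"
  proof (rule DERIV_nonneg_imp_nondecreasing[OF u])
    fix x :: real assume "0 \<le> x"
    thus "\<exists>y. ((\<lambda>x. 1 - x ^ 2 / 2 + x ^ 4 / 24 - cos x) has_real_derivative y) (at x) \<and> 0 \<le> y"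
      using sin_ge_cubic[of x]
      by (intro exI[of _ "- x + x ^ 3 / 6 + sin x"] conjI) (auto intro!: derivative_eq_intros)
  qed
  thus ?thesis by simp
qed

text \<open>The cosine is nonpositive at \<open>8/5\<close>. The value is accurate enough to keep all angles below \<open>\<surd>3\<close>, up to which the
  bounds on sine and cotangent hold.\<close>

lemma pi_le_16_5: "pi \<le> 16 / 5"
proof (rule ccontr)
  assume "\<not> ?thesis"
  hence "cos (8 / 5 :: real) > 0" by (intro cos_gt_zero_pi) auto
  moreover have "cos (8 / 5 :: real) \<le> 1 - (8 / 5) ^ 2 / 2 + (8 / 5) ^ 4 / 24" by (rule cos_le_quartic) simp
  ultimately show False by (simp add: power_def)
qed

lemma abs_sin_ge_half:
  fixes u :: real
  assumes "u ^ 2 \<le> 3"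
  shows "\<bar>sin u\<bar> \<ge> \<bar>u\<bar> / 2"
proof -
  have pos: "sin v \<ge> v / 2" if "v \<ge> 0" "v ^ 2 \<le> 3" for v :: real
  proof -
    have "v ^ 3 / 6 = v * (v ^ 2 / 6)" by (simp add: power3_eq_cube power2_eq_square)
    also have "\<dots> \<le> v * (1 / 2)" using that by (intro mult_left_mono) auto
    finally show ?thesis using sin_ge_cubic[OF that(1)] by simp
  qed
  show ?thesis using pos[of u] pos[of "-u"] assms by (cases "u \<ge> 0") auto
qed

text \<open>With \<open>v = u\<^sup>2\<close>, the bound \<open>sin u \<ge> u(1 - v/6)\<close> reduces the claim to \<open>(1 - v/6)\<^sup>2(1 + v) \<ge> 1\<close>, and the difference
  of the two sides is \<open>v(3-v)(8-v)/36\<close>.\<close>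

lemma inverse_sin_squared_le:
  fixes u :: real
  assumes "u \<noteq> 0" "u ^ 2 \<le> 3"
  shows "1 / (sin u) ^ 2 \<le> 1 / u ^ 2 + 1"
proof -
  have pos: "1 / (sin u) ^ 2 \<le> 1 / u ^ 2 + 1" if u: "u > 0" "u ^ 2 \<le> 3" for u :: real
  proof -
    define v where "v = u ^ 2"
    have v: "0 < v" "v \<le> 3" using u unfolding v_def by auto
    have s: "sin u \<ge> u * (1 - v / 6)" using sin_ge_cubic[of u] u
      unfolding v_def by (simp add: algebra_simps power3_eq_cube power2_eq_square)
    have "0 \<le> v * ((3 - v) * (8 - v)) / 36" using v by simp
    also have "\<dots> = (1 - v / 6) ^ 2 * (1 + v) - 1" by (simp add: power2_eq_square field_simps)
    finally have "1 \<le> (1 - v / 6) ^ 2 * (1 + v)" by simp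
    hence "v * 1 \<le> v * ((1 - v / 6) ^ 2 * (1 + v))" using v by (intro mult_left_mono) auto
    also have "\<dots> = (u * (1 - v / 6)) ^ 2 * (1 + v)" by (simp add: power_mult_distrib v_def)
    also have "\<dots> \<le> (sin u) ^ 2 * (1 + v)"
      using s u v by (intro mult_right_mono power_mono) auto
    finally have le: "v \<le> (sin u) ^ 2 * (1 + v)" by simp
    have "u * (1 - v / 6) > 0" using u v by (intro mult_pos_pos) auto
    hence "sin u > 0" using s by linarith
    thus ?thesis using le v unfolding v_def[symmetric] by (simp add: field_simps)
  qed
  show ?thesis using pos[of u] pos[of "-u"] assms by (cases "u > 0") auto
qed

lemma abs_cot_le:
  fixes u :: real
  assumes "u \<noteq> 0" "u ^ 2 \<le> 3"
  shows "\<bar>cot u\<bar> \<le> 1 / \<bar>u\<bar>"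
proof -
  have pos: "\<bar>cot u\<bar> \<le> 1 / u" if u: "u > 0" "u ^ 2 \<le> 3" for u :: real
  proof -
    define v where "v = u ^ 2"
    have v: "0 < v" "v \<le> 3" using u unfolding v_def by auto
    have v4: "u ^ 4 = v * v" unfolding v_def by (simp add: power4_eq_xxxx power2_eq_square)
    have s: "sin u \<ge> u * (1 - v / 6)" using sin_ge_cubic[of u] u
      unfolding v_def by (simp add: algebra_simps power3_eq_cube power2_eq_square)
    have "u * (1 - v / 6) > 0" using u v by (intro mult_pos_pos) auto
    hence s0: "sin u > 0" using s by linarith
    have "cos u \<le> 1 - u ^ 2 / 2 + u ^ 4 / 24" using cos_le_quartic[of u] u by simp
    hence "cos u \<le> 1 - v / 2 + v * v / 24" by (simp only: v4 v_def[symmetric])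
    moreover have "v * v \<le> 3 * v" using v by (intro mult_right_mono) auto
    ultimately have 1: "cos u \<le> 1 - v / 6" using v by linarith
    have 2: "- cos u \<le> 1 - v / 6" using cos_ge_quadratic[of u] u v unfolding v_def by simp
    have "\<bar>cos u\<bar> \<le> 1 - v / 6" using 1 2 by (simp add: abs_le_iff)
    hence "u * \<bar>cos u\<bar> \<le> u * (1 - v / 6)" using u by (intro mult_left_mono) auto
    hence "u * \<bar>cos u\<bar> \<le> sin u" using s by linarith
    thus ?thesis using s0 u by (simp add: cot_def abs_divide field_simps)
  qed
  show ?thesis using pos[of u] pos[of "-u"] assms by (cases "u > 0") auto
qed

lemma cot_approx:
  fixes u :: real
  assumes "u \<noteq> 0" "\<bar>u\<bar> \<le> 1"
  shows "\<bar>cot u - 1 / u\<bar> \<le> \<bar>u\<bar> / 2"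
proof -
  have pos: "\<bar>cot u - 1 / u\<bar> \<le> u / 2" if u: "u > 0" "u \<le> 1" for u :: real
  proof -
    have u2: "u ^ 2 \<le> 1" using u power_le_one[of u 2] by simp
    have "\<bar>cot u\<bar> \<le> 1 / \<bar>u\<bar>" by (rule abs_cot_le) (use u u2 in auto)
    hence 1: "cot u \<le> 1 / u" using u by simp
    have s0: "sin u > 0" using u pi_ge_two by (intro sin_gt_zero) auto
    have "(1 - u ^ 2 / 2) / u \<le> (1 - u ^ 2 / 2) / sin u"
      using s0 u u2 sin_x_le_x[of u] by (intro divide_left_mono) auto
    also have "\<dots> \<le> cos u / sin u"
      using s0 u cos_ge_quadratic[of u] by (intro divide_right_mono) auto
    finally have "(1 - u ^ 2 / 2) / u \<le> cot u" by (simp add: cot_def)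
    moreover have "(1 - u ^ 2 / 2) / u = 1 / u - u / 2" using u by (simp add: field_simps power2_eq_square)
    ultimately show ?thesis using 1 u by (simp add: abs_le_iff)
  qed
  show ?thesis
  proof (cases "u > 0")
    case False
    have "cot u - 1 / u = - (cot (- u) - 1 / (- u))" by simp
    hence "\<bar>cot u - 1 / u\<bar> = \<bar>cot (- u) - 1 / (- u)\<bar>" by (metis abs_minus_cancel)
    thus ?thesis using pos[of "-u"] False assms by simp
  qed (use pos[of u] assms in auto)
qed

lemma Rolle_real:
  fixes f f' :: "real \<Rightarrow> real"
  assumes "a < b" "f a = 0" "f b = 0" "\<And>x. a \<le> x \<Longrightarrow> x \<le> b \<Longrightarrow> (f has_real_derivative f' x) (at x)"
  obtains z where "a < z" "z < b" "f' z = 0"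
proof -
  obtain z where "a < z" "z < b" "f b - f a = (b - a) * f' z" using MVT2[OF assms(1,4)] by blast
  thus ?thesis using that assms by simp
qed

lemma card_zeros_le_1:
  fixes f f' :: "real \<Rightarrow> real"
  assumes der: "\<And>x. 0 < x \<Longrightarrow> x < 1 \<Longrightarrow> (f has_real_derivative f' x) (at x)"
    and nz: "\<And>x. 0 < x \<Longrightarrow> x < 1 \<Longrightarrow> f' x \<noteq> 0" and fin: "finite {x\<in>{0<..<1}. f x = 0}"
  shows "card {x\<in>{0<..<1}. f x = 0} \<le> 1"
proof (rule ccontr)
  assume "\<not> ?thesis"
  then obtain a b where ab: "a \<in> {x\<in>{0<..<1}. f x = 0}" "b \<in> {x\<in>{0<..<1}. f x = 0}" "a \<noteq> b"
    using card_le_Suc0_iff_eq[OF fin] by auto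
  have False if "a < b" "0 < a" "b < 1" "f a = 0" "f b = 0" for a b
  proof (rule Rolle_real[OF that(1,4,5), of f'])
    show "(f has_real_derivative f' x) (at x)" if "a \<le> x" "x \<le> b" for x
      by (rule der) (use that \<open>0 < a\<close> \<open>b < 1\<close> in auto)
    fix z assume "a < z" "z < b" "f' z = 0"
    thus False using nz[of z] that by simp
  qed
  moreover have "a < b \<or> b < a" using ab(3) by linarith
  ultimately show False using ab(1,2) by auto
qed

lemma card_zeros_le_2:
  fixes f f' f'' :: "real \<Rightarrow> real"
  assumes der: "\<And>x. 0 < x \<Longrightarrow> x < 1 \<Longrightarrow> (f has_real_derivative f' x) (at x)"
    and der2: "\<And>x. 0 < x \<Longrightarrow> x < 1 \<Longrightarrow> (f' has_real_derivative f'' x) (at x)"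
    and nz: "\<And>x. 0 < x \<Longrightarrow> x < 1 \<Longrightarrow> f'' x \<noteq> 0" and fin: "finite {x\<in>{0<..<1}. f x = 0}"
  shows "card {x\<in>{0<..<1}. f x = 0} \<le> 2"
proof (rule ccontr)
  assume "\<not> ?thesis"
  hence "3 \<le> card {x\<in>{0<..<1}. f x = 0}" by simp
  then obtain T where T: "T \<subseteq> {x\<in>{0<..<1}. f x = 0}" "card T = 3" by (rule obtain_subset_with_card_n)
  from T(2) obtain x y z where "T = {x, y, z}" "x \<noteq> y" "y \<noteq> z" "x \<noteq> z" unfolding card_3_iff by blast
  hence "\<exists>a\<in>T. \<exists>b\<in>T. \<exists>c\<in>T. a < b \<and> b < c" by (cases "x < y"; cases "y < z"; cases "x < z") auto
  then obtain a b c where abc: "a \<in> T" "b \<in> T" "c \<in> T" "a < b" "b < c" by blast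
  hence z: "0 < a" "c < 1" "f a = 0" "f b = 0" "f c = 0" using T by auto
  obtain s where s: "a < s" "s < b" "f' s = 0"
    by (rule Rolle_real[OF abc(4) z(3,4), of f']) (use der abc z in auto)
  obtain t where t: "b < t" "t < c" "f' t = 0"
    by (rule Rolle_real[OF abc(5) z(4,5), of f']) (use der abc z in auto)
  obtain r where "s < r" "r < t" "f'' r = 0"
    by (rule Rolle_real[of s t f' f'']) (use der2 abc z s t in auto)
  thus False using nz[of r] s t z by simp
qed

definition cot_sum' :: "nat \<Rightarrow> int \<Rightarrow> real \<Rightarrow> real" where
  "cot_sum' p m x = (\<Sum>j\<in>window (p div 2). of_int (Legendre (m + j) (int p)) *
     (- (pi / real p) / (sin (pi / real p * (x - of_int j))) ^ 2))"

definition cot_sum'' :: "nat \<Rightarrow> int \<Rightarrow> real \<Rightarrow> real" where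
  "cot_sum'' p m x = (\<Sum>j\<in>window (p div 2). of_int (Legendre (m + j) (int p)) *
     (2 * (pi / real p) ^ 2 * cot (pi / real p * (x - of_int j)) / (sin (pi / real p * (x - of_int j))) ^ 2))"

lemma cot_sum_deriv:
  assumes "p > 0" "0 < x" "x < 1"
  shows "(cot_sum p m has_real_derivative cot_sum' p m x) (at x)"
  unfolding cot_sum_def cot_sum'_def
proof (intro DERIV_sum DERIV_cmult)
  fix j
  have "((\<lambda>x. pi / real p * (x - of_int j)) has_real_derivative pi / real p) (at x)"
    using assms(1) by (auto intro!: derivative_eq_intros)
  from DERIV_chain2[OF DERIV_cot[OF sin_arc_nonzero[OF assms]] this]
  show "((\<lambda>x. cot (pi / real p * (x - of_int j))) has_real_derivative
       - (pi / real p) / (sin (pi / real p * (x - of_int j)))\<^sup>2) (at x)"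
    by (simp add: divide_inverse mult.commute)
qed

lemma cot_sum_deriv2:
  assumes "p > 0" "0 < x" "x < 1"
  shows "(cot_sum' p m has_real_derivative cot_sum'' p m x) (at x)"
  unfolding cot_sum''_def cot_sum'_def
proof (intro DERIV_sum DERIV_cmult)
  fix j
  have nz: "sin (pi / real p * (x - of_int j)) \<noteq> 0" using sin_arc_nonzero[OF assms] .
  show "((\<lambda>x. - (pi / real p) / (sin (pi / real p * (x - of_int j)))\<^sup>2) has_real_derivative
       2 * (pi / real p)\<^sup>2 * cot (pi / real p * (x - of_int j)) / (sin (pi / real p * (x - of_int j)))\<^sup>2) (at x)"
    using nz by (auto intro!: derivative_eq_intros simp: cot_def power2_eq_square divide_simps)
qed

text \<open>The extreme angle \<open>\<pi>(c+1)/(2c+1)\<close> exceeds \<open>\<pi>/2\<close> slightly.\<close>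

lemma arc_angle_bound:
  assumes "p = 2 * c + 1" "c \<ge> 11" "j \<in> window c" "0 \<le> x" "x \<le> 1"
  shows "(pi / real p * (x - of_int j)) ^ 2 \<le> 3"
proof -
  have "- real c \<le> of_int j" "of_int j \<le> real c" using assms(3) unfolding window_def by auto
  hence "\<bar>x - of_int j\<bar> \<le> real c + 1" using assms(4,5) by linarith
  hence "\<bar>pi / real p * (x - of_int j)\<bar> \<le> pi / real p * (real c + 1)"
    unfolding abs_mult using assms(1) by (simp add: mult_left_mono divide_right_mono)
  also have "\<dots> \<le> (16 / 5) / real p * (real c + 1)"
    using pi_le_16_5 by (intro mult_right_mono divide_right_mono) auto
  also have "\<dots> \<le> 17 / 10"
    using assms(1,2) by (simp add: field_simps)
  finally have "\<bar>pi / real p * (x - of_int j)\<bar> \<le> 17 / 10" .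
  hence "(pi / real p * (x - of_int j)) ^ 2 \<le> (17 / 10) ^ 2" by (metis abs_le_square_iff abs_of_nonneg zero_le_divide_iff zero_le_numeral)
  moreover have "(17 / 10) ^ 2 \<le> (3 :: real)" by (simp add: power2_eq_square)
  ultimately show ?thesis by linarith
qed

section \<open>Zeros on an arc away from 1\<close>

text \<open>The lower bound on \<open>c\<close> makes the error terms from replacing \<open>w cot(wy)\<close> by \<open>1/y\<close> harmless: it gives
  \<open>p w\<^sup>2 \<le> 1/10\<close> and \<open>cos w \<ge> 99/100\<close>.\<close>

locale fekete_arc =
  fixes p c :: nat and w :: real
  assumes prime_p: "prime p" and p_def: "p = 2 * c + 1" and c_ge: "c \<ge> 60" and w_def: "w = pi / real p"
begin

lemma p_gt: "p > 2" "p > 0" using p_def c_ge by auto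
lemma p_div_2: "p div 2 = c" using p_def by simp
lemma w_pos: "w > 0" using p_gt unfolding w_def by simp
lemma w_small: "w \<le> 1 / 10"
  using pi_le_16_5 p_def c_ge unfolding w_def by (simp add: divide_le_eq)
lemma pw_squared: "real p * w ^ 2 \<le> 1 / 10"
proof -
  have "real p * w ^ 2 = pi ^ 2 / real p" using p_gt unfolding w_def by (simp add: power2_eq_square)
  also have "\<dots> \<le> (16 / 5) ^ 2 / 121"
    using pi_le_16_5 p_def c_ge by (intro frac_le power_mono) auto
  finally show ?thesis by (simp add: power2_eq_square)
qed

lemma angle_bound: "j \<in> window c \<Longrightarrow> 0 \<le> x \<Longrightarrow> x \<le> 1 \<Longrightarrow> (w * (x - of_int j)) ^ 2 \<le> 3"
  unfolding w_def using arc_angle_bound[OF p_def] c_ge by simp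

lemma Legendre_abs_le: "\<bar>real_of_int (Legendre k (int p))\<bar> \<le> 1"
  using Legendre_range[of k "int p"] by auto

lemma csc_squared_term:
  assumes "j \<in> window c" "0 \<le> x" "x \<le> 1" "x - of_int j \<noteq> 0"
  shows "w ^ 2 / (sin (w * (x - of_int j))) ^ 2 \<le> 1 / (x - of_int j) ^ 2 + w ^ 2"
proof -
  have "1 / (sin (w * (x - of_int j))) ^ 2 \<le> 1 / (w * (x - of_int j)) ^ 2 + 1"
    by (rule inverse_sin_squared_le) (use assms w_pos angle_bound in auto)
  hence "w ^ 2 * (1 / (sin (w * (x - of_int j))) ^ 2) \<le> w ^ 2 * (1 / (w * (x - of_int j)) ^ 2 + 1)"
    by (intro mult_left_mono) auto
  also have "\<dots> = 1 / (x - of_int j) ^ 2 + w ^ 2"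
    using w_pos by (simp add: power_mult_distrib distrib_left)
  finally show ?thesis by simp
qed

lemma csc_squared_ge:
  assumes "x - of_int j \<noteq> 0" "sin (w * (x - of_int j)) \<noteq> 0"
  shows "1 / (x - of_int j) ^ 2 \<le> w ^ 2 / (sin (w * (x - of_int j))) ^ 2"
proof -
  define y where "y = x - of_int j"
  have "\<bar>sin (w * y)\<bar> \<le> \<bar>w * y\<bar>" by (rule abs_sin_x_le_abs_x)
  hence "(sin (w * y)) ^ 2 \<le> w ^ 2 * y ^ 2" by (simp add: abs_le_square_iff power_mult_distrib)
  moreover have "(sin (w * y)) ^ 2 > 0" "y ^ 2 > 0" using assms unfolding y_def by simp_all
  ultimately show ?thesis unfolding y_def[symmetric] by (simp add: field_simps)
qed

lemma cot_csc_squared_term: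
  assumes "j \<in> window c" "0 \<le> x" "x \<le> 1" "\<bar>x - of_int j\<bar> \<ge> 1"
  shows "\<bar>w ^ 3 * cot (w * (x - of_int j)) / (sin (w * (x - of_int j))) ^ 2\<bar> \<le> 1 / \<bar>x - of_int j\<bar> ^ 3 + w ^ 2"
proof -
  define y where "y = x - of_int j"
  have y: "\<bar>y\<bar> \<ge> 1" using assms unfolding y_def by simp
  have ang: "(w * y) ^ 2 \<le> 3" "w * y \<noteq> 0" unfolding y_def using angle_bound assms w_pos by auto
  have "w * \<bar>cot (w * y)\<bar> \<le> w * (1 / \<bar>w * y\<bar>)" using abs_cot_le[OF ang(2,1)] w_pos by (intro mult_left_mono) auto
  also have "\<dots> = 1 / \<bar>y\<bar>" using w_pos by (simp add: abs_mult)
  finally have a: "w * \<bar>cot (w * y)\<bar> \<le> 1 / \<bar>y\<bar>" .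
  have b: "w ^ 2 / (sin (w * y)) ^ 2 \<le> 1 / y ^ 2 + w ^ 2"
    unfolding y_def by (rule csc_squared_term) (use assms in auto)
  have "\<bar>w ^ 3 * cot (w * y) / (sin (w * y)) ^ 2\<bar> = (w * \<bar>cot (w * y)\<bar>) * (w ^ 2 / (sin (w * y)) ^ 2)"
    using w_pos by (simp add: abs_mult power3_eq_cube power2_eq_square)
  also have "\<dots> \<le> (1 / \<bar>y\<bar>) * (1 / y ^ 2 + w ^ 2)"
    using a b w_pos by (intro mult_mono) auto
  also have "\<dots> = 1 / \<bar>y\<bar> ^ 3 + w ^ 2 / \<bar>y\<bar>"
  proof -
    have "(1 / a) * (1 / a ^ 2 + W) = 1 / a ^ 3 + W / a" for a W :: real
      by (simp add: distrib_left power3_eq_cube power2_eq_square mult.assoc)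
    from this[of "\<bar>y\<bar>"] show ?thesis by simp
  qed
  also have "w ^ 2 / \<bar>y\<bar> \<le> w ^ 2 / 1" using y by (intro divide_left_mono) auto
  finally show ?thesis unfolding y_def by simp
qed

text \<open>The terms other than the two poles at the ends of the arc: \<open>2 \<Sum> 1/n\<^sup>2 \<le> 4\<close>, plus an error of at most \<open>1/10\<close>.
  The bound \<open>5\<close> is to be compared with the contributions \<open>1/x\<^sup>2 + 1/(1-x)\<^sup>2 \<ge> 8\<close> and \<open>1/x\<^sup>3 + 1/(1-x)\<^sup>3 \<ge> 16\<close>
  of the poles to the first and second derivative.\<close>

lemma outer_sum_bound:
  fixes t :: "int \<Rightarrow> real"
  assumes x: "0 \<le> x" "x \<le> 1"
    and t: "\<And>j. j \<in> window c \<Longrightarrow> \<bar>x - of_int j\<bar> \<ge> 1 \<Longrightarrow> \<bar>t j\<bar> \<le> 1 / (x - of_int j) ^ 2 + w ^ 2"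
  shows "\<bar>\<Sum>j\<in>window c - {0, 1}. of_int (Legendre (m + j) (int p)) * t j\<bar> < 5"
proof -
  define g where "g j = 1 / (x - of_int j) ^ 2 + w ^ 2" for j :: int
  have "\<bar>\<Sum>j\<in>window c - {0, 1}. of_int (Legendre (m + j) (int p)) * t j\<bar>
     \<le> (\<Sum>j\<in>window c - {0, 1}. \<bar>of_int (Legendre (m + j) (int p)) * t j\<bar>)" by (rule sum_abs)
  also have "\<dots> \<le> (\<Sum>j\<in>window c - {0, 1}. g j)"
  proof (rule sum_mono)
    fix j assume j: "j \<in> window c - {0, 1}"
    hence "j \<le> -1 \<or> j \<ge> 2" by auto
    hence "real_of_int j \<le> -1 \<or> real_of_int j \<ge> 2" by linarith
    hence "\<bar>x - of_int j\<bar> \<ge> 1" using x by linarith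
    hence "\<bar>t j\<bar> \<le> g j" unfolding g_def using t j by simp
    moreover have "\<bar>of_int (Legendre (m + j) (int p)) * t j\<bar> \<le> 1 * \<bar>t j\<bar>"
      unfolding abs_mult by (intro mult_right_mono Legendre_abs_le) auto
    ultimately show "\<bar>of_int (Legendre (m + j) (int p)) * t j\<bar> \<le> g j" by linarith
  qed
  also have "\<dots> \<le> (\<Sum>n\<in>{1..c}. g (int n + 1) + g (- int n))"
    by (rule sum_window_outer_le) (simp add: g_def)
  also have "\<dots> \<le> (\<Sum>n\<in>{1..c}. 2 * (1 / real n ^ 2) + 2 * w ^ 2)"
  proof (rule sum_mono)
    fix n assume n: "n \<in> {1..c}"
    have "g j \<le> 1 / real n ^ 2 + w ^ 2" if "\<bar>x - of_int j\<bar> \<ge> real n" for j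
    proof -
      have "real n ^ 2 \<le> \<bar>x - of_int j\<bar> ^ 2" using that by (intro power_mono) auto
      thus ?thesis unfolding g_def using n by (simp add: frac_le)
    qed
    from this[of "int n + 1"] this[of "- int n"] show "g (int n + 1) + g (- int n) \<le> 2 * (1 / real n ^ 2) + 2 * w ^ 2"
      using outer_distance[OF x, of n] n by simp
  qed
  also have "\<dots> = 2 * (\<Sum>n\<in>{1..c}. 1 / real n ^ 2) + 2 * real c * w ^ 2"
    by (simp add: sum.distrib sum_distrib_left)
  also have "\<dots> \<le> 4 + 2 * real c * w ^ 2" using sum_inverse_square_le[of c] by simp
  also have "2 * real c * w ^ 2 \<le> real p * w ^ 2" using p_def by (intro mult_right_mono) auto
  also have "\<dots> \<le> 1 / 10" by (rule pw_squared)
  finally show ?thesis by simp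
qed

lemma window_split: "(\<Sum>j\<in>window c. h j) = h 0 + h 1 + (\<Sum>j\<in>window c - {0, 1}. h j)" for h :: "int \<Rightarrow> real"
proof -
  have "window c = insert 0 (insert 1 (window c - {0, 1}))" using c_ge by (auto simp: window_def)
  hence "(\<Sum>j\<in>window c. h j) = (\<Sum>j\<in>insert 0 (insert 1 (window c - {0, 1})). h j)" by metis
  thus ?thesis by simp
qed

lemma cot_csc_main:
  assumes "0 < y" "y < 1"
  shows "w ^ 3 * cot (w * y) / (sin (w * y)) ^ 2 \<ge> (99 / 100) / y ^ 3"
proof -
  define u where "u = w * y"
  have u: "0 < u" "u \<le> 1 / 10"
  proof -
    show "0 < u" using w_pos assms unfolding u_def by simp
    have "u \<le> w * 1" unfolding u_def using w_pos assms by (intro mult_left_mono) auto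
    thus "u \<le> 1 / 10" using w_small by simp
  qed
  have s: "0 < sin u" "sin u \<le> u" using u pi_ge_two sin_x_le_x[of u] by (auto intro!: sin_gt_zero)
  have "u ^ 2 \<le> (1 / 10) ^ 2" using u by (intro power_mono) auto
  hence "cos u \<ge> 99 / 100" using cos_ge_quadratic[of u] u by (simp add: power2_eq_square)
  hence "(99 / 100) / u ^ 3 \<le> cos u / (sin u) ^ 3"
    using s u by (intro frac_le power_mono) auto
  hence "w ^ 3 * ((99 / 100) / u ^ 3) \<le> w ^ 3 * (cos u / (sin u) ^ 3)"
    using w_pos by (intro mult_left_mono) auto
  moreover have "w ^ 3 * ((99 / 100) / u ^ 3) = (99 / 100) / y ^ 3"
    using w_pos unfolding u_def by (simp add: power_mult_distrib)
  moreover have "w ^ 3 * (cos u / (sin u) ^ 3) = w ^ 3 * cot u / (sin u) ^ 2"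
    by (simp add: cot_def power3_eq_cube power2_eq_square)
  ultimately show ?thesis unfolding u_def by simp
qed

text \<open>For equal signs at the two ends the pole contributions to the first derivative reinforce each other.\<close>

lemma cot_sum'_nonzero:
  assumes x: "0 < x" "x < 1" and s: "Legendre m (int p) = s" "Legendre (m + 1) (int p) = s" "\<bar>s\<bar> = 1"
  shows "cot_sum' p m x \<noteq> 0"
proof
  define t where "t j = w ^ 2 / (sin (w * (x - of_int j))) ^ 2" for j :: int
  have nz: "sin (w * (x - of_int j)) \<noteq> 0" for j unfolding w_def using sin_arc_nonzero[OF p_gt(2) x] .
  assume "cot_sum' p m x = 0"
  moreover have "- w * cot_sum' p m x = (\<Sum>j\<in>window c. of_int (Legendre (m + j) (int p)) * t j)"
    unfolding cot_sum'_def p_div_2 w_def[symmetric] sum_distrib_left t_def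
    by (intro sum.cong refl) (simp add: power2_eq_square)
  ultimately have "of_int s * (t 0 + t 1) = - (\<Sum>j\<in>window c - {0, 1}. of_int (Legendre (m + j) (int p)) * t j)"
    using s unfolding window_split by (simp add: algebra_simps)
  hence "\<bar>of_int s * (t 0 + t 1)\<bar> = \<bar>\<Sum>j\<in>window c - {0, 1}. of_int (Legendre (m + j) (int p)) * t j\<bar>" by simp
  moreover have "\<bar>\<Sum>j\<in>window c - {0, 1}. of_int (Legendre (m + j) (int p)) * t j\<bar> < 5"
  proof (rule outer_sum_bound)
    fix j assume "j \<in> window c" "1 \<le> \<bar>x - of_int j\<bar>"
    thus "\<bar>t j\<bar> \<le> 1 / (x - of_int j) ^ 2 + w ^ 2"
      using csc_squared_term[of j x] x unfolding t_def by auto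
  qed (use x in auto)
  moreover have "\<bar>real_of_int s\<bar> = 1" using s(3) by linarith
  ultimately have "\<bar>t 0 + t 1\<bar> < 5" by (simp add: abs_mult)
  moreover have "t 0 \<ge> 1 / x ^ 2" "t 1 \<ge> 1 / (1 - x) ^ 2"
    using csc_squared_ge[of x 0] csc_squared_ge[of x 1] nz[of 0] nz[of 1] x unfolding t_def
    by (simp_all add: power2_commute)
  moreover have "1 / x ^ 2 + 1 / (1 - x) ^ 2 \<ge> 8"
  proof -
    define a b where "a = 1 / x" and "b = 1 / (1 - x)"
    have ab: "a + b \<ge> 4" unfolding a_def b_def by (rule inverse_sum_ge_4[OF x])
    have "0 \<le> (a - b) ^ 2" by simp
    moreover have "4 ^ 2 \<le> (a + b) ^ 2" using ab by (intro power_mono) auto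
    ultimately have "a ^ 2 + b ^ 2 \<ge> 8" by (simp add: power2_eq_square algebra_simps)
    thus ?thesis unfolding a_def b_def by (simp add: power_one_over)
  qed
  ultimately show False by linarith
qed

text \<open>For opposite signs it is the contributions to the second derivative that reinforce each other.\<close>

lemma cot_sum''_nonzero:
  assumes x: "0 < x" "x < 1" and s: "Legendre m (int p) = s" "Legendre (m + 1) (int p) = - s" "\<bar>s\<bar> = 1"
  shows "cot_sum'' p m x \<noteq> 0"
proof
  define t where "t j = w ^ 3 * cot (w * (x - of_int j)) / (sin (w * (x - of_int j))) ^ 2" for j :: int
  assume "cot_sum'' p m x = 0"
  moreover have "w / 2 * cot_sum'' p m x = (\<Sum>j\<in>window c. of_int (Legendre (m + j) (int p)) * t j)"
    unfolding cot_sum''_def p_div_2 w_def[symmetric] sum_distrib_left t_def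
    by (intro sum.cong refl) (simp add: power2_eq_square power3_eq_cube)
  ultimately have "of_int s * (t 0 - t 1) = - (\<Sum>j\<in>window c - {0, 1}. of_int (Legendre (m + j) (int p)) * t j)"
    using s unfolding window_split by (simp add: algebra_simps)
  hence "\<bar>of_int s * (t 0 - t 1)\<bar> = \<bar>\<Sum>j\<in>window c - {0, 1}. of_int (Legendre (m + j) (int p)) * t j\<bar>" by simp
  moreover have "\<bar>\<Sum>j\<in>window c - {0, 1}. of_int (Legendre (m + j) (int p)) * t j\<bar> < 5"
  proof (rule outer_sum_bound)
    fix j assume j: "j \<in> window c" "1 \<le> \<bar>x - of_int j\<bar>"
    hence "\<bar>t j\<bar> \<le> 1 / \<bar>x - of_int j\<bar> ^ 3 + w ^ 2"
      using cot_csc_squared_term[of j x] x unfolding t_def by auto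
    also have "1 / \<bar>x - of_int j\<bar> ^ 3 \<le> 1 / \<bar>x - of_int j\<bar> ^ 2"
      using j by (intro divide_left_mono power_increasing) auto
    finally show "\<bar>t j\<bar> \<le> 1 / (x - of_int j) ^ 2 + w ^ 2" by simp
  qed (use x in auto)
  moreover have "\<bar>real_of_int s\<bar> = 1" using s(3) by linarith
  ultimately have "\<bar>t 0 - t 1\<bar> < 5" by (simp add: abs_mult)
  moreover have "t 0 \<ge> (99 / 100) / x ^ 3" using cot_csc_main[OF x] unfolding t_def by simp
  moreover have "- t 1 \<ge> (99 / 100) / (1 - x) ^ 3"
  proof -
    have "w * (x - 1) = - (w * (1 - x))" by (simp add: algebra_simps)
    hence "- t 1 = w ^ 3 * cot (w * (1 - x)) / (sin (w * (1 - x))) ^ 2" unfolding t_def by simp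
    thus ?thesis using cot_csc_main[of "1 - x"] x by simp
  qed
  moreover have "1 / x ^ 3 + 1 / (1 - x) ^ 3 \<ge> 16"
  proof -
    define a b where "a = 1 / x" and "b = 1 / (1 - x)"
    have ab: "a + b \<ge> 4" unfolding a_def b_def by (rule inverse_sum_ge_4[OF x])
    have "a > 0" "b > 0" using x unfolding a_def b_def by auto
    hence "0 \<le> 3 * (a + b) * (a - b) ^ 2" by simp
    moreover have "3 * (a + b) * (a - b) ^ 2 = 4 * (a ^ 3 + b ^ 3) - (a + b) ^ 3"
      by (simp add: power2_eq_square power3_eq_cube algebra_simps)
    moreover have "4 ^ 3 \<le> (a + b) ^ 3" using ab by (intro power_mono) auto
    ultimately have "a ^ 3 + b ^ 3 \<ge> 16" by simp
    thus ?thesis unfolding a_def b_def by (simp add: power_one_over)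
  qed
  ultimately show False by simp
qed

text \<open>Within \<open>1/(8p)\<close> of an end of the arc the pole there outweighs the sum of all other terms.\<close>

lemma pole_dominates:
  assumes k: "k = 0 \<or> k = 1" and y: "0 \<le> y" "y \<le> 1"
    and near: "y - of_int k \<noteq> 0" "\<bar>y - of_int k\<bar> \<le> 1 / (8 * real p)"
    and s: "Legendre (m + k) (int p) = s" "\<bar>s\<bar> = 1"
  shows "of_int s * ((y - of_int k) * cot_sum p m y) > 0"
proof -
  define d where "d = y - of_int k"
  have "1 / (8 * real p) \<le> 1 / 8" using p_gt by (simp add: field_simps)
  hence d: "d \<noteq> 0" "\<bar>d\<bar> \<le> 1 / (8 * real p)" "\<bar>d\<bar> \<le> 1 / 8" using near unfolding d_def by linarith+
  define h where "h j = of_int (Legendre (m + j) (int p)) * cot (w * (y - of_int j))" for j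
  have kw: "k \<in> window c" using k c_ge by (auto simp: window_def)
  have split: "cot_sum p m y = h k + sum h (window c - {k})"
    unfolding cot_sum_def p_div_2 w_def[symmetric] h_def by (rule sum.remove[OF finite_window kw])
  have "\<bar>sum h (window c - {k})\<bar> \<le> (\<Sum>j\<in>window c - {k}. \<bar>h j\<bar>)" by (rule sum_abs)
  also have "\<dots> \<le> (\<Sum>j\<in>window c - {k}. 2 / w)"
  proof (rule sum_mono)
    fix j assume j: "j \<in> window c - {k}"
    hence "\<bar>real_of_int (j - k)\<bar> \<ge> 1" by auto
    hence far: "\<bar>y - of_int j\<bar> \<ge> 1 / 2" 
      using d(3) unfolding d_def of_int_diff by linarith
    have "\<bar>cot (w * (y - of_int j))\<bar> \<le> 1 / \<bar>w * (y - of_int j)\<bar>"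
      by (rule abs_cot_le) (use angle_bound[of j y] j y far w_pos in auto)
    also have "\<dots> \<le> 1 / (w * (1 / 2))"
      unfolding abs_mult using far w_pos by (intro divide_left_mono mult_mono mult_pos_pos) auto
    finally have "\<bar>cot (w * (y - of_int j))\<bar> \<le> 2 / w" by simp
    moreover have "\<bar>h j\<bar> \<le> 1 * \<bar>cot (w * (y - of_int j))\<bar>"
      unfolding h_def abs_mult by (intro mult_right_mono Legendre_abs_le) auto
    ultimately show "\<bar>h j\<bar> \<le> 2 / w" by linarith
  qed
  also have "\<dots> = real (2 * c) * (2 / w)" using kw by (simp add: card_window)
  also have "\<dots> \<le> real p * (2 / w)" using p_def w_pos by (intro mult_right_mono) auto
  finally have "\<bar>d\<bar> * \<bar>sum h (window c - {k})\<bar> \<le> 1 / (8 * real p) * (real p * (2 / w))"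
    using d(2) by (intro mult_mono) auto
  hence outer: "\<bar>d * sum h (window c - {k})\<bar> \<le> 1 / 4 * (1 / w)" using p_gt by (simp add: abs_mult)
  define u where "u = w * d"
  have u: "u \<noteq> 0" "\<bar>u\<bar> \<le> 1"
  proof -
    have "w * \<bar>d\<bar> \<le> 1 * 1" using w_small w_pos d(3) by (intro mult_mono) auto
    thus "u \<noteq> 0" "\<bar>u\<bar> \<le> 1" using w_pos d(1) unfolding u_def by (simp_all add: abs_mult)
  qed
  have "\<bar>d\<bar> * \<bar>cot u - 1 / u\<bar> \<le> 1 * (1 / 2)"
    using cot_approx[OF u] u d(3) by (intro mult_mono) auto
  moreover have "d * cot u - 1 / w = d * (cot u - 1 / u)"
    using d(1) w_pos unfolding u_def by (simp add: right_diff_distrib)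
  ultimately have main: "\<bar>d * cot u - 1 / w\<bar> \<le> 1 / 2" by (simp add: abs_mult)
  have "1 / w \<ge> 10" using w_small w_pos by (simp add: field_simps)
  hence big: "d * cot u > \<bar>d * sum h (window c - {k})\<bar>" using main outer by linarith
  have "real_of_int s = 1 \<or> real_of_int s = -1" using s(2) by linarith
  moreover have "h k = of_int s * cot u" using s unfolding h_def u_def d_def by simp
  hence "of_int s * (d * cot_sum p m y) = (of_int s * of_int s) * (d * cot u) + of_int s * (d * sum h (window c - {k}))"
    unfolding split by (simp only: distrib_left mult_ac)
  ultimately have "of_int s * (d * cot_sum p m y) > 0" using big by auto
  thus ?thesis unfolding d_def .
qed

lemma cot_sum_near_0:
  assumes x: "0 < x" "x \<le> 1 / (8 * real p)" "x \<le> 1" and s: "Legendre m (int p) = s" "\<bar>s\<bar> = 1"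
  shows "of_int s * cot_sum p m x > 0"
proof -
  have "x * (of_int s * cot_sum p m x) > 0" using pole_dominates[of 0 x m s] x s by (simp add: mult_ac)
  thus ?thesis using x by (simp add: zero_less_mult_iff)
qed

lemma cot_sum_near_1:
  assumes x: "0 < x" "x \<le> 1 / (8 * real p)" "x \<le> 1" and s: "Legendre (m + 1) (int p) = s" "\<bar>s\<bar> = 1"
  shows "of_int s * cot_sum p m (1 - x) < 0"
proof -
  have "x * (of_int s * cot_sum p m (1 - x)) < 0"
    using pole_dominates[of 1 "1 - x" m s] x s by (simp add: mult_ac)
  thus ?thesis using x by (simp add: mult_less_0_iff)
qed

lemma cot_sum_continuous:
  assumes "0 < a" "b < 1"
  shows "continuous_on {a..b} (cot_sum p m)"
  by (intro continuous_at_imp_continuous_on ballI DERIV_isCont[OF cot_sum_deriv[OF p_gt(2)]]) (use assms in auto)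

lemma cot_sum_IVT:
  assumes "0 < a" "a \<le> b" "b < 1" "cot_sum p m a * cot_sum p m b \<le> 0"
  shows "\<exists>x. a \<le> x \<and> x \<le> b \<and> cot_sum p m x = 0"
proof -
  note cont = cot_sum_continuous[OF assms(1,3), of m]
  show ?thesis
  proof (cases "cot_sum p m a \<le> 0")
    case True
    show ?thesis
    proof (cases "cot_sum p m b \<ge> 0")
      case True thus ?thesis using IVT'[OF \<open>cot_sum p m a \<le> 0\<close> True assms(2) cont] by blast
    next
      case False
      hence "cot_sum p m a = 0" using assms(4) True by (simp add: mult_le_0_iff)
      thus ?thesis using assms(2) by blast
    qed
  next
    case False
    hence "cot_sum p m b \<le> 0" using assms(4) by (simp add: mult_le_0_iff)
    thus ?thesis using IVT2'[of "cot_sum p m" b 0 a] False assms(2) cont by auto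
  qed
qed

lemma arc_zeros_finite: "finite (arc_zeros p m)"
  by (rule card_unit_circle_zeros(2)[OF prime_p p_gt(1)])

lemma card_arc_zeros_equal:
  assumes s: "Legendre m (int p) = s" "Legendre (m + 1) (int p) = s" "\<bar>s\<bar> = 1"
  shows "card (arc_zeros p m) = 1"
proof -
  have "card (arc_zeros p m) \<le> 1"
    unfolding arc_zeros_def
    by (rule card_zeros_le_1[OF cot_sum_deriv[OF p_gt(2)] cot_sum'_nonzero[OF _ _ s]])
       (use arc_zeros_finite in \<open>simp_all add: arc_zeros_def\<close>)
  moreover have "arc_zeros p m \<noteq> {}"
  proof -
    define e where "e = 1 / (8 * real p)"
    have e: "0 < e" "e \<le> 1 / 8" using p_gt unfolding e_def by (simp_all add: field_simps)
    have "of_int s * cot_sum p m e > 0" "of_int s * cot_sum p m (1 - e) < 0"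
      using cot_sum_near_0[of e m s] cot_sum_near_1[of e m s] e s unfolding e_def by auto
    moreover have "real_of_int s = 1 \<or> real_of_int s = -1" using s(3) by linarith
    ultimately have "cot_sum p m e * cot_sum p m (1 - e) \<le> 0" by (auto simp: mult_le_0_iff)
    then obtain x where "e \<le> x" "x \<le> 1 - e" "cot_sum p m x = 0"
      using cot_sum_IVT[of e "1 - e" m] e by auto
    moreover from this have "0 < x" "x < 1" using e by linarith+
    ultimately show ?thesis unfolding arc_zeros_def by auto
  qed
  ultimately show ?thesis using arc_zeros_finite[of m] by (simp add: le_less card_gt_0_iff)
qed

lemma card_arc_zeros_unequal_le:
  assumes s: "Legendre m (int p) = s" "Legendre (m + 1) (int p) = - s" "\<bar>s\<bar> = 1"
  shows "card (arc_zeros p m) \<le> 2"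
  unfolding arc_zeros_def
  by (rule card_zeros_le_2[OF cot_sum_deriv[OF p_gt(2)] cot_sum_deriv2[OF p_gt(2)] cot_sum''_nonzero[OF _ _ s]])
     (use arc_zeros_finite in \<open>simp_all add: arc_zeros_def\<close>)

text \<open>A negative value between two positive ends gives two zeros, and convexity allows no third.\<close>

lemma card_arc_zeros_crossing:
  assumes s: "Legendre m (int p) = s" "Legendre (m + 1) (int p) = - s" "\<bar>s\<bar> = 1"
    and x: "0 < x" "x < 1" "of_int s * cot_sum p m x < 0"
  shows "card (arc_zeros p m) = 2"
proof -
  have ss: "real_of_int s = 1 \<or> real_of_int s = -1" using s(3) by linarith
  define e where "e = min (1 / (8 * real p)) (min x (1 - x))"
  have e: "0 < e" "e \<le> x" "e \<le> 1 - x" "e \<le> 1 / (8 * real p)" using p_gt x unfolding e_def by auto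
  have pos: "of_int s * cot_sum p m e > 0" "of_int s * cot_sum p m (1 - e) > 0"
    using cot_sum_near_0[of e m s] cot_sum_near_1[of e m "- s"] e s by auto
  obtain y where y: "e \<le> y" "y \<le> x" "cot_sum p m y = 0"
    using cot_sum_IVT[of e x m] e x pos(1) ss by (auto simp: mult_le_0_iff)
  obtain z where z: "x \<le> z" "z \<le> 1 - e" "cot_sum p m z = 0"
    using cot_sum_IVT[of x "1 - e" m] e x pos(2) ss by (auto simp: mult_le_0_iff)
  have "y \<noteq> x" "z \<noteq> x" using y z x by auto
  hence "y \<noteq> z" "{y, z} \<subseteq> arc_zeros p m" using y z e x unfolding arc_zeros_def by auto
  hence "2 \<le> card (arc_zeros p m)" using card_mono[OF arc_zeros_finite, of "{y, z}" m] by simp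
  thus ?thesis using card_arc_zeros_unequal_le[OF s] by simp
qed

lemma card_arc_zeros_noncrossing:
  assumes "\<And>x. 0 < x \<Longrightarrow> x < 1 \<Longrightarrow> cot_sum p m x \<noteq> 0"
  shows "card (arc_zeros p m) = 0"
proof -
  have "arc_zeros p m = {}" using assms unfolding arc_zeros_def by auto
  thus ?thesis by simp
qed

end

section \<open>The two arcs next to 1\<close>

lemma sum_window_annulus:
  fixes g :: "int \<Rightarrow> 'a::comm_monoid_add"
  assumes "J \<le> c"
  shows "(\<Sum>j\<in>window c - window J. g j) = (\<Sum>n\<in>{J<..c}. g (int n) + g (- int n))"
proof -
  have "window c - window J = {int J<..int c} \<union> {-int c..<-int J}" using assms by (auto simp: window_def)
  hence "(\<Sum>j\<in>window c - window J. g j) = (\<Sum>j\<in>{int J<..int c} \<union> {-int c..<-int J}. g j)" by simp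
  also have "\<dots> = (\<Sum>j\<in>{int J<..int c}. g j) + (\<Sum>j\<in>{-int c..<-int J}. g j)"
    by (rule sum.union_disjoint) auto
  also have "(\<Sum>j\<in>{int J<..int c}. g j) = (\<Sum>n\<in>{J<..c}. g (int n))"
    by (rule sum.reindex_bij_witness[of _ int nat]) auto
  also have "(\<Sum>j\<in>{-int c..<-int J}. g j) = (\<Sum>n\<in>{J<..c}. g (- int n))"
    by (rule sum.reindex_bij_witness[of _ "\<lambda>n. - int n" "\<lambda>j. nat (- j)"]) auto
  finally show ?thesis by (simp add: sum.distrib)
qed

lemma sum_inverse_products_le:
  assumes "J \<ge> 1"
  shows "(\<Sum>n\<in>{J<..N}. 1 / ((real n - 1) * real n)) \<le> 1 / real J"
proof (cases "J \<le> N")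
  case True
  hence "(\<Sum>n\<in>{J<..N}. 1 / ((real n - 1) * real n)) = 1 / real J - 1 / real N"
  proof (induction N rule: dec_induct)
    case (step N)
    have "{J<..Suc N} = insert (Suc N) {J<..N}" using step by auto
    hence "(\<Sum>n\<in>{J<..Suc N}. 1 / ((real n - 1) * real n)) = 1 / (real N * real (Suc N)) + (1 / real J - 1 / real N)"
      using step.IH by simp
    also have "1 / (real N * real (Suc N)) = 1 / real N - 1 / real (Suc N)"
      using assms step by (simp add: field_simps)
    finally show ?case by simp
  qed simp
  thus ?thesis by simp
qed simp

lemma sum_inverse_square_from_2_le: "(\<Sum>n\<in>{1<..N}. 1 / real n ^ 2) \<le> 2 / 3"
proof -
  have "(\<Sum>n\<in>{1<..N}. 1 / real n ^ 2) \<le> 2 / 3 - 1 / (real N + 1 / 2)" if "N \<ge> 1"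
    using that
  proof (induction N rule: dec_induct)
    case (step N)
    have "{1<..Suc N} = insert (Suc N) {1<..N}" using step by auto
    hence "(\<Sum>n\<in>{1<..Suc N}. 1 / real n ^ 2) \<le> 1 / real (Suc N) ^ 2 + (2 / 3 - 1 / (real N + 1 / 2))"
      using step.IH by simp
    also have "1 / real (Suc N) ^ 2 \<le> 1 / ((real N + 1 / 2) * (real N + 3 / 2))"
      by (intro divide_left_mono) (auto simp: power2_eq_square field_simps intro!: add_pos_nonneg)
    also have "\<dots> = 1 / (real N + 1 / 2) - 1 / (real (Suc N) + 1 / 2)" by (simp add: field_simps)
    finally show ?case by simp
  qed simp
  moreover have "1 / (real N + 1 / 2) \<ge> 0" by simp
  ultimately show ?thesis by (cases "N \<ge> 1") (linarith, simp)
qed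

context fekete_arc
begin

lemma window_split_3:
  fixes h :: "int \<Rightarrow> real"
  shows "(\<Sum>j\<in>window c. h j) = h 0 + h 1 + h (-1) + (\<Sum>j\<in>window c - window 1. h j)"
proof -
  have "window 1 = {0, 1, -1}" unfolding window_def by auto
  moreover have "window 1 \<subseteq> window c" using c_ge unfolding window_def by auto
  ultimately show ?thesis using sum.subset_diff[of "window 1" "window c" h] by simp
qed

text \<open>On the arc that starts at \<open>1\<close> the coefficient at \<open>j = 0\<close> vanishes, and the terms are compared with those at
  \<open>j = 1\<close> and \<open>j = -1\<close>.\<close>

lemma outer_sum_bound_0:
  fixes t :: "int \<Rightarrow> real"
  assumes "\<And>n. n \<in> {1<..c} \<Longrightarrow> \<bar>t (int n)\<bar> + \<bar>t (- int n)\<bar> \<le> K * (1 / real n ^ 2) + 2 * w ^ 2" and K: "K \<ge> 0"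
  shows "\<bar>\<Sum>j\<in>window c - window 1. of_int (Legendre j (int p)) * t j\<bar> \<le> 2 / 3 * K + 1 / 10"
proof -
  have "\<bar>\<Sum>j\<in>window c - window 1. of_int (Legendre j (int p)) * t j\<bar>
      \<le> (\<Sum>j\<in>window c - window 1. \<bar>of_int (Legendre j (int p)) * t j\<bar>)" by (rule sum_abs)
  also have "\<dots> \<le> (\<Sum>j\<in>window c - window 1. \<bar>t j\<bar>)"
    unfolding abs_mult using Legendre_abs_le by (intro sum_mono mult_left_le_one_le) auto
  also have "\<dots> = (\<Sum>n\<in>{1<..c}. \<bar>t (int n)\<bar> + \<bar>t (- int n)\<bar>)"
    using c_ge by (intro sum_window_annulus) simp
  also have "\<dots> \<le> (\<Sum>n\<in>{1<..c}. K * (1 / real n ^ 2) + 2 * w ^ 2)" by (intro sum_mono assms)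
  also have "\<dots> = K * (\<Sum>n\<in>{1<..c}. 1 / real n ^ 2) + real (c - 1) * (2 * w ^ 2)"
    by (simp add: sum.distrib sum_distrib_left)
  also have "\<dots> \<le> K * (2 / 3) + real c * (2 * w ^ 2)"
    using sum_inverse_square_from_2_le[of c] K by (intro add_mono mult_left_mono mult_right_mono) auto
  also have "real c * (2 * w ^ 2) \<le> real p * w ^ 2"
    using p_def by (simp add: algebra_simps)
  also have "\<dots> \<le> 1 / 10" by (rule pw_squared)
  finally show ?thesis by simp
qed

lemma scaled_distance:
  fixes x :: real
  assumes "0 < x" "x < 1" "n \<ge> (2::nat)"
  shows "real n * (1 - x) \<le> real n - x"
proof -
  have "1 * x \<le> real n * x" using assms by (intro mult_right_mono) auto
  thus ?thesis by (simp add: algebra_simps)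
qed

text \<open>If \<open>\<chi>(-1) = 1\<close>, the contributions of \<open>j = 1\<close> and \<open>j = -1\<close> to the first derivative have the same sign. The others are
  bounded through \<open>n - x \<ge> n(1-x)\<close> in terms of \<open>A = 1/(1-x)\<^sup>2\<close>.\<close>

lemma cot_sum'_nonzero_even:
  assumes x: "0 < x" "x < 1" and s: "Legendre (-1) (int p) = 1"
  shows "cot_sum' p 0 x \<noteq> 0"
proof
  define t where "t j = w ^ 2 / (sin (w * (x - of_int j))) ^ 2" for j :: int
  define A where "A = 1 / (1 - x) ^ 2"
  have nz: "sin (w * (x - of_int j)) \<noteq> 0" for j unfolding w_def using sin_arc_nonzero[OF p_gt(2) x] .
  have A: "A > 0" using x unfolding A_def by simp
  assume "cot_sum' p 0 x = 0"
  moreover have "- w * cot_sum' p 0 x = (\<Sum>j\<in>window c. of_int (Legendre j (int p)) * t j)"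
    unfolding cot_sum'_def p_div_2 w_def[symmetric] sum_distrib_left t_def
    by (intro sum.cong refl) (simp add: power2_eq_square)
  ultimately have "t 1 + t (-1) = - (\<Sum>j\<in>window c - window 1. of_int (Legendre j (int p)) * t j)"
    using s Legendre_1[of p] Legendre_eq_0_iff[of 0 "int p"] p_gt unfolding window_split_3 by simp
  also have "\<dots> \<le> \<bar>\<Sum>j\<in>window c - window 1. of_int (Legendre j (int p)) * t j\<bar>" by simp
  also have "\<dots> \<le> 2 / 3 * (A + 1) + 1 / 10"
  proof (rule outer_sum_bound_0)
    fix n assume n: "n \<in> {1<..c}"
    have t_le: "\<bar>t j\<bar> \<le> 1 / (x - of_int j) ^ 2 + w ^ 2" if "j \<in> window c" "x - of_int j \<noteq> 0" for j
      using csc_squared_term[of j x] x that unfolding t_def by auto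
    have "\<bar>t (int n)\<bar> \<le> 1 / (x - real n) ^ 2 + w ^ 2" "\<bar>t (- int n)\<bar> \<le> 1 / (x + real n) ^ 2 + w ^ 2"
      using t_le[of "int n"] t_le[of "- int n"] n x by (auto simp: window_def)
    moreover have "1 / (x - real n) ^ 2 \<le> A * (1 / real n ^ 2)"
    proof -
      have "(real n * (1 - x)) ^ 2 \<le> (real n - x) ^ 2"
        using scaled_distance[of x n] x n by (intro power_mono) auto
      hence "1 / (real n - x) ^ 2 \<le> 1 / (real n * (1 - x)) ^ 2"
        using x n by (intro divide_left_mono) (auto intro!: mult_pos_pos)
      thus ?thesis unfolding A_def by (simp add: power_mult_distrib power2_commute mult.commute)
    qed
    moreover have "1 / (x + real n) ^ 2 \<le> 1 / real n ^ 2"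
      using x n by (intro divide_left_mono power_mono mult_pos_pos zero_less_power) auto
    ultimately show "\<bar>t (int n)\<bar> + \<bar>t (- int n)\<bar> \<le> (A + 1) * (1 / real n ^ 2) + 2 * w ^ 2"
      unfolding distrib_right mult_1 by linarith
  qed (use A in simp)
  finally have up: "t 1 + t (-1) \<le> 2 / 3 * (A + 1) + 1 / 10" .
  have "t 1 \<ge> A" "t (-1) \<ge> 1 / (1 + x) ^ 2"
    using csc_squared_ge[of x 1] csc_squared_ge[of x "-1"] nz[of 1] nz[of "-1"] x unfolding t_def A_def
    by (simp_all add: power2_commute add.commute)
  hence "A / 3 + 1 / (1 + x) ^ 2 \<le> 23 / 30" using up by argo
  moreover have "A / 3 + 1 / (1 + x) ^ 2 > 23 / 30"
  proof (cases "x \<le> 1 / 4")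
    case True
    have "(1 - x) ^ 2 \<le> 1" "(1 + x) ^ 2 \<le> (5 / 4) ^ 2" using x True by (auto intro!: power_le_one power_mono)
    hence "A \<ge> 1" "1 / (1 + x) ^ 2 \<ge> 1 / (5 / 4) ^ 2"
      using x unfolding A_def by (auto intro!: divide_left_mono mult_pos_pos zero_less_power simp: le_divide_eq)
    thus ?thesis by (simp add: power2_eq_square)
  next
    case False
    have "(1 - x) ^ 2 \<le> (3 / 4) ^ 2" by (rule power_mono) (use x False in auto)
    moreover have "(1 + x) ^ 2 \<le> 2 ^ 2" by (rule power_mono) (use x in auto)
    ultimately have "1 / (1 - x) ^ 2 \<ge> 1 / (3 / 4) ^ 2" "1 / (1 + x) ^ 2 \<ge> 1 / 2 ^ 2"
      using x by (auto intro!: divide_left_mono mult_pos_pos zero_less_power simp del: power2_eq_square)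
    thus ?thesis unfolding A_def by (simp add: power2_eq_square)
  qed
  ultimately show False by simp
qed

text \<open>If \<open>\<chi>(-1) = -1\<close>, the same happens for the second derivative.\<close>

lemma cot_sum''_nonzero_odd:
  assumes x: "0 < x" "x < 1" and s: "Legendre (-1) (int p) = -1"
  shows "cot_sum'' p 0 x \<noteq> 0"
proof
  define t where "t j = w ^ 3 * cot (w * (x - of_int j)) / (sin (w * (x - of_int j))) ^ 2" for j :: int
  define B where "B = 1 / (1 - x) ^ 3"
  have B: "B \<ge> 1" using x unfolding B_def by (simp add: le_divide_eq power_le_one)
  assume "cot_sum'' p 0 x = 0"
  moreover have "w / 2 * cot_sum'' p 0 x = (\<Sum>j\<in>window c. of_int (Legendre j (int p)) * t j)"
    unfolding cot_sum''_def p_div_2 w_def[symmetric] sum_distrib_left t_def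
    by (intro sum.cong refl) (simp add: power2_eq_square power3_eq_cube)
  ultimately have "- t 1 + t (-1) = (\<Sum>j\<in>window c - window 1. of_int (Legendre j (int p)) * t j)"
    using s Legendre_1[of p] Legendre_eq_0_iff[of 0 "int p"] p_gt unfolding window_split_3 by simp
  also have "\<dots> \<le> \<bar>\<Sum>j\<in>window c - window 1. of_int (Legendre j (int p)) * t j\<bar>" by simp
  also have "\<dots> \<le> 2 / 3 * (B / 2 + 1 / 2) + 1 / 10"
  proof (rule outer_sum_bound_0)
    fix n assume n: "n \<in> {1<..c}"
    have t_le: "\<bar>t j\<bar> \<le> 1 / \<bar>x - of_int j\<bar> ^ 3 + w ^ 2" if "j \<in> window c" "1 \<le> \<bar>x - of_int j\<bar>" for j
      using cot_csc_squared_term[of j x] x that unfolding t_def by auto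
    have "\<bar>t (int n)\<bar> \<le> 1 / \<bar>x - real n\<bar> ^ 3 + w ^ 2" "\<bar>t (- int n)\<bar> \<le> 1 / \<bar>x + real n\<bar> ^ 3 + w ^ 2"
      using t_le[of "int n"] t_le[of "- int n"] n x by (auto simp: window_def)
    moreover have cube: "2 * real n ^ 2 \<le> real n ^ 3"
    proof -
      have "2 * real n ^ 2 \<le> real n * real n ^ 2" using n by (intro mult_right_mono) auto
      thus ?thesis by (simp add: power3_eq_cube power2_eq_square)
    qed
    moreover have "1 / \<bar>x - real n\<bar> ^ 3 \<le> B / 2 * (1 / real n ^ 2)"
    proof -
      have "2 * real n ^ 2 * (1 - x) ^ 3 \<le> real n ^ 3 * (1 - x) ^ 3" using cube x by (intro mult_right_mono) auto
      also have "\<dots> = (real n * (1 - x)) ^ 3" by (simp add: power_mult_distrib)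
      also have "\<dots> \<le> \<bar>x - real n\<bar> ^ 3"
        using scaled_distance[of x n] x n by (intro power_mono) auto
      finally have "1 / \<bar>x - real n\<bar> ^ 3 \<le> 1 / (2 * real n ^ 2 * (1 - x) ^ 3)"
        using x n by (intro divide_left_mono) (auto intro!: mult_pos_pos)
      thus ?thesis unfolding B_def by (simp add: mult_ac)
    qed
    moreover have "1 / \<bar>x + real n\<bar> ^ 3 \<le> 1 / 2 * (1 / real n ^ 2)"
    proof -
      have "real n ^ 3 \<le> \<bar>x + real n\<bar> ^ 3" using x by (intro power_mono) auto
      hence "2 * real n ^ 2 \<le> \<bar>x + real n\<bar> ^ 3" using cube by linarith
      hence "1 / \<bar>x + real n\<bar> ^ 3 \<le> 1 / (2 * real n ^ 2)"
        using x n by (intro divide_left_mono) (auto intro!: mult_pos_pos)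
      thus ?thesis by simp
    qed
    ultimately show "\<bar>t (int n)\<bar> + \<bar>t (- int n)\<bar> \<le> (B / 2 + 1 / 2) * (1 / real n ^ 2) + 2 * w ^ 2"
      unfolding distrib_right by linarith
  qed (use B in simp)
  finally have up: "- t 1 + t (-1) \<le> 2 / 3 * (B / 2 + 1 / 2) + 1 / 10" .
  have "- t 1 \<ge> 99 / 100 * B"
  proof -
    have "w * (x - 1) = - (w * (1 - x))" by (simp add: algebra_simps)
    hence "- t 1 = w ^ 3 * cot (w * (1 - x)) / (sin (w * (1 - x))) ^ 2" unfolding t_def by simp
    thus ?thesis using cot_csc_main[of "1 - x"] x unfolding B_def by simp
  qed
  moreover have "t (-1) \<ge> 0"
  proof -
    have "w * (x + 1) \<le> (1 / 10) * 2" using w_small w_pos x by (intro mult_mono) auto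
    hence "cot (w * (x + 1)) > 0" using w_pos x pi_ge_two by (intro cot_gt_zero) auto
    thus ?thesis using w_pos unfolding t_def by simp
  qed
  ultimately show False using up B by argo
qed

end

section \<open>Comparison of an arc with its sign pattern\<close>

context fekete_arc
begin

lemma card_arc_zeros_0_le: "card (arc_zeros p 0) \<le> 2"
proof -
  have "Legendre (-1) (int p) \<noteq> 0" using Legendre_eq_0_iff[of "-1" "int p"] p_gt by auto
  hence "Legendre (-1) (int p) = 1 \<or> Legendre (-1) (int p) = -1"
    using Legendre_range[of "-1" "int p"] by auto
  thus ?thesis
  proof
    assume s: "Legendre (-1) (int p) = 1"
    have "card (arc_zeros p 0) \<le> 1"
      unfolding arc_zeros_def
      by (rule card_zeros_le_1[OF cot_sum_deriv[OF p_gt(2)] cot_sum'_nonzero_even[OF _ _ s]])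
         (use arc_zeros_finite in \<open>simp_all add: arc_zeros_def\<close>)
    thus ?thesis by simp
  next
    assume s: "Legendre (-1) (int p) = -1"
    show ?thesis
      unfolding arc_zeros_def
      by (rule card_zeros_le_2[OF cot_sum_deriv[OF p_gt(2)] cot_sum_deriv2[OF p_gt(2)] cot_sum''_nonzero_odd[OF _ _ s]])
         (use arc_zeros_finite in \<open>simp_all add: arc_zeros_def\<close>)
  qed
qed

lemma circ_uminus: "circ p (- y) = cnj (circ p y)"
  unfolding circ_def cis_cnj by (simp only: mult_minus_right minus_divide_left)

lemma poly_fekete_cnj: "poly (fekete_poly p) (cnj z) = cnj (poly (fekete_poly p) z)"
  unfolding poly_fekete by (simp add: cnj_sum)

text \<open>Complex conjugation exchanges the two arcs that meet at \<open>1\<close>.\<close>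

lemma card_arc_zeros_last_le: "card (arc_zeros p (int p - 1)) \<le> 2"
proof -
  have "(\<lambda>x. 1 - x) ` arc_zeros p (int p - 1) \<subseteq> arc_zeros p 0"
  proof clarify
    fix x assume "x \<in> arc_zeros p (int p - 1)"
    hence x: "0 < x" "x < 1" "cot_sum p (int p - 1) x = 0" unfolding arc_zeros_def by auto
    have "circ p (of_int (int p - 1) + x) = circ p ((x - 1) + real p * of_int 1)" by (simp add: algebra_simps)
    also have "\<dots> = circ p (x - 1)" by (rule circ_int_periodic) (use p_gt in simp)
    also have "\<dots> = circ p (- (1 - x))" by simp
    also have "\<dots> = cnj (circ p (of_int 0 + (1 - x)))" by (simp only: circ_uminus of_int_0 add_0_left)
    finally have c: "circ p (of_int (int p - 1) + x) = cnj (circ p (of_int 0 + (1 - x)))" .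
    have "poly (fekete_poly p) (circ p (of_int (int p - 1) + x)) = 0"
      using fekete_on_arc[OF prime_p p_gt(1) x(1,2)] x(3) by blast
    hence "poly (fekete_poly p) (circ p (of_int 0 + (1 - x))) = 0" unfolding c poly_fekete_cnj by simp
    hence "cot_sum p 0 (1 - x) = 0"
      using fekete_on_arc[OF prime_p p_gt(1), of "1 - x" 0] x(1,2) by simp
    thus "1 - x \<in> arc_zeros p 0" using x unfolding arc_zeros_def by simp
  qed
  hence "card ((\<lambda>x. 1 - x) ` arc_zeros p (int p - 1)) \<le> card (arc_zeros p 0)"
    by (intro card_mono arc_zeros_finite)
  moreover have "card ((\<lambda>x. 1 - x) ` arc_zeros p (int p - 1)) = card (arc_zeros p (int p - 1))"
    by (rule card_image) (simp add: inj_on_def)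
  ultimately show ?thesis using card_arc_zeros_0_le by simp
qed

text \<open>The contribution of the residues outside the window of radius \<open>J\<close>, frozen at \<open>x = 0\<close>. As a function of \<open>m\<close> it is
  a combination of shifted Legendre symbols, so its second moment can be computed.\<close>

definition far_sum :: "nat \<Rightarrow> int \<Rightarrow> real" where
  "far_sum J m = (\<Sum>j\<in>window c - window J. (w * cot (w * (- of_int j))) * of_int (Legendre (m + j) (int p)))"

lemma far_sum_second_moment:
  assumes J: "1 \<le> J" "J \<le> c"
  shows "(\<Sum>m\<in>{0..<int p}. far_sum J m ^ 2) \<le> real p * (2 / real J)"
proof -
  define h where "h j = w * cot (w * (- of_int j))" for j :: int
  have "(\<Sum>m\<in>{0..<int p}. far_sum J m ^ 2) \<le> real p * (\<Sum>j\<in>window c - window J. h j ^ 2)"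
    unfolding far_sum_def h_def
  proof (rule Legendre_second_moment[OF prime_p p_gt(1)])
    fix i j assume "i \<in> window c - window J" "j \<in> window c - window J" "i \<noteq> j"
    moreover from this have "\<bar>j - i\<bar> < int p" unfolding window_def p_def by auto
    ultimately show "\<not> int p dvd j - i" using dvd_imp_le_int[of "j - i" "int p"] by auto
  qed auto
  also have "(\<Sum>j\<in>window c - window J. h j ^ 2) = (\<Sum>n\<in>{J<..c}. h (int n) ^ 2 + h (- int n) ^ 2)"
    by (rule sum_window_annulus[OF J(2)])
  also have "\<dots> \<le> (\<Sum>n\<in>{J<..c}. 2 * (1 / ((real n - 1) * real n)))"
  proof (rule sum_mono)
    fix n assume n: "n \<in> {J<..c}"
    have "h j ^ 2 \<le> 1 / ((real n - 1) * real n)" if "\<bar>real_of_int j\<bar> = real n" "j \<in> window c" for j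
    proof -
      have j0: "j \<noteq> 0" using that n by auto
      have "\<bar>cot (w * (- of_int j))\<bar> \<le> 1 / \<bar>w * (- of_int j)\<bar>"
        by (rule abs_cot_le) (use angle_bound[of j 0] that(2) j0 w_pos in auto)
      hence "w * \<bar>cot (w * (- of_int j))\<bar> \<le> w * (1 / \<bar>w * (- of_int j)\<bar>)" using w_pos by (intro mult_left_mono) auto
      also have "\<dots> = 1 / real n" using w_pos that by (simp add: abs_mult)
      finally have "\<bar>h j\<bar> \<le> 1 / real n" unfolding h_def using w_pos by (simp add: abs_mult)
      hence "\<bar>h j\<bar> ^ 2 \<le> (1 / real n) ^ 2" by (intro power_mono) auto
      also have "\<dots> = 1 / (real n * real n)" by (simp add: power2_eq_square)
      also have "\<dots> \<le> 1 / ((real n - 1) * real n)"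
        using n J by (intro divide_left_mono mult_right_mono) auto
      finally show ?thesis by simp
    qed
    from this[of "int n"] this[of "- int n"]
    show "h (int n) ^ 2 + h (- int n) ^ 2 \<le> 2 * (1 / ((real n - 1) * real n))"
      using n by (simp add: window_def)
  qed
  also have "\<dots> = 2 * (\<Sum>n\<in>{J<..c}. 1 / ((real n - 1) * real n))" by (simp add: sum_distrib_left)
  also have "\<dots> \<le> 2 * (1 / real J)" using sum_inverse_products_le[OF J(1)] by (intro mult_left_mono) auto
  finally show ?thesis by (simp add: mult_left_mono)
qed

lemma card_far_sum_large:
  assumes J: "1 \<le> J" "J \<le> c" and \<delta>: "\<delta> > 0"
  shows "real (card {m\<in>{0..<int p}. \<bar>far_sum J m\<bar> > \<delta>}) \<le> real p * (2 / (real J * \<delta> ^ 2))"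
proof -
  let ?E = "{m\<in>{0..<int p}. \<bar>far_sum J m\<bar> > \<delta>}"
  have "real (card ?E) * \<delta> ^ 2 = (\<Sum>m\<in>?E. \<delta> ^ 2)" by simp
  also have "\<dots> \<le> (\<Sum>m\<in>?E. far_sum J m ^ 2)"
  proof (rule sum_mono)
    fix m assume "m \<in> ?E"
    hence "\<delta> ^ 2 \<le> \<bar>far_sum J m\<bar> ^ 2" using \<delta> by (intro power_mono) auto
    thus "\<delta> ^ 2 \<le> far_sum J m ^ 2" by simp
  qed
  also have "\<dots> \<le> (\<Sum>m\<in>{0..<int p}. far_sum J m ^ 2)" by (rule sum_mono2) auto
  also have "\<dots> \<le> real p * (2 / real J)" by (rule far_sum_second_moment[OF J])
  finally show ?thesis using \<delta> J by (simp add: field_simps)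
qed

lemma cot_diff:
  fixes a b :: real
  assumes "sin a \<noteq> 0" "sin b \<noteq> 0"
  shows "cot a - cot b = sin (b - a) / (sin a * sin b)"
  using assms unfolding cot_def sin_diff by (simp add: field_simps)

text \<open>From \<open>cot a - cot b = sin(b-a)/(sin a sin b)\<close> and \<open>\<bar>sin u\<bar> \<ge> \<bar>u\<bar>/2\<close>; the quadratic decay makes the total
  variation of the far terms small without any averaging over \<open>m\<close>.\<close>

lemma far_term_variation:
  assumes x: "0 < x" "x < 1" and j: "j \<in> window c" "\<bar>real_of_int j\<bar> = real n" and n: "n \<ge> 2"
  shows "\<bar>w * cot (w * (x - of_int j)) - w * cot (w * (- of_int j))\<bar> \<le> 4 * (1 / ((real n - 1) * real n))"
proof -
  define a b where "a = w * (x - of_int j)" and "b = w * (- of_int j)"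
  have y: "\<bar>x - of_int j\<bar> \<ge> real n - 1" using x j(2) by linarith
  have a: "\<bar>sin a\<bar> \<ge> \<bar>a\<bar> / 2" unfolding a_def by (rule abs_sin_ge_half) (use angle_bound[OF j(1), of x] x in auto)
  have b: "\<bar>sin b\<bar> \<ge> \<bar>b\<bar> / 2" unfolding b_def by (rule abs_sin_ge_half) (use angle_bound[OF j(1), of 0] in auto)
  have aa: "\<bar>a\<bar> \<ge> w * (real n - 1)" unfolding a_def abs_mult using y w_pos by (simp add: mult_left_mono)
  have bb: "\<bar>b\<bar> = w * real n" unfolding b_def using j(2) w_pos by (simp add: abs_mult)
  have sa: "\<bar>sin a\<bar> \<ge> w * (real n - 1) / 2" and sb: "\<bar>sin b\<bar> \<ge> w * real n / 2" using a b aa bb by linarith+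
  have pos: "w * (real n - 1) / 2 > 0" "w * real n / 2 > 0" using w_pos n by auto
  hence nz: "sin a \<noteq> 0" "sin b \<noteq> 0" using sa sb by auto
  have "b - a = - (w * x)" unfolding a_def b_def by (simp add: algebra_simps)
  hence "\<bar>b - a\<bar> \<le> w" using w_pos x by (simp add: abs_mult)
  hence sd: "\<bar>sin (b - a)\<bar> \<le> w" using abs_sin_x_le_abs_x[of "b - a"] by linarith
  have "\<bar>w * cot a - w * cot b\<bar> = w * \<bar>cot a - cot b\<bar>" using w_pos by (simp add: abs_mult flip: right_diff_distrib)
  also have "\<dots> = w * (\<bar>sin (b - a)\<bar> / (\<bar>sin a\<bar> * \<bar>sin b\<bar>))" unfolding cot_diff[OF nz] by (simp add: abs_mult)
  also have "\<dots> \<le> w * (w / ((w * (real n - 1) / 2) * (w * real n / 2)))"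
    using sd sa sb pos w_pos by (intro mult_left_mono frac_le mult_mono mult_pos_pos) auto
  also have "\<dots> = 4 * (1 / ((real n - 1) * real n))" using w_pos n by (simp add: field_simps)
  finally show ?thesis unfolding a_def b_def .
qed

text \<open>The three errors are the far terms at \<open>x = 0\<close>, their variation with \<open>x\<close>, and the replacement of the cotangent by its pole
  in the near terms.\<close>

lemma cot_sum_approx:
  assumes x: "0 < x" "x < 1" and J: "1 \<le> J" "J \<le> c" and wJ: "w * (real J + 1) \<le> 1"
  shows "\<bar>w * cot_sum p m x - local_sum J (legendre_pattern (window J) p m) x\<bar>
     \<le> \<bar>far_sum J m\<bar> + 8 / real J + (2 * real J + 1) * (w ^ 2 * (real J + 1) / 2)"
proof -
  define \<chi> where "\<chi> j = real_of_int (Legendre (m + j) (int p))" for j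
  define near where "near = (\<Sum>j\<in>window J. \<chi> j * (w * cot (w * (x - of_int j))))"
  define far where "far = (\<Sum>j\<in>window c - window J. \<chi> j * (w * cot (w * (x - of_int j))))"
  have sub: "window J \<subseteq> window c" using J unfolding window_def by auto
  have "w * cot_sum p m x = (\<Sum>j\<in>window c. \<chi> j * (w * cot (w * (x - of_int j))))"
    unfolding cot_sum_def p_div_2 w_def[symmetric] sum_distrib_left \<chi>_def by (simp add: mult_ac)
  also have "\<dots> = far + near" unfolding far_def near_def using sub by (simp add: sum.subset_diff)
  finally have split: "w * cot_sum p m x = far + near" .
  have chi: "\<bar>\<chi> j\<bar> \<le> 1" for j unfolding \<chi>_def by (rule Legendre_abs_le)
  have ls: "local_sum J (legendre_pattern (window J) p m) x = (\<Sum>j\<in>window J. \<chi> j * (1 / (x - of_int j)))"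
    unfolding local_sum_def legendre_pattern_def \<chi>_def by (intro sum.cong refl) simp
  have "\<bar>near - local_sum J (legendre_pattern (window J) p m) x\<bar>
      \<le> (\<Sum>j\<in>window J. \<bar>\<chi> j * (w * cot (w * (x - of_int j))) - \<chi> j * (1 / (x - of_int j))\<bar>)"
    unfolding near_def ls sum_subtractf[symmetric] by (rule sum_abs)
  also have "\<dots> \<le> (\<Sum>j\<in>window J. w ^ 2 * (real J + 1) / 2)"
  proof (rule sum_mono)
    fix j assume j: "j \<in> window J"
    have "\<bar>real_of_int j\<bar> \<le> real J" using j unfolding window_def by auto
    hence y: "\<bar>x - of_int j\<bar> \<le> real J + 1" using x by linarith
    have ynz: "x - of_int j \<noteq> 0"
    proof
      assume "x - of_int j = 0"
      hence "x = of_int j" by simp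
      thus False using x by simp
    qed
    define u where "u = w * (x - of_int j)"
    have u: "u \<noteq> 0" "\<bar>u\<bar> \<le> w * (real J + 1)"
      using ynz w_pos y unfolding u_def by (simp_all add: abs_mult)
    have "\<bar>cot u - 1 / u\<bar> \<le> \<bar>u\<bar> / 2" using u wJ by (intro cot_approx) auto
    also have "\<dots> \<le> w * (real J + 1) / 2" using u by simp
    finally have "w * \<bar>cot u - 1 / u\<bar> \<le> w * (w * (real J + 1) / 2)" using w_pos by (intro mult_left_mono) auto
    moreover have "w * cot u - 1 / (x - of_int j) = w * (cot u - 1 / u)"
    proof -
      define y where "y = x - of_int j"
      have "w * (1 / u) = 1 / y" using w_pos unfolding u_def y_def[symmetric] by simp
      thus ?thesis unfolding y_def by (simp only: right_diff_distrib)
    qed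
    ultimately have "\<bar>w * cot u - 1 / (x - of_int j)\<bar> \<le> w ^ 2 * (real J + 1) / 2"
      using w_pos by (simp add: abs_mult power2_eq_square mult_ac)
    moreover have "\<bar>\<chi> j * (w * cot u) - \<chi> j * (1 / (x - of_int j))\<bar> \<le> 1 * \<bar>w * cot u - 1 / (x - of_int j)\<bar>"
      unfolding right_diff_distrib[symmetric] abs_mult using chi by (intro mult_right_mono) auto
    ultimately show "\<bar>\<chi> j * (w * cot (w * (x - of_int j))) - \<chi> j * (1 / (x - of_int j))\<bar> \<le> w ^ 2 * (real J + 1) / 2"
      unfolding u_def mult_1 by (rule order.trans[rotated])
  qed
  also have "\<dots> = (2 * real J + 1) * (w ^ 2 * (real J + 1) / 2)" by (simp add: card_window)
  finally have A: "\<bar>near - local_sum J (legendre_pattern (window J) p m) x\<bar>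
      \<le> (2 * real J + 1) * (w ^ 2 * (real J + 1) / 2)" .
  define D where "D j = \<bar>w * cot (w * (x - of_int j)) - w * cot (w * (- of_int j))\<bar>" for j :: int
  have "\<bar>far - far_sum J m\<bar> \<le> (\<Sum>j\<in>window c - window J.
      \<bar>\<chi> j * (w * cot (w * (x - of_int j))) - (w * cot (w * (- of_int j))) * \<chi> j\<bar>)"
    unfolding far_def far_sum_def \<chi>_def sum_subtractf[symmetric] by (rule sum_abs)
  also have "\<dots> \<le> (\<Sum>j\<in>window c - window J. D j)"
  proof (rule sum_mono)
    fix j
    have "\<bar>\<chi> j * (w * cot (w * (x - of_int j))) - (w * cot (w * (- of_int j))) * \<chi> j\<bar> = \<bar>\<chi> j\<bar> * D j"
      unfolding D_def abs_mult[symmetric] by (simp add: algebra_simps)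
    also have "\<dots> \<le> 1 * D j" using chi by (intro mult_right_mono) (auto simp: D_def)
    finally show "\<bar>\<chi> j * (w * cot (w * (x - of_int j))) - (w * cot (w * (- of_int j))) * \<chi> j\<bar> \<le> D j" by simp
  qed
  also have "\<dots> = (\<Sum>n\<in>{J<..c}. D (int n) + D (- int n))" by (rule sum_window_annulus[OF J(2)])
  also have "\<dots> \<le> (\<Sum>n\<in>{J<..c}. 8 * (1 / ((real n - 1) * real n)))"
  proof (rule sum_mono)
    fix n assume n: "n \<in> {J<..c}"
    have "D (int n) \<le> 4 * (1 / ((real n - 1) * real n))" "D (- int n) \<le> 4 * (1 / ((real n - 1) * real n))"
      unfolding D_def using n J by (intro far_term_variation[OF x]; simp add: window_def)+
    thus "D (int n) + D (- int n) \<le> 8 * (1 / ((real n - 1) * real n))" by linarith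
  qed
  also have "\<dots> = 8 * (\<Sum>n\<in>{J<..c}. 1 / ((real n - 1) * real n))" by (simp add: sum_distrib_left)
  also have "\<dots> \<le> 8 * (1 / real J)" using sum_inverse_products_le[OF J(1)] by (intro mult_left_mono) auto
  finally have B: "\<bar>far - far_sum J m\<bar> \<le> 8 / real J" by simp
  show ?thesis using A B unfolding split by linarith
qed

end

section \<open>The limiting density\<close>

lemma legendre_pattern_apply: "j \<in> I \<Longrightarrow> legendre_pattern I p m j = Legendre (m + j) (int p)"
  unfolding legendre_pattern_def by simp

lemma legendre_pattern_in_sign_patterns_iff:
  "legendre_pattern I p m \<in> sign_patterns I \<longleftrightarrow> (\<forall>j\<in>I. \<not> int p dvd m + j)"
proof -
  have "Legendre k (int p) \<in> {-1, 1} \<longleftrightarrow> \<not> int p dvd k" for k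
    using Legendre_range[of k "int p"] Legendre_eq_0_iff[of k "int p"] by auto
  thus ?thesis unfolding legendre_pattern_def sign_patterns_def by (simp add: restrict_PiE_iff Pi_iff)
qed

context fekete_arc
begin

lemma card_arc_zeros_le_2:
  assumes m: "m \<in> {0..<int p}"
  shows "card (arc_zeros p m) \<le> 2"
proof -
  consider "m = 0" | "m = int p - 1" | "0 < m" "m + 1 < int p" using m by force
  thus ?thesis
  proof cases
    case 3
    have "\<not> int p dvd m" "\<not> int p dvd m + 1"
      using 3 zdvd_not_zless[of m "int p"] zdvd_not_zless[of "m + 1" "int p"] by auto
    hence l: "Legendre m (int p) = 1 \<or> Legendre m (int p) = -1" "Legendre (m + 1) (int p) = 1 \<or> Legendre (m + 1) (int p) = -1"
      using Legendre_range[of m "int p"] Legendre_range[of "m + 1" "int p"] Legendre_eq_0_iff by auto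
    show ?thesis
    proof (cases "Legendre (m + 1) (int p) = Legendre m (int p)")
      case True
      thus ?thesis using card_arc_zeros_equal[OF refl True] l by auto
    next
      case False
      hence "Legendre (m + 1) (int p) = - Legendre m (int p)" using l by auto
      thus ?thesis using card_arc_zeros_unequal_le[OF refl] l by auto
    qed
  qed (use card_arc_zeros_0_le card_arc_zeros_last_le in auto)
qed

text \<open>Every arc carries at most two zeros, so an arc on which the comparison with the sign pattern may fail costs at most \<open>2\<close>.\<close>

lemma arc_count_approx:
  fixes J :: nat and \<delta> \<epsilon> :: real
  assumes J: "1 \<le> J" "J \<le> c" and wJ: "w * (real J + 1) \<le> 1"
    and err: "\<epsilon> + 8 / real J + (2 * real J + 1) * (w ^ 2 * (real J + 1) / 2) \<le> \<delta>" and \<delta>: "\<delta> > 0"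
    and m: "m \<in> {0..<int p}"
  defines "q \<equiv> legendre_pattern (window J) p m"
  shows "\<bar>real (card (arc_zeros p m)) - (of_bool (q \<in> sign_patterns (window J) - sign_changes J) + 2 * of_bool (q \<in> crossing J))\<bar>
     \<le> 2 * (of_bool (q \<in> near_tangent J \<delta>) + of_bool (\<bar>far_sum J m\<bar> > \<epsilon>) + of_bool (\<exists>s\<in>window J. int p dvd m + s))"
proof -
  define n where "n = card (arc_zeros p m)"
  have n2: "n \<le> 2" unfolding n_def by (rule card_arc_zeros_le_2[OF m])
  have in01: "0 \<in> window J" "1 \<in> window J" using J by (auto simp: window_def)
  have q01: "q 0 = Legendre m (int p)" "q 1 = Legendre (m + 1) (int p)"
    unfolding q_def using legendre_pattern_apply in01 by simp_all
  have cr_sc: "crossing J \<subseteq> sign_changes J" and sc_sp: "sign_changes J \<subseteq> sign_patterns (window J)"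
    unfolding crossing_def sign_changes_def by auto
  show ?thesis
  proof (cases "q \<in> sign_patterns (window J)")
    case False
    hence "\<exists>s\<in>window J. int p dvd m + s" unfolding q_def legendre_pattern_in_sign_patterns_iff by blast
    thus ?thesis using False cr_sc sc_sp n2 unfolding n_def[symmetric] by auto
  next
    case sp: True
    have q0: "\<bar>q 0\<bar> = 1" "q 1 = q 0 \<or> q 1 = - q 0"
      using sign_patternsD[OF sp in01(1)] sign_patternsD[OF sp in01(2)] by auto
    show ?thesis
    proof (cases "q \<in> sign_changes J")
      case False
      hence "q 0 = q 1" using sp unfolding sign_changes_def by simp
      hence "Legendre (m + 1) (int p) = q 0" using q01(2) by metis
      hence "n = 1" unfolding n_def using card_arc_zeros_equal[OF q01(1)[symmetric] _ q0(1)] by blast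
      thus ?thesis using sp False cr_sc unfolding n_def[symmetric] by auto
    next
      case sc: True
      hence opp: "q 1 = - q 0" using q0(2) unfolding sign_changes_def by auto
      note s = q01(1)[symmetric] opp[unfolded q01(2)] q0(1)
      show ?thesis
      proof (cases "q \<in> near_tangent J \<delta> \<or> \<bar>far_sum J m\<bar> > \<epsilon>")
        case True
        have "\<bar>real n - (0 + 2 * of_bool (q \<in> crossing J))\<bar> \<le> 2" using n2 by (auto simp: of_bool_def)
        thus ?thesis using True sc unfolding n_def[symmetric] by (auto simp: of_bool_def)
      next
        case False
        have close: "\<bar>w * cot_sum p m x - local_sum J q x\<bar> \<le> \<delta>" if "0 < x" "x < 1" for x
          using cot_sum_approx[OF that J wJ, of m] False err unfolding q_def[symmetric] by linarith
        have sgn: "real_of_int (q 0) = 1 \<or> real_of_int (q 0) = -1" using q0(1) by linarith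
        have close': "\<bar>w * (of_int (q 0) * cot_sum p m x) - of_int (q 0) * local_sum J q x\<bar> \<le> \<delta>"
          if "0 < x" "x < 1" for x
          using close[OF that] sgn by auto
        show ?thesis
        proof (cases "q \<in> crossing J")
          case True
          then obtain x0 where x0: "x0 \<in> {0<..<1}" "of_int (q 0) * local_sum J q x0 < 0"
            unfolding crossing_def by blast
          have "\<exists>x\<in>{0<..<1}. of_int (q 0) * local_sum J q x < - \<delta>"
          proof (rule ccontr)
            assume "\<not> ?thesis"
            hence "\<forall>x\<in>{0<..<1}. - \<delta> \<le> of_int (q 0) * local_sum J q x" by force
            moreover have "\<exists>x\<in>{0<..<1}. of_int (q 0) * local_sum J q x \<le> \<delta>" using x0 \<delta> by force
            ultimately show False using False sc unfolding near_tangent_def by blast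
          qed
          then obtain x where x: "0 < x" "x < 1" "of_int (q 0) * local_sum J q x < - \<delta>" by auto
          hence "w * (of_int (q 0) * cot_sum p m x) < 0" using close'[of x] by linarith
          hence "of_int (q 0) * cot_sum p m x < 0" using w_pos by (simp add: mult_less_0_iff)
          hence "n = 2" unfolding n_def using card_arc_zeros_crossing[OF s x(1,2)] by simp
          thus ?thesis using True sc unfolding n_def[symmetric] by simp
        next
          case nc: False
          have nonneg: "of_int (q 0) * local_sum J q x \<ge> 0" if "x \<in> {0<..<1}" for x
            using nc sc that unfolding crossing_def by force
          have "cot_sum p m x \<noteq> 0" if "0 < x" "x < 1" for x
          proof -
            have "of_int (q 0) * local_sum J q x > \<delta>"
            proof (rule ccontr)
              assume "\<not> ?thesis"
              hence "\<exists>x\<in>{0<..<1}. of_int (q 0) * local_sum J q x \<le> \<delta>" using that by force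
              moreover have "\<forall>x\<in>{0<..<1}. - \<delta> \<le> of_int (q 0) * local_sum J q x" using nonneg \<delta> by force
              ultimately show False using False sc unfolding near_tangent_def by blast
            qed
            hence "w * (of_int (q 0) * cot_sum p m x) > 0" using close'[OF that] by linarith
            thus ?thesis by auto
          qed
          hence "n = 0" unfolding n_def by (rule card_arc_zeros_noncrossing)
          thus ?thesis using nc sc unfolding n_def[symmetric] by simp
        qed
      qed
    qed
  qed
qed

lemma zero_count_approx:
  fixes J :: nat and \<delta> \<epsilon> :: real
  assumes J: "1 \<le> J" "J \<le> c" and wJ: "w * (real J + 1) \<le> 1"
    and err: "\<epsilon> + 8 / real J + (2 * real J + 1) * (w ^ 2 * (real J + 1) / 2) \<le> \<delta>" and \<delta>: "\<delta> > 0" and \<epsilon>: "\<epsilon> > 0"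
  defines "N \<equiv> \<lambda>Q. real (card {m\<in>{0..<int p}. legendre_pattern (window J) p m \<in> Q})"
  shows "\<bar>real (card {z. cmod z = 1 \<and> poly (fekete_poly p) z = 0})
        - (N (sign_patterns (window J) - sign_changes J) + 2 * N (crossing J))\<bar>
     \<le> 1 + 2 * (N (near_tangent J \<delta>) + real p * (2 / (real J * \<epsilon> ^ 2)) + (2 * real J + 1))"
proof -
  define q where "q m = legendre_pattern (window J) p m" for m
  have count: "real (card {m\<in>{0..<int p}. P m}) = (\<Sum>m\<in>{0..<int p}. of_bool (P m))" for P
  proof -
    have "{0..<int p} \<inter> {m. P m} = {m\<in>{0..<int p}. P m}" by auto
    thus ?thesis by (simp add: of_bool_def sum.If_cases)
  qed
  have "real (card {z. cmod z = 1 \<and> poly (fekete_poly p) z = 0}) - (N (sign_patterns (window J) - sign_changes J) + 2 * N (crossing J))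
     = 1 + (\<Sum>m\<in>{0..<int p}. real (card (arc_zeros p m)) -
         (of_bool (q m \<in> sign_patterns (window J) - sign_changes J) + 2 * of_bool (q m \<in> crossing J)))"
    unfolding card_unit_circle_zeros(1)[OF prime_p p_gt(1)] N_def count q_def
    by (simp add: sum_subtractf sum.distrib sum_distrib_left)
  also have "\<bar>\<dots>\<bar> \<le> 1 + (\<Sum>m\<in>{0..<int p}. \<bar>real (card (arc_zeros p m)) -
         (of_bool (q m \<in> sign_patterns (window J) - sign_changes J) + 2 * of_bool (q m \<in> crossing J))\<bar>)"
    by (rule order.trans[OF abs_triangle_ineq]) (simp add: sum_abs)
  also have "\<dots> \<le> 1 + (\<Sum>m\<in>{0..<int p}. 2 * (of_bool (q m \<in> near_tangent J \<delta>) + of_bool (\<bar>far_sum J m\<bar> > \<epsilon>)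
       + of_bool (\<exists>s\<in>window J. int p dvd m + s)))"
    unfolding q_def by (intro add_left_mono sum_mono arc_count_approx[OF J wJ err \<delta>])
  also have "\<dots> = 1 + 2 * (N (near_tangent J \<delta>) + real (card {m\<in>{0..<int p}. \<bar>far_sum J m\<bar> > \<epsilon>})
       + real (card {m\<in>{0..<int p}. \<exists>s\<in>window J. int p dvd m + s}))"
    unfolding N_def count q_def by (simp add: sum.distrib sum_distrib_left)
  also have "\<dots> \<le> 1 + 2 * (N (near_tangent J \<delta>) + real p * (2 / (real J * \<epsilon> ^ 2)) + (2 * real J + 1))"
  proof -
    have "card {m\<in>{0..<int p}. \<exists>s\<in>window J. int p dvd m + s} \<le> 2 * J + 1"
      using card_residues_Ex_dvd_le[of "int p" "window J"] p_gt by (simp add: card_window)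
    hence "real (card {m\<in>{0..<int p}. \<exists>s\<in>window J. int p dvd m + s}) \<le> 2 * real J + 1" by linarith
    thus ?thesis using card_far_sum_large[OF J \<epsilon>] by simp
  qed
  finally show ?thesis .
qed

end

text \<open>One zero for every pattern without a sign change, which is half of them, and two for every crossing.\<close>

definition local_density :: "nat \<Rightarrow> real" where
  "local_density J = 1 / 2 + 2 * (real (card (crossing J)) / 2 ^ (2 * J + 1))"

definition zero_density :: "nat \<Rightarrow> real" where
  "zero_density p = real (card {z. cmod z = 1 \<and> poly (fekete_poly p) z = 0}) / real p"

lemma local_density_bounds:
  assumes J: "J \<ge> 8"
  shows "1 / 2 + 1 / 2 ^ 16 \<le> local_density J" "local_density J \<le> 1 / 2 + 18 / 49"
proof -
  have "real (2 ^ (2 * J + 1)) \<le> real (2 ^ 17 * card (crossing J))"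
    using card_crossing_ge[OF J] by (simp only: of_nat_le_iff)
  thus "1 / 2 + 1 / 2 ^ 16 \<le> local_density J" unfolding local_density_def by (simp add: field_simps)
  have "real (49 * card (crossing J)) \<le> real (18 * card (sign_changes J))"
    using card_crossing_le[of J] J by (simp only: of_nat_le_iff)
  moreover have "real (2 * card (sign_changes J)) = real (2 ^ (2 * J + 1))"
    using card_sign_changes[of J] J by simp
  ultimately show "local_density J \<le> 1 / 2 + 18 / 49" unfolding local_density_def by (simp add: field_simps)
qed

text \<open>The order of choices matters: \<open>r\<close> fixes the tolerance \<open>\<delta>\<close>, then \<open>J\<close> is taken large in terms of \<open>\<delta>\<close>, and only then
  \<open>p\<close> tends to infinity. The \<open>5\<close> is \<open>2 + 2\<close> from near-tangent patterns and large far sums, and \<open>1\<close> to spare for the limits in \<open>p\<close>.\<close>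

lemma zero_density_approx:
  obtains J0 where "\<And>J. J \<ge> J0 \<Longrightarrow> \<forall>\<^sub>F p in primes_at_top. \<bar>zero_density p - local_density J\<bar> \<le> 5 / 2 ^ r"
proof -
  define \<delta> :: real where "\<delta> = 1 / (4 * 4 ^ r)"
  define \<epsilon> :: real where "\<epsilon> = \<delta> / 4"
  have \<delta>: "\<delta> > 0" "2 * \<delta> < 1 / 4 ^ r" and \<epsilon>: "\<epsilon> > 0" unfolding \<delta>_def \<epsilon>_def by (simp_all add: field_simps)
  \<comment> \<open>The three summands serve the separation of minima, the variation of the far terms and their second moment.\<close>
  define J0 where "J0 = 4 ^ r + nat \<lceil>32 / \<delta>\<rceil> + nat \<lceil>2 * 2 ^ r / \<epsilon> ^ 2\<rceil> + 1"
  have "\<forall>\<^sub>F p in primes_at_top. \<bar>zero_density p - local_density J\<bar> \<le> 5 / 2 ^ r" if J: "J \<ge> J0" for J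
  proof -
    have J1: "J \<ge> 1" "4 ^ r \<le> J" using J unfolding J0_def by simp_all
    have "32 / \<delta> \<le> real J" using J unfolding J0_def by linarith
    hence J2: "8 / real J \<le> \<delta> / 4" using J1 \<delta> by (simp add: field_simps)
    have "2 * 2 ^ r / \<epsilon> ^ 2 \<le> real J" using J unfolding J0_def by linarith
    hence J3: "2 / (real J * \<epsilon> ^ 2) \<le> 1 / 2 ^ r" using J1 \<epsilon> by (simp add: field_simps)
    define I where "I = window J"
    define N where "N Q p = real (card {m\<in>{0..<int p}. legendre_pattern I p m \<in> Q}) / real p" for Q p
    have I: "finite I" "card I = 2 * J + 1" unfolding I_def by (simp_all add: card_window)
    have lim_N: "(N Q \<longlongrightarrow> real (card Q) / 2 ^ (2 * J + 1)) primes_at_top" if "Q \<subseteq> sign_patterns I" for Q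
      unfolding N_def using pattern_density[OF I(1) that] I(2) by simp
    define X where "X p = N (sign_patterns I - sign_changes J) p + 2 * N (crossing J) p" for p
    have "(X \<longlongrightarrow> local_density J) primes_at_top"
    proof -
      have "card (sign_patterns I - sign_changes J) = card (sign_patterns I) - card (sign_changes J)"
        by (rule card_Diff_subset[OF finite_sign_changes]) (auto simp: sign_changes_def I_def)
      hence "2 * card (sign_patterns I - sign_changes J) = 2 ^ (2 * J + 1)"
        using card_sign_changes[OF J1(1)] I by (simp add: card_sign_patterns)
      hence "real (2 * card (sign_patterns I - sign_changes J)) = real (2 ^ (2 * J + 1))" by simp
      hence half: "real (card (sign_patterns I - sign_changes J)) / 2 ^ (2 * J + 1) = 1 / 2" by simp
      have "(X \<longlongrightarrow> real (card (sign_patterns I - sign_changes J)) / 2 ^ (2 * J + 1)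
          + 2 * (real (card (crossing J)) / 2 ^ (2 * J + 1))) primes_at_top"
        unfolding X_def by (intro tendsto_intros lim_N) (auto simp: crossing_def sign_changes_def I_def)
      thus ?thesis unfolding local_density_def half .
    qed
    hence evX: "\<forall>\<^sub>F p in primes_at_top. dist (X p) (local_density J) < 1 / 2 / 2 ^ r"
      by (rule tendstoD) simp
    have inv: "((\<lambda>p. 1 / real p) \<longlongrightarrow> 0) primes_at_top"
      by (rule tendsto_primes_at_top[OF real_tendsto_divide_at_top[OF tendsto_const filterlim_real_sequentially]])
    define Y where "Y p = (1 + 2 * (2 * real J + 1)) * (1 / real p) + 2 * N (near_tangent J \<delta>) p" for p
    define b where "b = real (card (near_tangent J \<delta>)) / 2 ^ (2 * J + 1)"
    have "(Y \<longlongrightarrow> (1 + 2 * (2 * real J + 1)) * 0 + 2 * b) primes_at_top"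
      unfolding Y_def b_def by (intro tendsto_add tendsto_mult tendsto_const inv lim_N)
        (auto simp: near_tangent_def sign_changes_def I_def)
    moreover have "b \<le> 1 / 2 ^ r"
    proof -
      have "real (card (near_tangent J \<delta>) * 2 ^ r) \<le> real (2 ^ (2 * J + 1))"
        using card_near_tangent_le[OF \<delta>(2) J1(2)] by (simp only: of_nat_le_iff)
      thus ?thesis unfolding b_def by (simp add: field_simps)
    qed
    ultimately have evY: "\<forall>\<^sub>F p in primes_at_top. Y p < 2 / 2 ^ r + 1 / 2 / 2 ^ r"
      by (elim order_tendstoD(2)) (simp add: add_less_le_mono field_simps)
    have ev1: "\<forall>\<^sub>F p in primes_at_top. (real J + 1) * pi * (1 / real p) < 1"
      by (rule order_tendstoD(2)[OF tendsto_mult[OF tendsto_const inv]]) simp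
    have ev2: "\<forall>\<^sub>F p in primes_at_top. (2 * real J + 1) * (pi ^ 2 * (real J + 1) / 2) * ((1 / real p) * (1 / real p)) < \<delta> / 4"
      by (rule order_tendstoD(2)[OF tendsto_mult[OF tendsto_const tendsto_mult[OF inv inv]]]) (use \<delta> in simp)
    have ev3: "\<forall>\<^sub>F p in primes_at_top. prime p \<and> p \<ge> 2 * J + 121"
      unfolding eventually_primes_at_top by blast
    show ?thesis using evX evY ev1 ev2 ev3
    proof eventually_elim
      case (elim p)
      hence p: "prime p" "p > 2" by auto
      obtain c where c: "p = 2 * c + 1" using odd_prime_form[OF p] by blast
      interpret fekete_arc p c "pi / real p" by unfold_locales (use p c elim in auto)
      have "\<bar>real (card {z. cmod z = 1 \<and> poly (fekete_poly p) z = 0})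
        - (real (card {m\<in>{0..<int p}. legendre_pattern (window J) p m \<in> sign_patterns (window J) - sign_changes J})
           + 2 * real (card {m\<in>{0..<int p}. legendre_pattern (window J) p m \<in> crossing J}))\<bar>
        \<le> 1 + 2 * (real (card {m\<in>{0..<int p}. legendre_pattern (window J) p m \<in> near_tangent J \<delta>})
           + real p * (2 / (real J * \<epsilon> ^ 2)) + (2 * real J + 1))"
      proof (rule zero_count_approx[OF J1(1)])
        show "J \<le> c" using elim c by auto
        show "pi / real p * (real J + 1) \<le> 1" using elim by (simp add: mult_ac)
        have "(2 * real J + 1) * ((pi / real p) ^ 2 * (real J + 1) / 2) \<le> \<delta> / 4"
          using elim by (simp add: power2_eq_square mult_ac)
        thus "\<epsilon> + 8 / real J + (2 * real J + 1) * ((pi / real p) ^ 2 * (real J + 1) / 2) \<le> \<delta>"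
          using J2 \<delta> unfolding \<epsilon>_def by linarith
      qed (use \<delta> \<epsilon> in auto)
      moreover have "real p * X p =
          real (card {m\<in>{0..<int p}. legendre_pattern (window J) p m \<in> sign_patterns (window J) - sign_changes J})
           + 2 * real (card {m\<in>{0..<int p}. legendre_pattern (window J) p m \<in> crossing J})"
        using p unfolding X_def N_def I_def by (simp add: distrib_left)
      moreover have "real p * (Y p + 2 * (2 / (real J * \<epsilon> ^ 2))) =
          1 + 2 * (real (card {m\<in>{0..<int p}. legendre_pattern (window J) p m \<in> near_tangent J \<delta>})
           + real p * (2 / (real J * \<epsilon> ^ 2)) + (2 * real J + 1))"
        using p unfolding Y_def N_def I_def by (simp add: distrib_left add_divide_distrib)
      ultimately have "\<bar>real (card {z. cmod z = 1 \<and> poly (fekete_poly p) z = 0}) - real p * X p\<bar>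
        \<le> real p * (Y p + 2 * (2 / (real J * \<epsilon> ^ 2)))"
        by (simp only:)
      moreover have "real (card {z. cmod z = 1 \<and> poly (fekete_poly p) z = 0}) = real p * zero_density p"
        using p unfolding zero_density_def by simp
      ultimately have "real p * \<bar>zero_density p - X p\<bar> \<le> real p * (Y p + 2 * (2 / (real J * \<epsilon> ^ 2)))"
        by (simp add: abs_mult flip: right_diff_distrib)
      hence "\<bar>zero_density p - X p\<bar> \<le> Y p + 2 * (2 / (real J * \<epsilon> ^ 2))" using p by simp
      hence "\<bar>zero_density p - X p\<bar> \<le> Y p + 2 * (1 / 2 ^ r)" using J3 by linarith
      thus ?case using elim(1,2) unfolding dist_real_def by (simp add: abs_le_iff abs_less_iff)
    qed
  qed
  thus ?thesis using that by blast
qed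

lemma primes_at_top_not_bot: "primes_at_top \<noteq> bot"
proof
  assume "primes_at_top = bot"
  hence "\<forall>\<^sub>F p in primes_at_top. False" by simp
  then obtain N :: nat where "\<forall>p\<ge>N. prime p \<longrightarrow> False" unfolding eventually_primes_at_top by blast
  thus False using bigger_prime[of N] by (meson less_imp_le)
qed

text \<open>The approximation holds for all large \<open>J\<close>, and two values of \<open>J\<close> can be compared through a common prime; so the local
  densities form a Cauchy sequence, and their limit is the limit of the zero densities too.\<close>

lemma zero_density_converges:
  "\<exists>\<kappa>. (zero_density \<longlongrightarrow> \<kappa>) primes_at_top \<and> 1 / 2 + 1 / 2 ^ 16 \<le> \<kappa> \<and> \<kappa> \<le> 1 / 2 + 18 / 49"
proof -
  have "\<exists>J0. \<forall>J\<ge>J0. \<forall>\<^sub>F p in primes_at_top. \<bar>zero_density p - local_density J\<bar> \<le> 5 / 2 ^ r" for r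
    using zero_density_approx[of r] by metis
  then obtain J0 where J0: "\<And>r J. J \<ge> J0 r \<Longrightarrow> \<forall>\<^sub>F p in primes_at_top. \<bar>zero_density p - local_density J\<bar> \<le> 5 / 2 ^ r"
    by metis
  have small: "\<exists>r. 15 / 2 ^ r < e" if "e > 0" for e :: real
  proof -
    obtain r where "15 / e < 2 ^ r" using real_arch_pow[of 2 "15 / e"] by auto
    thus ?thesis using that by (intro exI[of _ r]) (simp add: field_simps)
  qed
  have close: "\<bar>local_density J - local_density J'\<bar> \<le> 10 / 2 ^ r" if "J \<ge> J0 r" "J' \<ge> J0 r" for r J J'
  proof -
    have "\<forall>\<^sub>F p in primes_at_top. \<bar>zero_density p - local_density J\<bar> \<le> 5 / 2 ^ r \<and> \<bar>zero_density p - local_density J'\<bar> \<le> 5 / 2 ^ r"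
      using that by (intro eventually_conj J0)
    then obtain p where "\<bar>zero_density p - local_density J\<bar> \<le> 5 / 2 ^ r" "\<bar>zero_density p - local_density J'\<bar> \<le> 5 / 2 ^ r"
      using eventually_happens'[OF primes_at_top_not_bot] by blast
    thus ?thesis by (simp add: abs_le_iff)
  qed
  have "Cauchy local_density"
  proof (rule metric_CauchyI)
    fix e :: real assume "e > 0"
    then obtain r where "15 / 2 ^ r < e" using small by blast
    moreover have "10 / (2::real) ^ r \<le> 15 / 2 ^ r" by (simp add: divide_right_mono)
    ultimately have "dist (local_density J) (local_density J') < e" if "J \<ge> J0 r" "J' \<ge> J0 r" for J J'
      using close[OF that] unfolding dist_real_def by linarith
    thus "\<exists>M. \<forall>m\<ge>M. \<forall>n\<ge>M. dist (local_density m) (local_density n) < e" by blast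
  qed
  then obtain \<kappa> where \<kappa>: "local_density \<longlonglongrightarrow> \<kappa>" using Cauchy_convergent_iff convergent_def by blast
  have "(zero_density \<longlongrightarrow> \<kappa>) primes_at_top"
  proof (rule tendstoI)
    fix e :: real assume "e > 0"
    then obtain r where r: "15 / 2 ^ r < e" using small by blast
    have "\<forall>\<^sub>F J in sequentially. dist (local_density J) \<kappa> < 5 / 2 ^ r" using \<kappa> by (rule tendstoD) simp
    moreover have "\<forall>\<^sub>F J in sequentially. J \<ge> J0 r" by (rule eventually_ge_at_top)
    ultimately have "\<forall>\<^sub>F J in sequentially. dist (local_density J) \<kappa> < 5 / 2 ^ r \<and> J \<ge> J0 r"
      by (rule eventually_conj)
    then obtain J where J: "dist (local_density J) \<kappa> < 5 / 2 ^ r" "J \<ge> J0 r"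
      using eventually_happens'[OF sequentially_bot] by blast
    show "\<forall>\<^sub>F p in primes_at_top. dist (zero_density p) \<kappa> < e"
      using J0[OF J(2)]
    proof eventually_elim
      case (elim p)
      have "5 / 2 ^ r + 5 / 2 ^ r \<le> 15 / (2::real) ^ r" by (simp add: field_simps)
      thus ?case using elim J(1) r unfolding dist_real_def by linarith
    qed
  qed
  moreover have "1 / 2 + 1 / 2 ^ 16 \<le> \<kappa>"
    by (rule LIMSEQ_le_const[OF \<kappa>]) (use local_density_bounds(1) in blast)
  moreover have "\<kappa> \<le> 1 / 2 + 18 / 49"
    by (rule LIMSEQ_le_const2[OF \<kappa>]) (use local_density_bounds(2) in blast)
  ultimately show ?thesis by blast
qed

theorem theorem1:
  shows "\<exists>\<kappa>\<^sub>0::real. 1 > \<kappa>\<^sub>0 \<and> \<kappa>\<^sub>0 > 1 / 2 \<and>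
    (\<lambda>p::nat. real (card {z::complex. cmod z = 1 \<and> poly (fekete_poly p) z = 0}))
      \<sim>[primes_at_top] (\<lambda>p. \<kappa>\<^sub>0 * real p)"
proof -
  obtain \<kappa> where \<kappa>: "(zero_density \<longlongrightarrow> \<kappa>) primes_at_top" "1 / 2 + 1 / 2 ^ 16 \<le> \<kappa>" "\<kappa> \<le> 1 / 2 + 18 / 49"
    using zero_density_converges by blast
  have bounds: "\<kappa> < 1" "\<kappa> > 1 / 2" using \<kappa>(2,3) by simp_all
  have "(\<lambda>p. real (card {z. cmod z = 1 \<and> poly (fekete_poly p) z = 0})) \<sim>[primes_at_top] (\<lambda>p. \<kappa> * real p)"
  proof (rule asymp_equivI')
    have "((\<lambda>p. zero_density p / \<kappa>) \<longlongrightarrow> \<kappa> / \<kappa>) primes_at_top"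
      by (intro tendsto_divide \<kappa>(1) tendsto_const) (use bounds in simp)
    moreover have "zero_density p / \<kappa> = real (card {z. cmod z = 1 \<and> poly (fekete_poly p) z = 0}) / (\<kappa> * real p)" for p
      unfolding zero_density_def by simp
    ultimately show "((\<lambda>p. real (card {z. cmod z = 1 \<and> poly (fekete_poly p) z = 0}) / (\<kappa> * real p)) \<longlongrightarrow> 1) primes_at_top"
      using bounds by simp
  qed
  thus ?thesis using bounds by blast
qed

end
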